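(* Let $m\ge1$ be an integer, $f(z)=\sum_{n\ge0}a_n z^{-n/m}\in\mathbb{C}[[z^{-1/m}]]$ a Gevrey-1 series, and $\widetilde f(\zeta)=\sum_{n\ge1}\frac{a_n\zeta^{n/m-1}}{\Gamma(n/m)}\in\zeta^{-1+\frac1m}\mathbb{C}\{\zeta^{1/m}\}$ its Borel transform. For $l=1,\dots,m$ let $f_l(w)=\sum_{j\ge1}a_{l,j}w^{-j}$ with $a_{l,j}=a_{l+m(j-1)}$, and $\widetilde{f_l}(\xi)=\sum_{j\ge1}\frac{a_{l,j}\xi^{j-1}}{(j-1)!}$ its Borel transform. The following are equivalent: (1) There exists $r>0$ such that $\widetilde f$ extends analytically to $\mathcal{D}_r^\star$, and there exist $A>0$, $B>0$ with $|\widetilde f(\zeta)\zeta^{\frac{m-1}{m}}|\le Ae^{B|\zeta|}$ for all $\zeta\in\mathcal{D}_r^\star$. (2) There exist $r>0$, $B>0$, constants $A_l>0$ ($1\le l\le m$) and functions $\mathrm{S}_0f_l(w)$ holomorphic on $\{w\in\mathbb{C}:\Re w>B\}$ such that for all $w$ with $\Re w>B$, all $n\ge1$ and all $1\le l\le m$, $$\Big|\mathrm{S}_0f_l(w)-\sum_{j=1}^n\frac{a_{l,j}}{w^j}\Big|\le R_{as}(r,A_l,B,n,w),\qquad R_{as}(r,A,B,n,w)=Ae^{Br}\frac{n!}{r^n}\frac{1}{|w|^n(\Re(w)-B)}.$$ Moreover, in this situation, for $\Re(w)>B$, $\mathrm{S}_0f_l(w)=\int_0^\infty\widetilde{f_l}(\xi)e^{-w\xi}\,d\xi$;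 for $z\in P(B)$, $$\mathrm{S}_0f(z):=a_0+\int_0^\infty\widetilde f(\zeta)e^{-z\zeta}\,d\zeta=a_0+\sum_{l=1}^m z^{\frac{m-l}{m}}\,\mathrm{S}_0f_l(\dot z);$$ and for all $z\in P(B)$ and $n\ge1$, $$\Big|\mathrm{S}_0f(z)-\sum_{k=0}^{mn}\frac{a_k}{z^{k/m}}\Big|\le C e^{Br}\frac{n!}{r^n}\,\frac{\sum_{i=0}^{m-1}|z|^{i/m}}{|z|^n(\Re(\dot z)-B)},\qquad C=\max_{1\le l\le m}A_l.$$
   Context: $\mathbb{C}_m^\star$ is the $m$-sheeted covering of $\mathbb{C}^\star$ (Riemann surface of $X^{1/m}$ without the origin): a point $x$ is a pair $(|x|,\arg x)$ with $|x|>0$, $\arg x\in\mathbb{R}/2\pi m\mathbb{Z}$, with projection $\pi(x)=\dot x=|x|e^{i\arg x}$; $|\arg x|$ refers to the representative in $]-m\pi,m\pi]$. For $k\in\mathbb{Z}$, $x^{k/m}$ has modulus $|x|^{k/m}$ and argument $\frac km\arg x$; complex values are read via $\pi$ (e.g. $e^{-z\zeta}=e^{-\dot z\dot\zeta}$). For $r>0$, $\mathcal{B}_r=\{\zeta\in\mathbb{C}:d(\zeta,\mathbb{R}^+)<r\}$ (Euclidean distance), $\mathcal{B}_r^\star=\mathcal{B}_r\setminus\{0\}$, and $\mathcal{D}_r^\star=\pi^{-1}(\mathcal{B}_r^\star)\subset\mathbb{C}_m^\star$. $P(B)=\{z\in\mathbb{C}_m^\star:|\arg z|\le\pi/2,\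 \Re(\dot z)>B\}$. A series $\sum a_nz^{-n/m}$ is Gevrey-1 if $|a_n|\le CK^n\Gamma(1+n/m)$ for some constants. Laplace integrals are taken along the ray of argument $0$. *)

theory Defs
  imports "HOL-Analysis.Analysis"
begin

text \<open>Convention: a point x of the m-sheeted covering C_m^* is represented by the
  nonzero complex number u = x^(1/m) (modulus |x|^(1/m), argument arg x / m).
  This is a biholomorphism C_m^* -> C - {0}; under it the projection is u^m,
  |x| = |u|^m, x^(k/m) = u^k, and the representative of arg x in ]-m pi, m pi]
  is m * Arg u.\<close>

definition gevrey1 :: "nat \<Rightarrow> (nat \<Rightarrow> complex) \<Rightarrow> bool" where
  "gevrey1 m a \<longleftrightarrow> (\<exists>C K. \<forall>n. norm (a n) \<le> C * K ^ n * Gamma (1 + real n / real m))"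

definition Bset :: "real \<Rightarrow> complex set" where
  "Bset r = {\<zeta>. infdist \<zeta> (complex_of_real ` {0..}) < r}"

definition Dset :: "nat \<Rightarrow> real \<Rightarrow> complex set" where
  "Dset m r = {u. u \<noteq> 0 \<and> u ^ m \<in> Bset r}"

definition Pset :: "nat \<Rightarrow> real \<Rightarrow> complex set" where
  "Pset m B = {u. u \<noteq> 0 \<and> \<bar>real m * Arg u\<bar> \<le> pi / 2 \<and> Re (u ^ m) > B}"

text \<open>Borel transform of f, in the u-coordinate:
  sum_{n>=1} a_n zeta^(n/m - 1) / Gamma(n/m) = sum_{n>=1} a_n u^(n-m) / Gamma(n/m).\<close>
definition borel_germ :: "nat \<Rightarrow> (nat \<Rightarrow> complex) \<Rightarrow> complex \<Rightarrow> complex" where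
  "borel_germ m a u =
     (\<Sum>n. a (Suc n) * u ^ n / complex_of_real (Gamma (real (Suc n) / real m))) / u ^ (m - 1)"

definition sub_coeff :: "nat \<Rightarrow> (nat \<Rightarrow> complex) \<Rightarrow> nat \<Rightarrow> nat \<Rightarrow> complex" where
  "sub_coeff m a l j = a (l + m * (j - 1))"

definition borel_sub :: "nat \<Rightarrow> (nat \<Rightarrow> complex) \<Rightarrow> nat \<Rightarrow> complex \<Rightarrow> complex" where
  "borel_sub m a l \<xi> = (\<Sum>j. sub_coeff m a l (Suc j) * \<xi> ^ j / of_nat (fact j))"

definition Ras :: "real \<Rightarrow> real \<Rightarrow> real \<Rightarrow> nat \<Rightarrow> complex \<Rightarrow> real" where
  "Ras r A B n w = A * exp (B * r) * fact n / r ^ n * (1 / (norm w ^ n * (Re w - B)))"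

definition cond1 :: "nat \<Rightarrow> (nat \<Rightarrow> complex) \<Rightarrow> bool" where
  "cond1 m a \<longleftrightarrow> (\<exists>r>0. \<exists>F. F holomorphic_on Dset m r
      \<and> (\<exists>\<epsilon>>0. \<forall>u. u \<noteq> 0 \<and> norm u < \<epsilon> \<longrightarrow> F u = borel_germ m a u)
      \<and> (\<exists>A>0. \<exists>B>0. \<forall>u\<in>Dset m r. norm (F u * u ^ (m - 1)) \<le> A * exp (B * norm u ^ m)))"

definition cond2_data :: "nat \<Rightarrow> (nat \<Rightarrow> complex) \<Rightarrow> real \<Rightarrow> real \<Rightarrow> (nat \<Rightarrow> real)
    \<Rightarrow> (nat \<Rightarrow> complex \<Rightarrow> complex) \<Rightarrow> bool" where
  "cond2_data m a r B A S \<longleftrightarrow> r > 0 \<and> B > 0 \<and> (\<forall>l\<in>{1..m}. A l > 0)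
      \<and> (\<forall>l\<in>{1..m}. S l holomorphic_on {w. Re w > B})
      \<and> (\<forall>w n l. Re w > B \<longrightarrow> n \<ge> 1 \<longrightarrow> l \<in> {1..m} \<longrightarrow>
           norm (S l w - (\<Sum>j=1..n. sub_coeff m a l j / w ^ j)) \<le> Ras r (A l) B n w)"

definition cond2 :: "nat \<Rightarrow> (nat \<Rightarrow> complex) \<Rightarrow> bool" where
  "cond2 m a \<longleftrightarrow> (\<exists>r B A S. cond2_data m a r B A S)"

end

theory Submission
  imports Defs "HOL-Complex_Analysis.Complex_Analysis" "HOL-Real_Asymp.Real_Asymp"
begin

text \<open>
  In the coordinate \<open>u\<close>, multiplying the Borel transform of \<open>f\<close> by \<open>u ^ (m - 1)\<close> and splitting it into residue classes
  modulo \<open>m\<close> gives functions \<open>\<psi>\<^sub>l(u ^ m)\<close> with coefficients \<open>a\<^bsub>l+mj\<^esub> / \<Gamma>(j + l/m)\<close>, while the Borel transform of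
  \<open>f\<^sub>l\<close> has coefficients \<open>a\<^bsub>l+mj\<^esub> / j!\<close>. The two are exchanged by Euler (Beta) integrals combined with
  a first-order differential operator, which preserve holomorphy and exponential growth on
  neighbourhoods of the half-line. This reduces the theorem to the case \<open>m = 1\<close>.

  For \<open>m = 1\<close>, the estimate follows from the growth condition by repeated integration by parts and
  Cauchy's inequalities. Conversely (Nevanlinna's theorem), the inverse Laplace integral of \<open>S\<close>
  along a vertical line has derivatives of order \<open>k\<close> bounded by \<open>M e\<^bsup>bx\<^esup> k! / (r/2) ^ k\<close>, hence extends to a
  neighbourhood of the half-line; Cauchy's formula for the half-plane identifies its Laplace
  transform with \<open>S\<close>. Finally, \<open>t\<^bsup>l/m - 1\<^esup> \<psi>\<^sub>l(t)\<close> is up to a Gamma factor the derivative of a convolution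
  with \<open>t\<^bsup>l/m - 1\<^esup>\<close>, which yields the factor \<open>z\<^bsup>(m - l)/m\<^esup>\<close>.
\<close>

section \<open>Integrals over the line and the half-line\<close>

text \<open>The identities for a given \<open>cond2_data\<close> are claimed on the full half-plane
  Re w > B with that same \<open>B\<close>, whereas a derivative, a factor \<xi> or the choice of a
  contour each cost a little growth. Growth is therefore recorded as rate b for every b > B, with a
  constant depending on b. This loses nothing in \<open>B\<close>; only the width of the
  neighbourhood shrinks: from r to r/2 when the factor (k+1)(k+2) of a truncation of order k+2 is
  absorbed, then to r/4 for the geometric series and to r/8 for Cauchy's inequality. The inverse
  Laplace integrand decays only like 1/|v|, which is not absolutely integrable. Subtracting at least
  two terms of the expansion makes every line integral converge absolutely, and the subtracted terms
  have explicit transforms. A further obstacle is the branching of the m-th root at 0: the residue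
  classes can be separated by averaging over the sheets only away from 0, and have to be glued to
  convergent series near 0.\<close>

lemma integral_FTC_real_line:
  fixes F f :: "real \<Rightarrow> complex"
  assumes "\<And>x. (F has_vector_derivative f x) (at x)" "\<And>x. isCont f x" "integrable lborel f"
    and "(F \<longlongrightarrow> A) at_bot" "(F \<longlongrightarrow> B) at_top"
  shows "(\<integral>x. f x \<partial>lborel) = B - A"
proof -
  have "(LBINT x=-\<infinity>..\<infinity>. f x) = B - A"
    using assms
    by (intro interval_integral_FTC_integrable[where F = F])
       (auto simp: ereal_tendsto_simps1 set_integrable_def)
  then show ?thesis
    by (simp add: interval_integral_to_infinity_eq interval_lebesgue_integral_def set_lebesgue_integral_def)
qed

lemma set_integral_FTC_half_line:
  fixes F f :: "real \<Rightarrow> complex"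
  assumes "\<And>x. x > 0 \<Longrightarrow> (F has_vector_derivative f x) (at x)" "\<And>x. x > 0 \<Longrightarrow> isCont f x"
    and "set_integrable lborel {0<..} f"
    and "(F \<longlongrightarrow> A) (at_right 0)" "(F \<longlongrightarrow> B) at_top"
  shows "(LINT x:{0<..}|lborel. f x) = B - A"
proof -
  have e: "einterval 0 \<infinity> = {0<..}"
    by (auto simp: einterval_def)
  have "(LBINT x=0..\<infinity>. f x) = B - A"
    using assms
    by (intro interval_integral_FTC_integrable[where F = F])
       (auto simp: ereal_tendsto_simps1 e zero_ereal_def)
  then show ?thesis
    by (simp add: interval_lebesgue_integral_def e)
qed

lemma has_integral_set_integral:
  fixes f :: "real \<Rightarrow> complex"
  assumes "set_integrable lborel S f"
  shows "(f has_integral (LINT x:S|lborel. f x)) S"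
  using set_borel_integral_eq_integral[OF assms] by (simp add: integrable_integral)

lemma integrable_inverse_1_plus_square: "integrable lborel (\<lambda>y::real. 1 / (1 + y\<^sup>2))"
  and integral_inverse_1_plus_square: "(\<integral>y. 1 / (1 + y\<^sup>2) \<partial>lborel) = pi"
proof -
  have ne: "1 + x * x \<noteq> (0::real)" for x
    by (metis add_pos_nonneg less_irrefl zero_le_square zero_less_one)
  have D: "(arctan has_real_derivative 1 / (1 + y\<^sup>2)) (at y)" for y
    by (auto intro!: derivative_eq_intros simp: divide_inverse)
  have C: "isCont (\<lambda>y. 1 / (1 + y\<^sup>2)) x" for x :: real
    using ne[of x] by (intro continuous_intros) (simp add: power2_eq_square)
  have L: "((arctan \<circ> real_of_ereal) \<longlongrightarrow> - (pi / 2)) (at_right (-\<infinity>))"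
    "((arctan \<circ> real_of_ereal) \<longlongrightarrow> pi / 2) (at_left \<infinity>)"
    using tendsto_arctan_at_top tendsto_arctan_at_bot by (simp_all add: ereal_tendsto_simps1)
  have "set_integrable lborel (einterval (-\<infinity>) \<infinity>) (\<lambda>y::real. 1 / (1 + y\<^sup>2))"
    "(LBINT y=-\<infinity>..\<infinity>. 1 / (1 + y\<^sup>2)) = pi / 2 - (- (pi / 2))"
    using interval_integral_FTC_nonneg[OF _ D C _ L] by auto
  then show "integrable lborel (\<lambda>y::real. 1 / (1 + y\<^sup>2))" "(\<integral>y. 1 / (1 + y\<^sup>2) \<partial>lborel) = pi"
    by (simp_all add: set_integrable_def interval_lebesgue_integral_def set_lebesgue_integral_def)
qed

lemma integrable_inverse_c_plus_square:
  fixes c :: real assumes "c > 0"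
  shows "integrable lborel (\<lambda>y::real. 1 / (c\<^sup>2 + y\<^sup>2))"
    and "(\<integral>y. 1 / (c\<^sup>2 + y\<^sup>2) \<partial>lborel) = pi / c"
proof -
  have eq: "1 / (c\<^sup>2 + (0 + c * y)\<^sup>2) = (1 / c\<^sup>2) * (1 / (1 + y\<^sup>2))" for y :: real
    by (simp add: power_mult_distrib flip: distrib_left)
       (metis distrib_left mult.right_neutral)
  have "integrable lborel (\<lambda>y::real. 1 / (c\<^sup>2 + (0 + c * y)\<^sup>2))"
    unfolding eq using integrable_inverse_1_plus_square by (rule integrable_mult_right)
  then show "integrable lborel (\<lambda>y::real. 1 / (c\<^sup>2 + y\<^sup>2))"
    using lborel_integrable_real_affine_iff[of c "\<lambda>y. 1 / (c\<^sup>2 + y\<^sup>2)" 0] assms by simp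
  have "(\<integral>y. 1 / (c\<^sup>2 + y\<^sup>2) \<partial>lborel) = c * (\<integral>y. 1 / (c\<^sup>2 + (0 + c * y)\<^sup>2) \<partial>lborel)"
    using lborel_integral_real_affine[of c "\<lambda>y. 1 / (c\<^sup>2 + y\<^sup>2)" 0] assms by simp
  also have "\<dots> = c * ((1 / c\<^sup>2) * pi)"
    unfolding eq by (subst integral_mult_right_zero) (simp add: integral_inverse_1_plus_square)
  finally show "(\<integral>y. 1 / (c\<^sup>2 + y\<^sup>2) \<partial>lborel) = pi / c"
    using assms by (simp add: power2_eq_square)
qed

section \<open>Norm bounds and differentiation under the integral sign\<close>

lemma norm_lebesgue_integral_le:
  fixes f :: "_ \<Rightarrow> 'a::{banach,second_countable_topology}"
  assumes "integrable M g" "\<And>t. t \<in> space M \<Longrightarrow> norm (f t) \<le> g t"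
  shows "norm (\<integral>t. f t \<partial>M) \<le> (\<integral>t. g t \<partial>M)"
proof (cases "integrable M f")
  case True
  have "norm (\<integral>t. f t \<partial>M) \<le> (\<integral>t. norm (f t) \<partial>M)"
    by (rule integral_norm_bound)
  also have "\<dots> \<le> (\<integral>t. g t \<partial>M)"
    using assms True by (intro integral_mono) auto
  finally show ?thesis .
next
  case False
  \<comment> \<open>A non-integrable \<open>f\<close> has Bochner integral 0, so only the sign of
    the right-hand side is at stake, and \<open>g\<close> dominates a norm.\<close>
  have "0 \<le> (\<integral>t. g t \<partial>M)"
    using assms(2) norm_ge_zero order_trans by (intro integral_nonneg_AE AE_I2) blast
  with False show ?thesis by (simp add: not_integrable_integral_eq)
qed

text \<open>Integrating a Taylor remainder that is quadratic with an integrable coefficient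
  \<open>C t\<close> leaves a remainder O(|y - x|^2). One form serves real and complex
  differentiation: in \<open>w\<close> for Laplace integrals, in \<open>x\<close> for line
  integrals, in \<xi> for Euler integrals.\<close>

lemma has_derivative_integral_of_quadratic_bound:
  fixes f :: "'b \<Rightarrow> 'a::real_normed_vector \<Rightarrow> 'c::{banach,second_countable_topology}"
  assumes int: "\<And>x. x \<in> S \<Longrightarrow> integrable M (\<lambda>t. f t x)"
    and int': "\<And>h. integrable M (\<lambda>t. f' t h)"
    and bl: "bounded_linear (\<lambda>h. \<integral>t. f' t h \<partial>M)"
    and C: "integrable M C" and x: "x \<in> S" and "\<delta> > 0"
    and bound: "\<And>t y. y \<in> S \<Longrightarrow> norm (y - x) < \<delta> \<Longrightarrow> t \<in> space M \<Longrightarrow>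
      norm (f t y - f t x - f' t (y - x)) \<le> C t * norm (y - x) ^ 2"
  shows "((\<lambda>x. \<integral>t. f t x \<partial>M) has_derivative (\<lambda>h. \<integral>t. f' t h \<partial>M)) (at x within S)"
proof -
  define K where "K = (\<integral>t. C t \<partial>M)"
  have est: "norm ((\<integral>t. f t y \<partial>M) - (\<integral>t. f t x \<partial>M) - (\<integral>t. f' t (y - x) \<partial>M)) \<le> K * norm (y - x) ^ 2"
    if "y \<in> S" "norm (y - x) < \<delta>" for y
  proof -
    have "(\<integral>t. f t y \<partial>M) - (\<integral>t. f t x \<partial>M) - (\<integral>t. f' t (y - x) \<partial>M)
        = (\<integral>t. f t y - f t x - f' t (y - x) \<partial>M)"
      using that x by (simp add: int int')
    also have "norm \<dots> \<le> (\<integral>t. C t * norm (y - x) ^ 2 \<partial>M)"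
      using that x C bound
      by (intro norm_lebesgue_integral_le Bochner_Integration.integrable_mult_left) auto
    also have "\<dots> = K * norm (y - x) ^ 2"
      by (simp add: K_def)
    finally show ?thesis .
  qed
  show ?thesis
    unfolding has_derivative_within_alt2
  proof (intro conjI allI impI bl)
    fix e :: real assume "e > 0"
    have K: "\<bar>K\<bar> + 1 > 0" by simp
    have "eventually (\<lambda>y. y \<in> S \<and> dist y x < min \<delta> (e / (\<bar>K\<bar> + 1))) (at x within S)"
      using \<open>e > 0\<close> \<open>\<delta> > 0\<close> by (auto simp: eventually_at intro!: exI[of _ "min \<delta> (e / (\<bar>K\<bar> + 1))"])
    then show "eventually (\<lambda>y. norm ((\<integral>t. f t y \<partial>M) - (\<integral>t. f t x \<partial>M) - (\<integral>t. f' t (y - x) \<partial>M))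
        \<le> e * norm (y - x)) (at x within S)"
    proof eventually_elim
      case (elim y)
      have "K * norm (y - x) \<le> (\<bar>K\<bar> + 1) * norm (y - x)"
        by (intro mult_right_mono) auto
      also have "\<dots> \<le> e"
        using elim K by (simp add: dist_norm field_simps)
      finally have "K * norm (y - x) * norm (y - x) \<le> e * norm (y - x)"
        by (intro mult_right_mono) auto
      with est[of y] elim show ?case
        by (auto simp: dist_norm power2_eq_square mult.assoc)
    qed
  qed
qed

text \<open>Only \<open>Re z\<close> enters the exponential, because \<open>exp\<close> is bounded
  by exp |Re z| on the segment from 0 to \<open>z\<close>. On a vertical line the imaginary part is
  unbounded, so a factor exp |z| would destroy integrability.\<close>

lemma norm_exp_minus_one_minus_le_Re:
  fixes z :: complex
  shows "norm (exp z - 1 - z) \<le> norm z ^ 2 * exp \<bar>Re z\<bar>"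
proof -
  have "norm (exp z - (\<Sum>i\<le>1. exp 0 * (z - 0)^i / fact i)) \<le> exp \<bar>Re z\<bar> * norm (z - 0) ^ Suc 1 / fact 1"
  proof (rule complex_Taylor[where S = "closed_segment 0 z" and f = "\<lambda>_. exp"])
    fix x :: complex assume "x \<in> closed_segment 0 z"
    then obtain u where u: "0 \<le> u" "u \<le> 1" "x = u *\<^sub>R z"
      by (auto simp: closed_segment_def)
    have "u * Re z \<le> \<bar>u * Re z\<bar>" by simp
    also have "\<dots> \<le> 1 * \<bar>Re z\<bar>"
      unfolding abs_mult using u by (intro mult_right_mono) auto
    finally show "norm (exp x) \<le> exp \<bar>Re z\<bar>"
      by (simp add: u)
  qed (auto intro!: derivative_eq_intros)
  then show ?thesis
    by (simp add: algebra_simps power2_eq_square numeral_2_eq_2)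
qed

corollary norm_exp_minus_one_minus_le:
  fixes z :: complex
  shows "norm (exp z - 1 - z) \<le> norm z ^ 2 * exp (norm z)"
proof -
  have "norm z ^ 2 * exp \<bar>Re z\<bar> \<le> norm z ^ 2 * exp (norm z)"
    by (intro mult_left_mono) (auto simp: abs_Re_le_cmod)
  then show ?thesis
    using norm_exp_minus_one_minus_le_Re[of z] by linarith
qed

section \<open>The Laplace transform\<close>

text \<open>As a Lebesgue integral it is 0 when the integrand is not integrable; integrability is
  therefore proved separately wherever a value of \<open>laplace\<close> becomes a
  \<open>has_integral\<close> statement.\<close>

definition laplace :: "(real \<Rightarrow> complex) \<Rightarrow> complex \<Rightarrow> complex" where
  "laplace h w = (LINT t:{0<..}|lborel. h t * exp (- (w * of_real t)))"

lemma set_integrable_powr_exp: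
  fixes \<alpha> c :: real
  assumes "\<alpha> > 0" "c > 0"
  shows "set_integrable lborel {0<..} (\<lambda>t. t powr (\<alpha> - 1) * exp (- (c * t)))"
proof -
  let ?f = "\<lambda>t. complex_of_real t powr (complex_of_real \<alpha> - 1) / of_real (exp (c * t))"
  have "set_integrable lebesgue {0<..} (\<lambda>t. norm (?f t))"
    using absolutely_integrable_Gamma_integral[of "of_real \<alpha>" c] assms
    by (intro set_integrable_norm) auto
  also have "?this \<longleftrightarrow> set_integrable lebesgue {0<..} (\<lambda>t. t powr (\<alpha> - 1) * exp (- (c * t)))"
    by (intro set_integrable_cong)
       (auto simp: norm_mult norm_inverse norm_powr_real_powr exp_minus divide_inverse)
  finally have I: "integrable lebesgue (\<lambda>t. indicator {0<..} t *\<^sub>R (t powr (\<alpha> - 1) * exp (- (c * t))))"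
    by (simp add: set_integrable_def)
  \<comment> \<open>The Gamma integral is available for the completed measure; Borel measurability
    carries its integrability over to \<open>lborel\<close>.\<close>
  have "(\<lambda>t. indicator {0<..} t *\<^sub>R (t powr (\<alpha> - 1) * exp (- (c * t)))) \<in> borel_measurable lborel"
    by measurable
  with I show ?thesis
    unfolding set_integrable_def by (subst (asm) integrable_completion) auto
qed

lemma set_integrable_dominated_powr_exp:
  fixes f :: "real \<Rightarrow> complex"
  assumes "\<alpha> > 0" "c > 0" "continuous_on {0<..} f"
    and "\<And>t. t > 0 \<Longrightarrow> norm (f t) \<le> M * (t powr (\<alpha> - 1) * exp (- (c * t)))"
  shows "set_integrable lborel {0<..} f"
proof -
  have "set_integrable lborel {0<..} (\<lambda>t. M * (t powr (\<alpha> - 1) * exp (- (c * t))))"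
    using set_integrable_powr_exp[OF assms(1,2)] by (rule set_integrable_mult_right)
  moreover have "(\<lambda>t. indicator {0<..} t *\<^sub>R f t) \<in> borel_measurable borel"
    by (intro borel_measurable_continuous_on_indicator assms) auto
  ultimately show ?thesis
    unfolding set_integrable_def
    by (elim Bochner_Integration.integrable_bound)
       (use assms(4) in \<open>auto simp: indicator_def intro!: AE_I2 order_trans[OF _ abs_ge_self]\<close>)
qed

lemma set_integrable_laplace:
  fixes h :: "real \<Rightarrow> complex"
  assumes "\<alpha> > 0" "Re w > b" "continuous_on {0<..} h"
    and "\<And>t. t > 0 \<Longrightarrow> norm (h t) \<le> M * (t powr (\<alpha> - 1) * exp (b * t))"
  shows "set_integrable lborel {0<..} (\<lambda>t. h t * exp (- (w * of_real t)))"
proof (rule set_integrable_dominated_powr_exp)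
  fix t :: real assume t: "t > 0"
  have "norm (h t * exp (- (w * of_real t))) = norm (h t) * exp (- (Re w * t))"
    by (simp add: norm_mult)
  also have "\<dots> \<le> M * (t powr (\<alpha> - 1) * exp (b * t)) * exp (- (Re w * t))"
    using assms(4)[OF t] by (intro mult_right_mono) auto
  also have "\<dots> = M * (t powr (\<alpha> - 1) * exp (- ((Re w - b) * t)))"
    by (simp add: algebra_simps flip: exp_add)
  finally show "norm (h t * exp (- (w * of_real t))) \<le> M * (t powr (\<alpha> - 1) * exp (- ((Re w - b) * t)))" .
qed (use assms in \<open>auto intro!: continuous_intros\<close>)

lemma tendsto_exp_minus_at_top:
  fixes z :: complex
  assumes "Re z > 0"
  shows "((\<lambda>t. exp (- (z * of_real t))) \<longlongrightarrow> 0) at_top"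
proof (rule tendsto_norm_zero_cancel)
  have "((\<lambda>t. exp (- (Re z * t))) \<longlongrightarrow> 0) at_top"
    using assms by real_asymp
  then show "((\<lambda>t. norm (exp (- (z * of_real t)))) \<longlongrightarrow> 0) at_top"
    by simp
qed

lemma laplace_one:
  assumes "Re z > 0"
  shows "set_integrable lborel {0<..} (\<lambda>t. exp (- (z * of_real t)))"
    and "(LINT t:{0<..}|lborel. exp (- (z * of_real t))) = 1 / z"
proof -
  show I: "set_integrable lborel {0<..} (\<lambda>t. exp (- (z * of_real t)))"
    using set_integrable_laplace[of 1 0 z "\<lambda>_. 1" 1] assms by simp
  have "(LINT t:{0<..}|lborel. exp (- (z * of_real t))) = 0 - (- (1 / z))"
  proof (rule set_integral_FTC_half_line[where F = "\<lambda>t. - (exp (- (z * of_real t)) / z)", OF _ _ I])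
    show "((\<lambda>t. - (exp (- (z * of_real t)) / z)) has_vector_derivative exp (- (z * of_real x))) (at x)" for x
      using assms by (auto intro!: derivative_eq_intros has_vector_derivative_real_field)
    have "((\<lambda>t. - (exp (- (z * of_real t)) / z)) \<longlongrightarrow> - (exp (- (z * of_real 0)) / z)) (at_right 0)"
      using assms by (intro tendsto_intros) auto
    then show "((\<lambda>t. - (exp (- (z * of_real t)) / z)) \<longlongrightarrow> - (1 / z)) (at_right 0)"
      by simp
    show "((\<lambda>t. - (exp (- (z * of_real t)) / z)) \<longlongrightarrow> 0) at_top"
      using tendsto_minus[OF tendsto_divide_zero[OF tendsto_exp_minus_at_top[OF assms], of z]] by simp
  qed (auto intro!: continuous_intros)
  then show "(LINT t:{0<..}|lborel. exp (- (z * of_real t))) = 1 / z"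
    by simp
qed

lemma norm_laplace_le:
  assumes "Re w > b"
    and "\<And>t. t > 0 \<Longrightarrow> norm (h t) \<le> M * exp (b * t)"
  shows "norm (laplace h w) \<le> M / (Re w - b)"
proof -
  let ?g = "\<lambda>t. indicator {0<..} t *\<^sub>R (M * exp (- ((Re w - b) * t)))"
  have "set_integrable lborel {0<..} (\<lambda>t. M * exp (- ((Re w - b) * t)))"
    using set_integrable_norm[OF laplace_one(1)[of "of_real (Re w - b)"]] assms(1)
    by (intro set_integrable_mult_right) simp
  then have I: "integrable lborel ?g"
    by (simp add: set_integrable_def)
  have "norm (laplace h w) \<le> (\<integral>t. ?g t \<partial>lborel)"
    unfolding laplace_def set_lebesgue_integral_def
  proof (rule norm_lebesgue_integral_le[OF I])
    fix t :: real
    show "norm (indicator {0<..} t *\<^sub>R (h t * exp (- (w * of_real t)))) \<le> ?g t"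
    proof (cases "t > 0")
      case True
      have "norm (h t * exp (- (w * of_real t))) \<le> M * exp (b * t) * exp (- (Re w * t))"
        unfolding norm_mult using assms(2)[OF True]
        by (intro mult_mono) (auto intro: order_trans[OF norm_ge_zero])
      with True show ?thesis
        by (simp add: algebra_simps flip: exp_add)
    qed auto
  qed
  also have "\<dots> = M * (LINT t:{0<..}|lborel. exp (- ((Re w - b) * t)))"
    by (simp add: set_lebesgue_integral_def mult.left_commute)
  also have "(LINT t:{0<..}|lborel. exp (- ((Re w - b) * t))) = 1 / (Re w - b)"
  proof -
    have "complex_of_real (LINT t:{0<..}|lborel. exp (- ((Re w - b) * t)))
        = (LINT t:{0<..}|lborel. exp (- (of_real (Re w - b) * of_real t)))"
      by (subst set_integral_complex_of_real[symmetric])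
         (simp only: exp_of_real[symmetric] of_real_minus of_real_mult)
    also have "\<dots> = of_real (1 / (Re w - b))"
      using laplace_one(2)[of "of_real (Re w - b)"] assms(1) by simp
    finally show ?thesis
      by (simp only: of_real_eq_iff)
  qed
  finally show ?thesis by simp
qed

text \<open>Integration by parts: a growth rate \<open>b\<close> below \<open>Re w\<close> kills the
  boundary term at infinity, and the one at 0 gives \<open>- h 0\<close>. At 0 only the limit of
  \<open>h\<close> enters, so the derivative may be one-sided there.\<close>

lemma laplace_derivative:
  assumes "Re w > b"
    and D: "\<And>t. t \<ge> 0 \<Longrightarrow> (h has_vector_derivative h' t) (at t within {0..})"
    and cont: "continuous_on {0..} h'"
    and bd: "\<And>t. t \<ge> 0 \<Longrightarrow> norm (h t) \<le> M * exp (b * t)"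
    and bd': "\<And>t. t \<ge> 0 \<Longrightarrow> norm (h' t) \<le> M' * exp (b * t)"
  shows "laplace h' w = w * laplace h w - h 0"
proof -
  have hc: "continuous_on {0..} h"
    unfolding continuous_on_eq_continuous_within
    using D by (auto intro: has_vector_derivative_continuous)
  let ?e = "\<lambda>t. exp (- (w * complex_of_real t))"
  have I: "set_integrable lborel {0<..} (\<lambda>t. h t * ?e t)"
    using bd by (intro set_integrable_laplace[of 1 b _ _ M] assms(1) continuous_on_subset[OF hc]) auto
  have I': "set_integrable lborel {0<..} (\<lambda>t. h' t * ?e t)"
    using bd' by (intro set_integrable_laplace[of 1 b _ _ M'] assms(1) continuous_on_subset[OF cont]) auto
  have "(LINT t:{0<..}|lborel. h' t * ?e t - w * (h t * ?e t)) = 0 - h 0"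
  proof (rule set_integral_FTC_half_line[where F = "\<lambda>t. h t * ?e t"])
    fix x :: real assume x: "x > 0"
    have *: "at x within {0..} = at x"
      using x by (intro at_within_interior) simp
    have "(h has_vector_derivative h' x) (at x)"
      using D[of x] x * by simp
    moreover have "(?e has_vector_derivative (- w * ?e x)) (at x)"
      by (auto intro!: derivative_eq_intros has_vector_derivative_real_field)
    ultimately have "((\<lambda>t. h t * ?e t) has_vector_derivative (h x * (- w * ?e x) + h' x * ?e x)) (at x)"
      by (rule has_vector_derivative_mult)
    then show "((\<lambda>t. h t * ?e t) has_vector_derivative (h' x * ?e x - w * (h x * ?e x))) (at x)"
      by (simp add: algebra_simps)
    have "isCont h x" "isCont h' x"
      using hc cont x by (auto intro!: continuous_on_interior[where S = "{0..}"])
    then show "isCont (\<lambda>t. h' t * ?e t - w * (h t * ?e t)) x"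
      by (intro continuous_intros)
  next
    show "set_integrable lborel {0<..} (\<lambda>t. h' t * ?e t - w * (h t * ?e t))"
      using I I' by (intro set_integral_diff set_integrable_mult_right) auto
    have "(h \<longlongrightarrow> h 0) (at_right 0)"
      using hc by (auto simp: continuous_on_def intro: tendsto_within_subset)
    then have "((\<lambda>t. h t * ?e t) \<longlongrightarrow> h 0 * ?e 0) (at_right 0)"
      by (intro tendsto_intros) auto
    then show "((\<lambda>t. h t * ?e t) \<longlongrightarrow> h 0) (at_right 0)"
      by simp
    have "((\<lambda>t. M * exp (- ((Re w - b) * t))) \<longlongrightarrow> 0) at_top"
      using assms(1) by real_asymp
    moreover have "eventually (\<lambda>t. norm (h t * ?e t) \<le> M * exp (- ((Re w - b) * t))) at_top"
      using eventually_ge_at_top[of 0]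
    proof eventually_elim
      case (elim t)
      have "norm (h t * ?e t) \<le> M * exp (b * t) * exp (- (Re w * t))"
        unfolding norm_mult using bd[OF elim]
        by (intro mult_mono) (auto intro: order_trans[OF norm_ge_zero])
      then show ?case by (simp add: algebra_simps flip: exp_add)
    qed
    ultimately show "((\<lambda>t. h t * ?e t) \<longlongrightarrow> 0) at_top"
      by (rule Lim_null_comparison[rotated])
  qed
  moreover have "(LINT t:{0<..}|lborel. h' t * ?e t - w * (h t * ?e t)) = laplace h' w - w * laplace h w"
    using I I' by (simp add: laplace_def set_integral_diff set_integrable_mult_right)
  ultimately show ?thesis by (simp add: algebra_simps)
qed

lemma holomorphic_laplace:
  assumes "\<alpha> > 0" "continuous_on {0<..} h"
    and bd: "\<And>t. t > 0 \<Longrightarrow> norm (h t) \<le> M * (t powr (\<alpha> - 1) * exp (b * t))"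
  shows "laplace h holomorphic_on {w. Re w > b}"
proof -
  have "\<exists>D. (laplace h has_field_derivative D) (at w within {w. Re w > b})" if w: "Re w > b" for w
  proof -
    \<comment> \<open>Half of the gap pays for moving \<open>w\<close> by less than
      \<open>d\<close>; the other half remains as the decay exp (- d t) of the majorant.\<close>
    define d where "d = (Re w - b) / 2"
    have d: "d > 0" using w by (simp add: d_def)
    let ?f = "\<lambda>t w. indicator {0<..} t *\<^sub>R (h t * exp (- (w * complex_of_real t)))"
    let ?f' = "\<lambda>t. indicator {0<..} t *\<^sub>R (- of_real t * h t * exp (- (w * complex_of_real t)))"
    \<comment> \<open>The exponent \<alpha> + 2 absorbs the factor t^2 of the second-order
      remainder.\<close>
    let ?C = "\<lambda>t. indicator {0<..} t *\<^sub>R (M * (t powr ((\<alpha> + 2) - 1) * exp (- (d * t))))"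
    have I: "integrable lborel (\<lambda>t. ?f t z)" if "Re z > b" for z
      using set_integrable_laplace[OF assms(1) that assms(2) bd] by (simp add: set_integrable_def)
    have "set_integrable lborel {0<..} (\<lambda>t. (- of_real t * h t) * exp (- (w * complex_of_real t)))"
    proof (rule set_integrable_laplace[of "\<alpha> + 1" b _ _ M])
      fix t :: real assume t: "t > 0"
      have "norm (- of_real t * h t) \<le> t * (M * (t powr (\<alpha> - 1) * exp (b * t)))"
        using bd[OF t] t by (auto simp: norm_mult)
      also have "\<dots> = M * (t powr (\<alpha> + 1 - 1) * exp (b * t))"
        using t powr_add[of t "\<alpha> - 1" 1] by simp
      finally show "norm (- of_real t * h t) \<le> M * (t powr (\<alpha> + 1 - 1) * exp (b * t))" .
    qed (use assms w in \<open>auto intro!: continuous_intros\<close>)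
    then have I': "integrable lborel ?f'"
      by (simp add: set_integrable_def)
    have C: "integrable lborel ?C"
      using set_integrable_mult_right[of M, OF set_integrable_powr_exp[of "\<alpha> + 2" d]] assms(1) d
      by (simp add: set_integrable_def)
    have "((\<lambda>z. \<integral>t. ?f t z \<partial>lborel) has_derivative (\<lambda>z. \<integral>t. ?f' t * z \<partial>lborel)) (at w within {w. Re w > b})"
    proof (rule has_derivative_integral_of_quadratic_bound[OF I _ _ C _ d])
      show "integrable lborel (\<lambda>t. ?f' t * z)" for z
        using I' by (intro integrable_mult_left) auto
      have "bounded_linear (\<lambda>z. (\<integral>t. ?f' t \<partial>lborel) * z)"
        by (rule bounded_linear_mult_right)
      then show "bounded_linear (\<lambda>z. \<integral>t. ?f' t * z \<partial>lborel)"
        by (simp only: integral_mult_left_zero)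
      fix t :: real and z assume z: "z \<in> {w. Re w > b}" "norm (z - w) < d"
      show "norm (?f t z - ?f t w - ?f' t * (z - w)) \<le> ?C t * norm (z - w) ^ 2"
      proof (cases "t > 0")
        case t: True
        have nn: "0 \<le> M * (t powr (\<alpha> - 1) * exp (b * t))"
          using bd[OF t] norm_ge_zero order_trans by blast
        let ?x = "- ((z - w) * of_real t)"
        have "exp (- (z * complex_of_real t)) = exp (- (w * complex_of_real t)) * exp ?x"
          by (simp add: algebra_simps flip: exp_add)
        then have "?f t z - ?f t w - ?f' t * (z - w) = h t * exp (- (w * complex_of_real t)) * (exp ?x - 1 - ?x)"
          using t by (simp add: algebra_simps)
        also have "norm \<dots> \<le> (M * (t powr (\<alpha> - 1) * exp (b * t))) * exp (- (Re w * t)) * (norm ?x ^ 2 * exp (norm ?x))"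
          unfolding norm_mult[of "_ * _" "exp _ - _ - _"] norm_mult[of "h t"]
          using bd[OF t] norm_exp_minus_one_minus_le[of ?x] nn
          by (intro mult_mono) auto
        also have "\<dots> \<le> (M * (t powr (\<alpha> - 1) * exp (b * t))) * exp (- (Re w * t)) * (norm ?x ^ 2 * exp (d * t))"
          using z t nn
          by (intro mult_left_mono mult_nonneg_nonneg[OF nn]) (auto simp: norm_mult)
        also have "\<dots> = M * (t powr (\<alpha> - 1) * t\<^sup>2) * (exp (b * t) * exp (- (Re w * t)) * exp (d * t)) * norm (z - w) ^ 2"
          using t by (simp add: norm_mult power_mult_distrib mult_ac)
        also have "t powr (\<alpha> - 1) * t\<^sup>2 = t powr ((\<alpha> + 2) - 1)"
          using t powr_add[of t "\<alpha> - 1" 2] by simp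
        also have "exp (b * t) * exp (- (Re w * t)) * exp (d * t) = exp (- (d * t))"
          unfolding exp_add[symmetric] by (simp add: d_def field_simps)
        finally show ?thesis using t by simp
      qed auto
    qed (use w in auto)
    then have "((\<lambda>z. \<integral>t. ?f t z \<partial>lborel) has_field_derivative (\<integral>t. ?f' t \<partial>lborel)) (at w within {w. Re w > b})"
      by (simp only: has_field_derivative_def integral_mult_left_zero)
    then show ?thesis
      unfolding laplace_def set_lebesgue_integral_def by blast
  qed
  then show ?thesis
    by (auto simp: holomorphic_on_def field_differentiable_def)
qed

section \<open>Integrals along vertical lines\<close>

text \<open>The Bromwich integral: 1 / (2 pi i) times the contour integral upwards along Re v = c.
  There dv = i dy, so the factor i cancels.\<close>

definition line_int :: "real \<Rightarrow> (complex \<Rightarrow> complex) \<Rightarrow> complex" where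
  "line_int c \<phi> = (\<integral>y. \<phi> (Complex c y) \<partial>lborel) / (2 * pi)"

lemma has_vector_derivative_Complex [derivative_intros]:
  "((\<lambda>y. Complex c y) has_vector_derivative \<i>) (at y within S)"
  unfolding Complex_eq by (auto intro!: derivative_eq_intros has_vector_derivative_real_field)

lemma continuous_on_Complex_line: "continuous_on S (\<lambda>y. Complex c y)"
  unfolding continuous_on_eq_continuous_within
  by (auto intro: has_vector_derivative_continuous has_vector_derivative_Complex)

lemma norm_Complex_square: "norm (Complex c y) ^ 2 = c\<^sup>2 + y\<^sup>2"
  by (simp add: cmod_def)

lemma continuous_on_line:
  fixes \<phi> :: "complex \<Rightarrow> complex"
  assumes "continuous_on {v. Re v = c} \<phi>"
  shows "continuous_on UNIV (\<lambda>y. \<phi> (Complex c y))"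
  by (rule continuous_on_compose2[OF assms continuous_on_Complex_line]) auto

lemma line_integrable:
  fixes \<phi> :: "complex \<Rightarrow> complex"
  assumes "continuous_on {v. Re v = c} \<phi>" "c > 0"
    and bd: "\<And>v. Re v = c \<Longrightarrow> norm (\<phi> v) \<le> M / norm v ^ 2"
  shows "integrable lborel (\<lambda>y. \<phi> (Complex c y))"
proof (rule Bochner_Integration.integrable_bound)
  show "integrable lborel (\<lambda>y. M * (1 / (c\<^sup>2 + y\<^sup>2)))"
    using integrable_inverse_c_plus_square(1)[OF assms(2)] by (rule integrable_mult_right)
  show "(\<lambda>y. \<phi> (Complex c y)) \<in> borel_measurable lborel"
    using continuous_on_line[OF assms(1)] by (simp add: borel_measurable_continuous_onI)
  show "AE y in lborel. norm (\<phi> (Complex c y)) \<le> norm (M * (1 / (c\<^sup>2 + y\<^sup>2)))"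
  proof (intro AE_I2)
    fix y
    show "norm (\<phi> (Complex c y)) \<le> norm (M * (1 / (c\<^sup>2 + y\<^sup>2)))"
      using bd[of "Complex c y"] abs_ge_self[of "M / (c\<^sup>2 + y\<^sup>2)"] by (simp add: norm_Complex_square)
  qed
qed

lemma norm_line_int_le:
  assumes "c > 0"
    and bd: "\<And>v. Re v = c \<Longrightarrow> norm (\<phi> v) \<le> M / norm v ^ 2"
  shows "norm (line_int c \<phi>) \<le> M / (2 * c)"
proof -
  have "norm (\<integral>y. \<phi> (Complex c y) \<partial>lborel) \<le> (\<integral>y. M * (1 / (c\<^sup>2 + y\<^sup>2)) \<partial>lborel)"
  proof (rule norm_lebesgue_integral_le)
    show "integrable lborel (\<lambda>y. M * (1 / (c\<^sup>2 + y\<^sup>2)))"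
      using integrable_inverse_c_plus_square(1)[OF assms(1)] by (rule integrable_mult_right)
    show "norm (\<phi> (Complex c y)) \<le> M * (1 / (c\<^sup>2 + y\<^sup>2))" for y
      using bd[of "Complex c y"] by (simp add: norm_Complex_square)
  qed
  also have "\<dots> = M * (pi / c)"
    using integrable_inverse_c_plus_square(2)[OF assms(1)] by (subst integral_mult_right_zero) simp
  finally have "norm (\<integral>y. \<phi> (Complex c y) \<partial>lborel) / (2 * pi) \<le> M * (pi / c) / (2 * pi)"
    by (intro divide_right_mono) auto
  also have "\<dots> = M / (2 * c)"
    by simp
  finally show ?thesis
    by (simp add: line_int_def norm_divide norm_mult)
qed

lemma integral_symmetric_tendsto:
  fixes f :: "real \<Rightarrow> complex"
  assumes "integrable lborel f"
  shows "(\<lambda>n. LINT y:{- real n..real n}|lborel. f y) \<longlonglongrightarrow> (\<integral>y. f y \<partial>lborel)"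
  unfolding set_lebesgue_integral_def
proof (rule integral_dominated_convergence[where w = "\<lambda>y. norm (f y)"])
  show "AE y in lborel. (\<lambda>n. indicator {- real n..real n} y *\<^sub>R f y) \<longlonglongrightarrow> f y"
  proof (intro AE_I2 tendsto_eventually)
    fix y
    show "\<forall>\<^sub>F n in sequentially. indicator {- real n..real n} y *\<^sub>R f y = f y"
      using eventually_ge_at_top[of "nat \<lceil>\<bar>y\<bar>\<rceil>"]
    proof eventually_elim
      case (elim n)
      then have "\<bar>y\<bar> \<le> real n" by linarith
      then show ?case by (auto simp: indicator_def abs_le_iff)
    qed
  qed
qed (use assms in \<open>auto simp: indicator_def intro!: AE_I2 borel_measurable_integrable\<close>)

text \<open>Cauchy's theorem for a tall rectangle, expressed through a primitive \<Psi> on the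
  convex half-plane: each truncated vertical integral is a difference of values of \<Psi>, and the
  horizontal sides contribute O(1 / n^2).\<close>

lemma line_int_shift:
  assumes hol: "\<phi> holomorphic_on {v. Re v > B}" and "B < c1" "0 < c1" "c1 \<le> c2"
    and bd: "\<And>v. c1 \<le> Re v \<Longrightarrow> Re v \<le> c2 \<Longrightarrow> norm (\<phi> v) \<le> M / norm v ^ 2"
  shows "line_int c1 \<phi> = line_int c2 \<phi>"
proof -
  have "convex {v. Re v > B}" "open {v. Re v > B}"
    by (simp_all add: convex_halfspace_Re_gt open_halfspace_Re_gt)
  from holomorphic_convex_primitive'[OF this hol] obtain \<Psi>
    where "\<And>v. Re v > B \<Longrightarrow> (\<Psi> has_field_derivative \<phi> v) (at v within {v. Re v > B})"
    by auto
  then have \<Psi>: "(\<Psi> has_field_derivative \<phi> v) (at v)" if "Re v > B" for v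
    using that at_within_open[OF _ open_halfspace_Re_gt[of B]] by auto
  have cont: "continuous_on {v. Re v = c} \<phi>" if "c > B" for c
    using that by (intro continuous_on_subset[OF holomorphic_on_imp_continuous_on[OF hol]]) auto
  have I: "integrable lborel (\<lambda>y. \<phi> (Complex c y))" if "c1 \<le> c" "c \<le> c2" for c
    using that assms by (intro line_integrable[of c _ M] cont) auto
  define J where "J c n = (LINT y:{- real n..real n}|lborel. \<phi> (Complex c y))" for c n
  have J: "\<i> * J c n = \<Psi> (Complex c n) - \<Psi> (Complex c (- real n))" if "c1 \<le> c" "c \<le> c2" for c n
  proof -
    have "((\<lambda>y. \<phi> (Complex c y) * \<i>) has_integral (\<Psi> (Complex c (real n)) - \<Psi> (Complex c (- real n))))
        {- real n..real n}"
    proof (rule fundamental_theorem_of_calculus)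
      fix y :: real
      have "((\<Psi> \<circ> Complex c) has_vector_derivative \<i> * \<phi> (Complex c y)) (at y within {- real n..real n})"
      proof (rule field_vector_diff_chain_within[OF has_vector_derivative_Complex])
        show "(\<Psi> has_field_derivative \<phi> (Complex c y)) (at (Complex c y) within Complex c ` {- real n..real n})"
          using that \<open>B < c1\<close> by (intro has_field_derivative_at_within[OF \<Psi>]) auto
      qed
      then show "((\<lambda>y. \<Psi> (Complex c y)) has_vector_derivative \<phi> (Complex c y) * \<i>) (at y within {- real n..real n})"
        by (simp add: o_def mult.commute)
    qed auto
    moreover have "set_integrable lborel {- real n..real n} (\<lambda>y. \<phi> (Complex c y) * \<i>)"
      using that \<open>B < c1\<close> 
      by (intro borel_integrable_atLeastAtMost' continuous_intros
            continuous_on_subset[OF continuous_on_line[OF cont]]) auto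
    from has_integral_set_integral[OF this]
    have "((\<lambda>y. \<phi> (Complex c y) * \<i>) has_integral (J c n * \<i>)) {- real n..real n}"
      by (simp add: J_def)
    ultimately show ?thesis
      using has_integral_unique by (metis mult.commute)
  qed
  have seg: "norm (\<Psi> (Complex c2 y) - \<Psi> (Complex c1 y)) \<le> M / y\<^sup>2 * (c2 - c1)" if "y \<noteq> 0" for y
  proof -
    have cv: "convex (closed_segment (Complex c1 y) (Complex c2 y))" by simp
    have "norm (\<Psi> (Complex c2 y) - \<Psi> (Complex c1 y)) \<le> M / y\<^sup>2 * norm (Complex c2 y - Complex c1 y)"
    proof (rule field_differentiable_bound[OF cv])
      fix v assume "v \<in> closed_segment (Complex c1 y) (Complex c2 y)"
      then obtain u where u: "0 \<le> u" "u \<le> 1" "v = (1 - u) *\<^sub>R Complex c1 y + u *\<^sub>R Complex c2 y"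
        by (auto simp: closed_segment_def)
      have v: "Im v = y" "Re v = c1 + u * (c2 - c1)"
        by (simp_all add: u algebra_simps)
      have "0 \<le> u * (c2 - c1)" "u * (c2 - c1) \<le> 1 * (c2 - c1)"
        using u \<open>c1 \<le> c2\<close> mult_right_mono[of u 1 "c2 - c1"] by auto
      then have v': "c1 \<le> Re v" "Re v \<le> c2"
        by (auto simp: v)
      show "(\<Psi> has_field_derivative \<phi> v) (at v within closed_segment (Complex c1 y) (Complex c2 y))"
        using v' \<open>B < c1\<close> by (intro has_field_derivative_at_within[OF \<Psi>]) auto
      have b: "norm (\<phi> v) \<le> M / norm v ^ 2" using bd v' by auto
      have v0: "norm v ^ 2 > 0" using v that by auto
      with b have "0 \<le> M"
        using order_trans[OF norm_ge_zero b] by (simp add: zero_le_divide_iff)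
      moreover have "y\<^sup>2 \<le> norm v ^ 2"
        using v by (simp add: cmod_power2)
      ultimately have "M / norm v ^ 2 \<le> M / y\<^sup>2"
        using that v0 by (intro divide_left_mono mult_pos_pos) auto
      with b show "norm (\<phi> v) \<le> M / y\<^sup>2" by simp
    qed auto
    also have "norm (Complex c2 y - Complex c1 y) = c2 - c1"
      using assms by (simp add: complex_diff cmod_def)
    finally show ?thesis .
  qed
  have "(\<lambda>n. J c2 n - J c1 n) \<longlonglongrightarrow> 0"
  proof (rule Lim_null_comparison)
    show "\<forall>\<^sub>F n in sequentially. norm (J c2 n - J c1 n) \<le> 2 * (M / (real n)\<^sup>2 * (c2 - c1))"
      using eventually_gt_at_top[of 0]
    proof eventually_elim
      case (elim n)
      have "norm (J c2 n - J c1 n) = norm (\<i> * J c2 n - \<i> * J c1 n)"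
        by (simp add: norm_mult flip: right_diff_distrib)
      also have "\<dots> = norm ((\<Psi> (Complex c2 n) - \<Psi> (Complex c1 n)) - (\<Psi> (Complex c2 (- real n)) - \<Psi> (Complex c1 (- real n))))"
        using assms by (simp add: J algebra_simps)
      also have "\<dots> \<le> M / (real n)\<^sup>2 * (c2 - c1) + M / (- real n)\<^sup>2 * (c2 - c1)"
        using elim by (intro order_trans[OF norm_triangle_ineq4] add_mono seg) auto
      finally show ?case by simp
    qed
    show "(\<lambda>n. 2 * (M / (real n)\<^sup>2 * (c2 - c1))) \<longlonglongrightarrow> 0"
      by real_asymp
  qed
  moreover have "(\<lambda>n. J c2 n - J c1 n) \<longlonglongrightarrow> (\<integral>y. \<phi> (Complex c2 y) \<partial>lborel) - (\<integral>y. \<phi> (Complex c1 y) \<partial>lborel)"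
    unfolding J_def using assms by (intro tendsto_diff integral_symmetric_tendsto I) auto
  ultimately have "(\<integral>y. \<phi> (Complex c2 y) \<partial>lborel) - (\<integral>y. \<phi> (Complex c1 y) \<partial>lborel) = 0"
    using LIMSEQ_unique by blast
  then show ?thesis by (simp add: line_int_def)
qed

text \<open>The line can be moved to any abscissa c' to the right, where the value is at most M / (2
  c'), and this tends to 0.\<close>

lemma line_int_eq_0:
  assumes hol: "\<phi> holomorphic_on {v. Re v > B}" and "B < c" "0 < c"
    and bd: "\<And>v. c \<le> Re v \<Longrightarrow> norm (\<phi> v) \<le> M / norm v ^ 2"
  shows "line_int c \<phi> = 0"
proof -
  have "norm (line_int c \<phi>) \<le> M / (2 * c')" if "c' \<ge> c" for c'
  proof -
    have "line_int c \<phi> = line_int c' \<phi>"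
      using assms that by (intro line_int_shift[OF hol, where M = M]) auto
    also have "norm \<dots> \<le> M / (2 * c')"
      using assms that by (intro norm_line_int_le) auto
    finally show ?thesis .
  qed
  then have "eventually (\<lambda>c'. norm (line_int c \<phi>) \<le> M / (2 * c')) at_top"
    using eventually_at_top_linorder by blast
  moreover have "((\<lambda>c'. M / (2 * c')) \<longlongrightarrow> 0) at_top"
    by real_asymp
  ultimately have "norm (line_int c \<phi>) \<le> 0"
    by (intro tendsto_lowerbound) auto
  then show ?thesis by simp
qed

text \<open>Fubini on the product of the line and the half-line: the inner Laplace integral of exp
  (v x) is 1 / (w - v) because Re v = c < Re w, and the decay 1 / |v|^2 makes the double integral
  absolutely convergent.\<close>

lemma laplace_line_int:
  assumes cont: "continuous_on {v. Re v = c} \<phi>" and "c > 0" "Re w > c"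
    and bd: "\<And>v. Re v = c \<Longrightarrow> norm (\<phi> v) \<le> M / norm v ^ 2"
  shows "set_integrable lborel {0<..} (\<lambda>x. line_int c (\<lambda>v. \<phi> v * exp (v * of_real x)) * exp (- (w * of_real x)))"
    and "laplace (\<lambda>x. line_int c (\<lambda>v. \<phi> v * exp (v * of_real x))) w = line_int c (\<lambda>v. \<phi> v / (w - v))"
proof -
  define f where "f = (\<lambda>(x, y). indicator {0<..} x *\<^sub>R (\<phi> (Complex c y) * exp (- ((w - Complex c y) * of_real x))))"
  have I: "integrable lborel (\<lambda>y. \<phi> (Complex c y))"
    using assms by (intro line_integrable) auto
  have [measurable]: "(\<lambda>y. \<phi> (Complex c y)) \<in> borel_measurable borel"
    using borel_measurable_integrable[OF I] by simp
  have [measurable]: "(\<lambda>y. Complex c y) \<in> borel_measurable borel"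
    by (intro borel_measurable_continuous_onI continuous_on_Complex_line)
  have fm: "f \<in> borel_measurable (lborel \<Otimes>\<^sub>M lborel)"
    unfolding f_def by measurable
  have nf: "norm (f (x, y)) = norm (\<phi> (Complex c y)) * (indicator {0<..} x *\<^sub>R exp (- ((Re w - c) * x)))" for x y
    by (simp add: f_def norm_mult indicator_def)
  have E: "set_integrable lborel {0<..} (\<lambda>x. exp (- ((Re w - c) * x)))"
    using set_integrable_norm[OF laplace_one(1)[of "of_real (Re w - c)"]] assms by simp
  have fint: "integrable (lborel \<Otimes>\<^sub>M lborel) f"
  proof (rule lborel_pair.Fubini_integrable[OF fm])
    have "integrable lborel (\<lambda>x. (\<integral>y. norm (\<phi> (Complex c y)) \<partial>lborel) * (indicator {0<..} x *\<^sub>R exp (- ((Re w - c) * x))))"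
      using E unfolding set_integrable_def by (rule integrable_mult_right)
    then show "integrable lborel (\<lambda>x. \<integral>y. norm (f (x, y)) \<partial>lborel)"
      by (simp add: nf)
    show "AE x in lborel. integrable lborel (\<lambda>y. f (x, y))"
    proof (intro AE_I2)
      fix x :: real
      have "integrable lborel (\<lambda>y. norm (f (x, y)))"
        unfolding nf using I by (intro integrable_mult_left) auto
      then show "integrable lborel (\<lambda>y. f (x, y))"
        by (rule Bochner_Integration.integrable_bound) (use fm in \<open>auto simp: f_def\<close>)
    qed
  qed
  have fx: "(\<integral>y. f (x, y) \<partial>lborel) = (2 * pi) * (indicator {0<..} x *\<^sub>R 
      (line_int c (\<lambda>v. \<phi> v * exp (v * of_real x)) * exp (- (w * of_real x))))" for x
  proof -
    have "f (x, y) = (\<phi> (Complex c y) * exp (Complex c y * of_real x)) * (indicator {0<..} x *\<^sub>R exp (- (w * of_real x)))" for y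
      by (simp add: f_def algebra_simps flip: exp_add)
    then show ?thesis
      by (simp only: integral_mult_left_zero line_int_def) (simp add: algebra_simps)
  qed
  have "integrable lborel (\<lambda>x. \<integral>y. f (x, y) \<partial>lborel)"
    using lborel_pair.integrable_fst'[OF fint] .
  then have "integrable lborel (\<lambda>x. (1 / (2 * pi)) *\<^sub>R ((2 * pi) * (indicator {0<..} x *\<^sub>R 
      (line_int c (\<lambda>v. \<phi> v * exp (v * of_real x)) * exp (- (w * of_real x))))))"
    unfolding fx by (rule integrable_scaleR_right)
  then show "set_integrable lborel {0<..} (\<lambda>x. line_int c (\<lambda>v. \<phi> v * exp (v * of_real x)) * exp (- (w * of_real x)))"
    by (simp add: set_integrable_def scaleR_conv_of_real)
  have "(2 * pi) * laplace (\<lambda>x. line_int c (\<lambda>v. \<phi> v * exp (v * of_real x))) w = (\<integral>x. \<integral>y. f (x, y) \<partial>lborel \<partial>lborel)"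
    unfolding fx by (simp only: integral_mult_right_zero laplace_def set_lebesgue_integral_def)
  also have "\<dots> = (\<integral>y. \<integral>x. f (x, y) \<partial>lborel \<partial>lborel)"
    using lborel_pair.Fubini_integral[of "\<lambda>x y. f (x, y)"] fint by simp
  also have "\<dots> = (\<integral>y. \<phi> (Complex c y) / (w - Complex c y) \<partial>lborel)"
  proof (rule Bochner_Integration.integral_cong)
    fix y
    have "Re (w - Complex c y) > 0" using assms by simp
    from laplace_one(2)[OF this]
    have "(\<integral>x. indicator {0<..} x *\<^sub>R exp (- ((w - Complex c y) * of_real x)) \<partial>lborel) = 1 / (w - Complex c y)"
      by (simp only: set_lebesgue_integral_def)
    moreover have "f (x, y) = \<phi> (Complex c y) * (indicator {0<..} x *\<^sub>R exp (- ((w - Complex c y) * of_real x)))" for x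
      by (simp add: f_def)
    ultimately show "(\<integral>x. f (x, y) \<partial>lborel) = \<phi> (Complex c y) / (w - Complex c y)"
      by (simp only: integral_mult_right_zero) simp
  qed simp
  also have "\<dots> = (2 * pi) * line_int c (\<lambda>v. \<phi> v / (w - v))"
    by (simp add: line_int_def)
  finally show "laplace (\<lambda>x. line_int c (\<lambda>v. \<phi> v * exp (v * of_real x))) w = line_int c (\<lambda>v. \<phi> v / (w - v))"
    by simp
qed

section \<open>Elementary Laplace transforms and the inverse transforms of negative powers\<close>

lemma laplace_cong:
  assumes "\<And>t. t > 0 \<Longrightarrow> f t = g t"
  shows "laplace f w = laplace g w"
  unfolding laplace_def using assms by (intro set_lebesgue_integral_cong) auto

lemma laplace_cmult: "laplace (\<lambda>t. k * f t) w = k * laplace f w"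
  unfolding laplace_def by (simp add: mult.assoc)

lemma laplace_const:
  assumes "Re w > 0"
  shows "laplace (\<lambda>_. k) w = k / w"
  using laplace_one(2)[OF assms] by (simp add: laplace_def)

lemma laplace_id:
  assumes "Re w > 0"
  shows "laplace of_real w = 1 / w\<^sup>2"
proof -
  define b where "b = Re w / 2"
  have b: "b > 0" "b < Re w" using assms by (auto simp: b_def)
  have "laplace (\<lambda>_. 1) w = w * laplace of_real w - of_real 0"
  proof (rule laplace_derivative[OF b(2)])
    show "(of_real has_vector_derivative (1::complex)) (at t within {0..})" for t
      by (auto intro!: derivative_eq_intros has_vector_derivative_real_field)
    fix t :: real assume t: "0 \<le> t"
    have "b * t \<le> exp (b * t)"
      using exp_ge_add_one_self[of "b * t"] by linarith
    then show "norm (complex_of_real t) \<le> (1 / b) * exp (b * t)"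
      using t b by (simp add: field_simps)
    show "norm (1::complex) \<le> 1 * exp (b * t)"
      using t b by simp
  qed simp
  moreover have "w \<noteq> 0" using assms by auto
  ultimately show ?thesis
    using laplace_const[OF assms, of 1] by (simp add: field_simps power2_eq_square)
qed

lemma norm_exp_div_power_le:
  assumes "Re v = c" "c > 0" "j \<ge> 2"
  shows "norm (exp (v * of_real x) / v ^ j) \<le> (exp (c * x) / c ^ (j - 2)) / norm v ^ 2"
proof -
  have cv: "c \<le> norm v" using assms complex_Re_le_cmod[of v] by simp
  have v0: "norm v > 0" using cv assms by linarith
  have "norm v ^ j = norm v ^ (j - 2) * norm v ^ 2"
    using assms(3) by (metis le_add_diff_inverse2 power_add)
  moreover have "c ^ (j - 2) * norm v ^ 2 \<le> norm v ^ (j - 2) * norm v ^ 2"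
    using cv assms by (intro mult_right_mono power_mono) auto
  ultimately have "exp (c * x) / norm v ^ j \<le> exp (c * x) / (c ^ (j - 2) * norm v ^ 2)"
    using assms v0 by (intro divide_left_mono mult_pos_pos) auto
  then show ?thesis
    using assms(1) by (simp add: norm_divide norm_power)
qed

lemma continuous_on_exp_div_power:
  assumes "c > 0"
  shows "continuous_on {v. Re v = c} (\<lambda>v. exp (v * of_real x) / v ^ j)"
  using assms by (intro continuous_intros) auto

lemma line_integrable_exp_div_power:
  assumes "c > 0" "j \<ge> 2"
  shows "integrable lborel (\<lambda>y. exp (Complex c y * of_real x) / Complex c y ^ j)"
  using assms continuous_on_exp_div_power[OF assms(1)] norm_exp_div_power_le[of _ c j x]
  by (intro line_integrable[where \<phi> = "\<lambda>v. exp (v * of_real x) / v ^ j"]) blast+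

text \<open>exp (v x) / v^j tends to 0 at both ends of the line, so its derivative along the line
  has integral 0; the two terms of that derivative give the recursion. With \<open>j \<ge> 2\<close>
  both are absolutely integrable.\<close>

lemma line_int_exp_div_power_Suc:
  assumes c: "c > 0" and j: "j \<ge> 2"
  shows "line_int c (\<lambda>v. exp (v * of_real x) / v ^ Suc j) = of_real x / of_nat j * line_int c (\<lambda>v. exp (v * of_real x) / v ^ j)"
proof -
  let ?e = "\<lambda>j y. exp (Complex c y * of_real x) / Complex c y ^ j"
  have nz: "Complex c y \<noteq> 0" for y using c by (simp add: complex_eq_iff)
  have I: "integrable lborel (?e k)" if "k \<ge> 2" for k
    using line_integrable_exp_div_power[OF c that] .
  have lim: "(?e j \<longlongrightarrow> 0) F" if "F = at_top \<or> F = at_bot" for F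
  proof (rule Lim_null_comparison)
    have "((\<lambda>y. (exp (c * x) / c ^ (j - 2)) / (c\<^sup>2 + y\<^sup>2)) \<longlongrightarrow> 0) at_top"
      by real_asymp
    moreover have "((\<lambda>y. (exp (c * x) / c ^ (j - 2)) / (c\<^sup>2 + y\<^sup>2)) \<longlongrightarrow> 0) at_bot"
      by real_asymp
    ultimately show "((\<lambda>y. (exp (c * x) / c ^ (j - 2)) / (c\<^sup>2 + y\<^sup>2)) \<longlongrightarrow> 0) F"
      using that by auto
    show "\<forall>\<^sub>F y in F. norm (?e j y) \<le> (exp (c * x) / c ^ (j - 2)) / (c\<^sup>2 + y\<^sup>2)"
      using norm_exp_div_power_le[of "Complex c _" c j x] c j
      by (intro always_eventually allI) (simp add: norm_Complex_square)
  qed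
  have "(\<integral>y. \<i> * of_real x * ?e j y - \<i> * of_nat j * ?e (Suc j) y \<partial>lborel) = 0 - 0"
  proof (rule integral_FTC_real_line[where F = "?e j"])
    fix y
    have "((\<lambda>v. exp (v * of_real x) / v ^ j) has_field_derivative
        (of_real x * (exp (Complex c y * of_real x) / Complex c y ^ j) - of_nat j * (exp (Complex c y * of_real x) / Complex c y ^ Suc j)))
        (at (Complex c y) within UNIV)"
    proof -
      have "Complex c y ^ j = Complex c y * Complex c y ^ (j - 1)"
        using j by (simp flip: power_Suc)
      then show ?thesis
        using nz[of y] j by (auto intro!: derivative_eq_intros simp: divide_simps) (simp add: algebra_simps)
    qed
    from field_vector_diff_chain_within[OF has_vector_derivative_Complex has_field_derivative_subset[OF this subset_UNIV]]
    show "(?e j has_vector_derivative \<i> * of_real x * ?e j y - \<i> * of_nat j * ?e (Suc j) y) (at y)"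
      by (simp add: o_def algebra_simps)
    have "isCont (\<lambda>y. Complex c y) y"
      using continuous_on_Complex_line[of UNIV c] by (simp add: continuous_on_eq_continuous_at)
    then show "isCont (\<lambda>y. \<i> * of_real x * ?e j y - \<i> * of_nat j * ?e (Suc j) y) y"
      using nz by (intro continuous_intros) auto
  next
    show "integrable lborel (\<lambda>y. \<i> * of_real x * ?e j y - \<i> * of_nat j * ?e (Suc j) y)"
      using j by (intro Bochner_Integration.integrable_diff integrable_mult_right I) auto
  qed (use lim in auto)
  moreover have "(\<integral>y. \<i> * of_real x * ?e j y - \<i> * of_nat j * ?e (Suc j) y \<partial>lborel)
      = \<i> * of_real x * (\<integral>y. ?e j y \<partial>lborel) - \<i> * of_nat j * (\<integral>y. ?e (Suc j) y \<partial>lborel)"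
    using j by (subst Bochner_Integration.integral_diff)
      (simp_all only: integral_mult_right_zero I integrable_mult_right Suc_le_eq less_Suc_eq_le le_SucI)
  ultimately have "\<i> * (of_nat j * (\<integral>y. ?e (Suc j) y \<partial>lborel)) = \<i> * (of_real x * (\<integral>y. ?e j y \<partial>lborel))"
    by (simp add: mult_ac)
  then have "of_nat j * (\<integral>y. ?e (Suc j) y \<partial>lborel) = of_real x * (\<integral>y. ?e j y \<partial>lborel)"
    by simp
  with j show ?thesis
    by (simp add: line_int_def field_simps)
qed

lemma holomorphic_on_exp_div_power:
  "(\<lambda>v. exp (v * of_real x) / v ^ j) holomorphic_on {v. Re v > 0}"
  by (intro holomorphic_intros) auto

lemma line_int_exp_div_square_indep:
  assumes "0 < c1" "c1 \<le> c2" "x \<ge> 0"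
  shows "line_int c1 (\<lambda>v. exp (v * of_real x) / v\<^sup>2) = line_int c2 (\<lambda>v. exp (v * of_real x) / v\<^sup>2)"
proof (rule line_int_shift[OF holomorphic_on_exp_div_power, where M = "exp (c2 * x)"])
  fix v assume v: "c1 \<le> Re v" "Re v \<le> c2"
  have "exp (Re v * x) \<le> exp (c2 * x)"
    using v assms by (simp add: mult_right_mono)
  then show "norm (exp (v * of_real x) / v\<^sup>2) \<le> exp (c2 * x) / norm v ^ 2"
    by (simp add: norm_divide norm_power divide_right_mono)
qed (use assms in auto)

text \<open>The one explicit integral, which fixes the normalising constant of the inversion
  formula. On Re v = 1 one has v (2 - v) = 1 + y^2, so the integrand equals (1 - i y) / (1 + y^2)^2
  and has an elementary primitive.\<close>

lemma integral_Complex_one_cubic: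
  "(\<integral>y. 1 / ((Complex 1 y)\<^sup>2 * (2 - Complex 1 y)) \<partial>lborel) = pi / 2"
proof -
  let ?f = "\<lambda>y. 1 / ((Complex 1 y)\<^sup>2 * (2 - Complex 1 y))"
  let ?F = "\<lambda>y. complex_of_real ((y / (1 + y\<^sup>2) + arctan y) / 2) + \<i> * complex_of_real (1 / (2 * (1 + y\<^sup>2)))"
  have nz: "Complex 1 y \<noteq> 0" "2 - Complex 1 y \<noteq> 0" for y by (simp_all add: complex_eq_iff)
  have ne: "1 + y\<^sup>2 \<noteq> (0::real)" for y
    by (metis add_pos_nonneg less_irrefl zero_le_power2 zero_less_one)
  have eq: "?f y = complex_of_real (1 / (1 + y\<^sup>2)\<^sup>2) + \<i> * complex_of_real (- y / (1 + y\<^sup>2)\<^sup>2)" for y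
  proof -
    have prod: "Complex 1 y * (2 - Complex 1 y) = of_real (1 + y\<^sup>2)"
      by (simp add: complex_eq_iff power2_eq_square)
    have "?f y = (2 - Complex 1 y) / (Complex 1 y * (2 - Complex 1 y))\<^sup>2"
      using nz[of y] by (simp add: power2_eq_square divide_simps)
    also have "\<dots> = (2 - Complex 1 y) / of_real ((1 + y\<^sup>2)\<^sup>2)"
      by (simp add: prod)
    also have "\<dots> = (1 - \<i> * of_real y) / of_real ((1 + y\<^sup>2)\<^sup>2)"
    proof -
      have "2 - Complex 1 y = 1 - \<i> * of_real y"
        by (simp add: complex_eq_iff)
      then show ?thesis by (simp only:)
    qed
    finally show ?thesis
      using ne[of y] by (simp add: diff_divide_distrib)
  qed
  have "(\<integral>y. ?f y \<partial>lborel) = complex_of_real pi / 4 - (- (complex_of_real pi / 4))"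
  proof (rule integral_FTC_real_line[where F = ?F])
    fix y
    have 1: "((\<lambda>y. (y / (1 + y\<^sup>2) + arctan y) / 2) has_real_derivative 1 / (1 + y\<^sup>2)\<^sup>2) (at y)"
    proof (rule DERIV_cong)
      show "((\<lambda>y. (y / (1 + y\<^sup>2) + arctan y) / 2) has_real_derivative
          ((1 * (1 + y\<^sup>2) - y * (2 * y)) / ((1 + y\<^sup>2) * (1 + y\<^sup>2)) + inverse (1 + y\<^sup>2)) / 2) (at y)"
        using ne[of y] by (auto intro!: derivative_eq_intros)
      define q where "q = 1 + y\<^sup>2"
      have "q \<noteq> 0" "y * (2 * y) = 2 * (q - 1)"
        using ne[of y] by (auto simp: q_def power2_eq_square)
      moreover have "((1 * q - 2 * (q - 1)) / (q * q) + inverse q) / 2 = 1 / q\<^sup>2" if "q \<noteq> 0" for q :: real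
        using that by (simp add: field_simps power2_eq_square)
      ultimately show "((1 * (1 + y\<^sup>2) - y * (2 * y)) / ((1 + y\<^sup>2) * (1 + y\<^sup>2)) + inverse (1 + y\<^sup>2)) / 2 = 1 / (1 + y\<^sup>2)\<^sup>2"
        unfolding q_def[symmetric] by (simp only:)
    qed
    have 2: "((\<lambda>y. 1 / (2 * (1 + y\<^sup>2))) has_real_derivative - y / (1 + y\<^sup>2)\<^sup>2) (at y)"
    proof (rule DERIV_cong)
      show "((\<lambda>y. 1 / (2 * (1 + y\<^sup>2))) has_real_derivative - (2 * (2 * y)) / ((2 * (1 + y\<^sup>2)) * (2 * (1 + y\<^sup>2)))) (at y)"
        using ne[of y] by (auto intro!: derivative_eq_intros)
      show "- (2 * (2 * y)) / ((2 * (1 + y\<^sup>2)) * (2 * (1 + y\<^sup>2))) = - y / (1 + y\<^sup>2)\<^sup>2"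
      proof -
        have "- (2 * (2 * y)) / ((2 * q) * (2 * q)) = - y / q\<^sup>2" if "q \<noteq> 0" for q :: real
          using that by (simp add: field_simps power2_eq_square)
        from this[OF ne] show ?thesis .
      qed
    qed
    show "(?F has_vector_derivative ?f y) (at y)"
      unfolding eq
      by (intro has_vector_derivative_add has_vector_derivative_mult_right
           has_vector_derivative_of_real 1 2)
    have "isCont (\<lambda>y. Complex 1 y) y"
      using continuous_on_Complex_line[of UNIV 1] by (simp add: continuous_on_eq_continuous_at)
    then show "isCont ?f y"
      using nz[of y] by (intro continuous_intros) auto
  next
    show "integrable lborel ?f"
    proof (rule line_integrable[where M = 1 and \<phi> = "\<lambda>v. 1 / (v\<^sup>2 * (2 - v))"])
      show "continuous_on {v. Re v = 1} (\<lambda>v. 1 / (v\<^sup>2 * (2 - v)))"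
        by (intro continuous_intros) auto
      fix v assume v: "Re v = 1"
      have "1 \<le> norm (2 - v)"
        using complex_Re_le_cmod[of "2 - v"] v by simp
      then have "norm v ^ 2 * 1 \<le> norm v ^ 2 * norm (2 - v)"
        by (intro mult_left_mono) auto
      moreover have "norm v > 0" using v by auto
      ultimately show "norm (1 / (v\<^sup>2 * (2 - v))) \<le> 1 / norm v ^ 2"
        unfolding norm_divide norm_mult norm_power norm_one by (intro divide_left_mono mult_pos_pos) (use v in auto)
    qed simp
    have a: "((\<lambda>y::real. (y / (1 + y\<^sup>2) + arctan y) / 2) \<longlongrightarrow> - (pi / 4)) at_bot"
      "((\<lambda>y::real. 1 / (2 * (1 + y\<^sup>2))) \<longlongrightarrow> 0) at_bot"
      "((\<lambda>y::real. (y / (1 + y\<^sup>2) + arctan y) / 2) \<longlongrightarrow> pi / 4) at_top"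
      "((\<lambda>y::real. 1 / (2 * (1 + y\<^sup>2))) \<longlongrightarrow> 0) at_top"
      by real_asymp+
    show "(?F \<longlongrightarrow> - (complex_of_real pi / 4)) at_bot"
      using tendsto_add[OF tendsto_of_real[OF a(1)] tendsto_mult[OF tendsto_const tendsto_of_real[OF a(2)]], of \<i>] by simp
    show "(?F \<longlongrightarrow> (complex_of_real pi / 4)) at_top"
      using tendsto_add[OF tendsto_of_real[OF a(3)] tendsto_mult[OF tendsto_const tendsto_of_real[OF a(4)]], of \<i>] by simp
  qed
  then show ?thesis by simp
qed

text \<open>By homogeneity the integral is \<open>\<kappa> x\<close>; the constant is found by comparing Laplace transforms at \<open>w = 2\<close>.\<close>

lemma line_int_exp_div_square:
  assumes "c > 0" "x \<ge> 0"
  shows "line_int c (\<lambda>v. exp (v * of_real x) / v\<^sup>2) = of_real x"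
proof -
  define \<kappa> where "\<kappa> = line_int 1 (\<lambda>v. exp v / v\<^sup>2)"
  have scale: "line_int c (\<lambda>v. exp (v * of_real x) / v\<^sup>2) = of_real x * \<kappa>" if "x > 0" "c > 0" for x c
  proof -
    \<comment> \<open>At abscissa 1 / x the substitution v = v' / x lands on Re v' = 1, where
      \<kappa> is defined.\<close>
    have "line_int c (\<lambda>v. exp (v * of_real x) / v\<^sup>2) = line_int (1 / x) (\<lambda>v. exp (v * of_real x) / v\<^sup>2)"
    proof (cases "c \<le> 1 / x")
      case True
      with that show ?thesis by (intro line_int_exp_div_square_indep) auto
    next
      case False
      with that show ?thesis by (intro line_int_exp_div_square_indep[symmetric]) auto
    qed
    also have "\<dots> = of_real x * \<kappa>"
    proof -
      have sc: "Complex (1 / x) (0 + (1 / x) * y) = Complex 1 y / of_real x" for y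
        using that by (simp add: complex_eq_iff)
      have "(\<integral>y. exp (Complex (1 / x) y * of_real x) / (Complex (1 / x) y)\<^sup>2 \<partial>lborel)
          = \<bar>1 / x\<bar> *\<^sub>R (\<integral>y. exp (Complex (1 / x) (0 + (1 / x) * y) * of_real x) / (Complex (1 / x) (0 + (1 / x) * y))\<^sup>2 \<partial>lborel)"
        using that by (intro lborel_integral_real_affine) auto
      also have "\<dots> = (1 / x) *\<^sub>R (\<integral>y. of_real (x\<^sup>2) * (exp (Complex 1 y) / (Complex 1 y)\<^sup>2) \<partial>lborel)"
        unfolding sc using that by (simp add: power_divide mult.commute)
      also have "\<dots> = of_real x * (\<integral>y. exp (Complex 1 y) / (Complex 1 y)\<^sup>2 \<partial>lborel)"
        using that by (simp only: integral_mult_right_zero) (simp add: scaleR_conv_of_real power2_eq_square)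
      finally show ?thesis
        by (simp add: line_int_def \<kappa>_def)
    qed
    finally show ?thesis .
  qed
  have "\<kappa> / 4 = laplace (\<lambda>x. \<kappa> * of_real x) 2"
    by (simp add: laplace_cmult laplace_id)
  also have "\<dots> = laplace (\<lambda>x. line_int 1 (\<lambda>v. (1 / v\<^sup>2) * exp (v * of_real x))) 2"
    using scale[of _ 1] by (intro laplace_cong) (simp add: mult.commute)
  also have "\<dots> = line_int 1 (\<lambda>v. (1 / v\<^sup>2) / (2 - v))"
    by (rule laplace_line_int(2)[where M = 1])
       (auto intro!: continuous_intros simp: norm_divide norm_power)
  also have "\<dots> = 1 / 4"
    unfolding line_int_def divide_divide_eq_left integral_Complex_one_cubic by simp
  finally have "\<kappa> = 1" by simp
  moreover have "line_int c (\<lambda>v. exp (v * of_real 0) / v\<^sup>2) = 0"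
    using assms
    by (intro line_int_eq_0[OF holomorphic_on_exp_div_power, where M = 1]) (auto simp: norm_divide norm_power)
  ultimately show ?thesis
    using scale[of x c] assms by (cases "x = 0") auto
qed

lemma line_int_exp_div_power:
  assumes "c > 0" "x \<ge> 0"
  shows "line_int c (\<lambda>v. exp (v * of_real x) / v ^ (j + 2)) = of_real x ^ (j + 1) / fact (j + 1)"
proof (induction j)
  case 0
  then show ?case using line_int_exp_div_square[OF assms] by (simp add: numeral_2_eq_2)
next
  case (Suc j)
  have "line_int c (\<lambda>v. exp (v * of_real x) / v ^ (Suc j + 2))
      = of_real x / of_nat (j + 2) * (of_real x ^ (j + 1) / fact (j + 1))"
    using line_int_exp_div_power_Suc[OF assms(1), of "j + 2" x] Suc.IH by simp
  also have "\<dots> = of_real x ^ (Suc j + 1) / fact (Suc j + 1)"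
    by (simp add: field_simps)
  finally show ?case .
qed

text \<open>The integrand minus \<open>R w * w\<^sup>2 / (v\<^sup>2 * (w - v))\<close> has a removable singularity and decays, so its integral
  vanishes; the subtracted term is the known case \<open>1 / v\<^sup>2\<close>.\<close>

lemma half_plane_Cauchy_formula:
  assumes hol: "R holomorphic_on {v. Re v > B}" and "B \<ge> 0" "B < c" "c < Re w"
    and bd: "\<And>v. Re v \<ge> c \<Longrightarrow> norm (R v) \<le> M / norm v ^ 2"
  shows "line_int c (\<lambda>v. R v / (w - v)) = R w"
proof -
  define g where "g v = R v - R w * w\<^sup>2 / v\<^sup>2" for v
  define k where "k v = (if v = w then deriv g w else (g v - g w) / (v - w))" for v
  have w0: "w \<noteq> 0" using assms by auto
  have gw: "g w = 0" using w0 by (simp add: g_def)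
  have holg: "g holomorphic_on {v. Re v > B}"
    unfolding g_def using assms by (intro holomorphic_intros hol) auto
  have holk: "k holomorphic_on {v. Re v > B}"
    unfolding k_def[abs_def] by (rule pole_lemma_open[OF holg open_halfspace_Re_gt])
  have "\<exists>N. \<forall>v. c \<le> Re v \<longrightarrow> norm (k v) \<le> N / norm v ^ 2"
  proof -
    \<comment> \<open>The closed ball of this radius reaches the line Re v = c and stays inside the
      domain since B < c. On it \<open>k\<close> is bounded by compactness; outside it |v - w| \<ge>
      d, and \<open>g\<close> supplies the decay.\<close>
    define d where "d = Re w - c"
    have d: "d > 0" using assms by (simp add: d_def)
    have sub: "cball w d \<subseteq> {v. Re v > B}"
    proof
      fix v assume "v \<in> cball w d"
      then have "\<bar>Re (w - v)\<bar> \<le> d"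
        using abs_Re_le_cmod[of "w - v"] by (auto simp: dist_norm)
      then show "v \<in> {v. Re v > B}" using assms by (auto simp: d_def)
    qed
    have "compact (k ` cball w d)"
      by (intro compact_continuous_image continuous_on_subset[OF holomorphic_on_imp_continuous_on[OF holk] sub]) auto
    then obtain N where N: "\<And>v. v \<in> cball w d \<Longrightarrow> norm (k v) \<le> N"
      using compact_imp_bounded by (force simp: bounded_iff)
    have N0: "0 \<le> N" using order_trans[OF norm_ge_zero N[of w]] d by simp
    define M' where "M' = M + norm (R w) * norm w ^ 2"
    have "norm (k v) \<le> (N * (norm w + d)\<^sup>2 + M' / d) / norm v ^ 2" if v: "c \<le> Re v" for v
    proof -
      have v0: "v \<noteq> 0" using v assms(2,3) by auto
      have gb: "norm (g v) \<le> M' / norm v ^ 2"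
        using bd[OF v] norm_triangle_ineq4[of "R v" "R w * w\<^sup>2 / v\<^sup>2"]
        by (simp add: g_def M'_def norm_mult norm_divide norm_power add_divide_distrib)
      then have M'0: "0 \<le> M'"
        using v0 order_trans[OF norm_ge_zero gb] by (simp add: zero_le_divide_iff)
      show ?thesis
      proof (cases "v \<in> cball w d")
        case True
        have "norm v \<le> norm w + d"
          using True norm_triangle_ineq2[of v w] by (simp add: dist_norm norm_minus_commute)
        then have "norm v ^ 2 \<le> (norm w + d)\<^sup>2" by (intro power_mono) auto
        then have "N * norm v ^ 2 \<le> N * (norm w + d)\<^sup>2 + M' / d"
          using N0 M'0 d by (intro add_increasing2 mult_left_mono) auto
        then have "N \<le> (N * (norm w + d)\<^sup>2 + M' / d) / norm v ^ 2"
          using v0 by (simp add: pos_le_divide_eq)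
        with N[OF True] show ?thesis by linarith
      next
        case False
        then have "d \<le> norm (v - w)" by (simp add: dist_norm norm_minus_commute)
        then have "norm (g v) / norm (v - w) \<le> (M' / norm v ^ 2) / d"
          using gb d by (intro frac_le) (auto intro: order_trans[OF norm_ge_zero])
        moreover have "v \<noteq> w" using False d by auto
        ultimately have "norm (k v) \<le> (M' / d) / norm v ^ 2"
          by (simp add: k_def gw norm_divide mult.commute)
        also have "\<dots> \<le> (N * (norm w + d)\<^sup>2 + M' / d) / norm v ^ 2"
          using N0 by (intro divide_right_mono) auto
        finally show ?thesis .
      qed
    qed
    then show ?thesis by blast
  qed
  then obtain N where N: "\<And>v. c \<le> Re v \<Longrightarrow> norm (k v) \<le> N / norm v ^ 2" by blast
  have k0: "line_int c k = 0"
    using assms N by (intro line_int_eq_0[OF holk]) auto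
  have int: "integrable lborel (\<lambda>y. f (Complex c y) / (w - Complex c y))"
    if "continuous_on {v. Re v = c} f" "\<And>v. Re v = c \<Longrightarrow> norm (f v) \<le> K / norm v ^ 2" for f K
  proof (rule line_integrable[where \<phi> = "\<lambda>v. f v / (w - v)" and M = "K / (Re w - c)"])
    show "continuous_on {v. Re v = c} (\<lambda>v. f v / (w - v))"
      using that(1) \<open>c < Re w\<close> by (intro continuous_intros) auto
    fix v assume v: "Re v = c"
    have "Re w - c \<le> norm (w - v)" using complex_Re_le_cmod[of "w - v"] v by simp
    then have "norm (f v) / norm (w - v) \<le> (K / norm v ^ 2) / (Re w - c)"
      using that(2)[OF v] \<open>c < Re w\<close> by (intro frac_le) (auto intro: order_trans[OF norm_ge_zero])
    then show "norm (f v / (w - v)) \<le> (K / (Re w - c)) / norm v ^ 2"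
      by (simp add: norm_divide mult.commute)
  qed (use \<open>B \<ge> 0\<close> \<open>B < c\<close> in auto)
  have cR: "continuous_on {v. Re v = c} R"
    using \<open>B < c\<close> by (intro continuous_on_subset[OF holomorphic_on_imp_continuous_on[OF hol]]) auto
  have cS: "continuous_on {v. Re v = c} (\<lambda>v. 1 / v\<^sup>2)"
    using \<open>B \<ge> 0\<close> \<open>B < c\<close> by (intro continuous_intros) auto
  have bS: "norm (1 / v\<^sup>2) \<le> 1 / norm v ^ 2" for v :: complex
    by (simp add: norm_divide norm_power)
  have "k v = (R w * w\<^sup>2) * ((1 / v\<^sup>2) / (w - v)) - R v / (w - v)" if "Re v = c" for v
  proof -
    have "v \<noteq> w" "v \<noteq> 0" using that assms by auto
    then show ?thesis using w0 by (simp add: k_def gw g_def divide_simps) (simp add: algebra_simps)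
  qed
  then have kC: "k (Complex c y) = (R w * w\<^sup>2) * ((1 / (Complex c y)\<^sup>2) / (w - Complex c y)) - R (Complex c y) / (w - Complex c y)" for y
    by simp
  have "line_int c k = ((\<integral>y. (R w * w\<^sup>2) * ((1 / (Complex c y)\<^sup>2) / (w - Complex c y)) \<partial>lborel)
      - (\<integral>y. R (Complex c y) / (w - Complex c y) \<partial>lborel)) / (2 * pi)"
    unfolding line_int_def kC
    by (subst Bochner_Integration.integral_diff[OF integrable_mult_right[OF int[OF cS bS]] int[OF cR bd]]) auto
  also have "\<dots> = (R w * w\<^sup>2) * line_int c (\<lambda>v. (1 / v\<^sup>2) / (w - v)) - line_int c (\<lambda>v. R v / (w - v))"
    by (simp only: integral_mult_right_zero line_int_def diff_divide_distrib times_divide_eq_right[symmetric])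
  also have "line_int c (\<lambda>v. (1 / v\<^sup>2) / (w - v)) = laplace (\<lambda>x. line_int c (\<lambda>v. (1 / v\<^sup>2) * exp (v * of_real x))) w"
    using assms(2-4) by (intro laplace_line_int(2)[symmetric, where M = 1] cS) (auto simp: bS)
  also have "\<dots> = laplace of_real w"
    using line_int_exp_div_square[of c] assms(2-4) by (intro laplace_cong) simp
  also have "\<dots> = 1 / w\<^sup>2"
    using assms(2-4) by (intro laplace_id) auto
  finally have "0 = R w * w\<^sup>2 * (1 / w\<^sup>2) - line_int c (\<lambda>v. R v / (w - v))"
    unfolding k0 .
  moreover have "R w * w\<^sup>2 * (1 / w\<^sup>2) = R w"
    using w0 by simp
  ultimately show ?thesis
    by (metis right_minus_eq)
qed

text \<open>The second-order remainder of exp (v x) in \<open>x\<close> costs a factor |v|^2; decay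
  of order 4 leaves the integrable 1 / |v|^2.\<close>

lemma has_vector_derivative_line_int:
  assumes cont: "continuous_on {v. Re v = c} \<phi>" and c: "c > 0"
    and bd: "\<And>v. Re v = c \<Longrightarrow> norm (\<phi> v) \<le> M / norm v ^ 4"
  shows "((\<lambda>x. line_int c (\<lambda>v. \<phi> v * exp (v * of_real x))) has_vector_derivative
      line_int c (\<lambda>v. v * \<phi> v * exp (v * of_real x))) (at x within S)"
proof -
  have int: "integrable lborel (\<lambda>y. Complex c y ^ i * \<phi> (Complex c y) * exp (Complex c y * of_real x))" if "i < 3" for i x
  proof (rule line_integrable[where \<phi> = "\<lambda>v. v ^ i * \<phi> v * exp (v * of_real x)" and M = "M / c ^ (2 - i) * exp (c * x)"])
    fix v assume v: "Re v = c"
    have v0: "c \<le> norm v" using complex_Re_le_cmod[of v] v by simp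
    then have v1: "norm v > 0" using c by linarith
    have "0 \<le> M / norm v ^ 4" using bd[OF v] norm_ge_zero order_trans by blast
    then have M: "0 \<le> M" using v1 by (simp add: zero_le_divide_iff)
    have "norm v ^ i * norm (\<phi> v) \<le> norm v ^ i * (M / norm v ^ 4)"
      using bd[OF v] by (intro mult_left_mono) auto
    also have "\<dots> = M / norm v ^ (2 - i) / norm v ^ 2"
    proof -
      have "norm v ^ 4 = norm v ^ i * norm v ^ (2 - i) * norm v ^ 2"
        using that by (simp flip: power_add)
      then show ?thesis using v1 by simp
    qed
    also have "\<dots> \<le> M / c ^ (2 - i) / norm v ^ 2"
      using M c v0 v1 by (intro divide_right_mono divide_left_mono power_mono mult_pos_pos) auto
    finally have "norm v ^ i * norm (\<phi> v) * exp (c * x) \<le> M / c ^ (2 - i) / norm v ^ 2 * exp (c * x)"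
      by (intro mult_right_mono) auto
    then show "norm (v ^ i * \<phi> v * exp (v * of_real x)) \<le> M / c ^ (2 - i) * exp (c * x) / norm v ^ 2"
      using v by (simp add: norm_mult norm_power)
  qed (use c in \<open>auto intro!: continuous_intros cont\<close>)
  let ?f = "\<lambda>y x. \<phi> (Complex c y) * exp (Complex c y * of_real x)"
  let ?g = "\<lambda>y. Complex c y * \<phi> (Complex c y) * exp (Complex c y * of_real x)"
  \<comment> \<open>For |z - x| < 1 the factor exp (c |z - x|) is at most exp c, whence the exponent
    |x| + 1.\<close>
  let ?C = "\<lambda>y. M * exp (c * (\<bar>x\<bar> + 1)) * (1 / (c\<^sup>2 + y\<^sup>2))"
  have "((\<lambda>x. \<integral>y. ?f y x \<partial>lborel) has_derivative (\<lambda>h. \<integral>y. h *\<^sub>R ?g y \<partial>lborel)) (at x within UNIV)"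
  proof (rule has_derivative_integral_of_quadratic_bound[where C = ?C and \<delta> = 1])
    show "integrable lborel (\<lambda>y. ?f y x)" for x
      using int[of 0 x] by simp
    show "integrable lborel (\<lambda>y. h *\<^sub>R ?g y)" for h
      using int[of 1 x] by simp
    show "bounded_linear (\<lambda>h. \<integral>y. h *\<^sub>R ?g y \<partial>lborel)"
      unfolding integral_scaleR_right by (rule bounded_linear_scaleR_left)
    show "integrable lborel ?C"
      by (rule integrable_mult_right[OF integrable_inverse_c_plus_square(1)[OF c]])
    fix y z :: real assume z: "norm (z - x) < 1"
    define v where "v = Complex c y"
    have v: "Re v = c" by (simp add: v_def)
    have v1: "norm v > 0" using complex_Re_le_cmod[of v] v c by linarith
    have nM: "0 \<le> M / norm v ^ 4" using bd[OF v] norm_ge_zero order_trans by blast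
    let ?x = "v * of_real (z - x)"
    have "?f y z - ?f y x - (z - x) *\<^sub>R ?g y = \<phi> v * exp (v * of_real x) * (exp ?x - 1 - ?x)"
    proof -
      have "exp (v * of_real z) = exp (v * of_real x) * exp ?x"
        by (simp add: algebra_simps flip: exp_add)
      then show ?thesis
        by (simp add: v_def[symmetric] scaleR_conv_of_real algebra_simps)
    qed
    also have "norm \<dots> \<le> M / norm v ^ 4 * exp (c * \<bar>x\<bar>) * ((norm v * norm (z - x)) ^ 2 * exp (c * 1))"
    proof -
      have e1: "norm (\<phi> v * exp (v * of_real x)) \<le> M / norm v ^ 4 * exp (c * \<bar>x\<bar>)"
        unfolding norm_mult using bd[OF v] nM c v by (intro mult_mono) auto
      have "norm (exp ?x - 1 - ?x) \<le> norm ?x ^ 2 * exp \<bar>Re ?x\<bar>"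
        by (rule norm_exp_minus_one_minus_le_Re)
      also have "\<dots> \<le> (norm v * norm (z - x)) ^ 2 * exp (c * 1)"
        using z v c by (intro mult_mono) (simp_all add: norm_mult abs_mult del: of_real_diff)
      finally have e2: "norm (exp ?x - 1 - ?x) \<le> (norm v * norm (z - x)) ^ 2 * exp (c * 1)" .
      show ?thesis
        unfolding norm_mult[of "\<phi> v * exp (v * of_real x)"]
        by (intro mult_mono e1 e2 mult_nonneg_nonneg nM) auto
    qed
    also have "\<dots> = ?C y * norm (z - x) ^ 2"
    proof -
      have "norm v ^ 4 = norm v ^ 2 * norm v ^ 2" by (simp flip: power_add)
      moreover have "c\<^sup>2 + y\<^sup>2 = norm v ^ 2" by (simp add: v_def norm_Complex_square)
      moreover have "exp (c * (\<bar>x\<bar> + 1)) = exp (c * \<bar>x\<bar>) * exp (c * 1)"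
        by (simp add: distrib_left exp_add)
      ultimately show ?thesis
        using v1 by (simp only: power_mult_distrib) (simp add: field_simps)
    qed
    finally show "norm (?f y z - ?f y x - (z - x) *\<^sub>R ?g y) \<le> ?C y * norm (z - x) ^ 2" .
  qed auto
  then have "((\<lambda>x. \<integral>y. ?f y x \<partial>lborel) has_vector_derivative (\<integral>y. ?g y \<partial>lborel)) (at x)"
    unfolding integral_scaleR_right has_vector_derivative_def by simp
  from has_vector_derivative_divide[OF has_vector_derivative_at_within[OF this], of "complex_of_real (2 * pi)"]
  show ?thesis
    by (simp add: line_int_def)
qed

lemma line_int_add:
  assumes "integrable lborel (\<lambda>y. f (Complex c y))" "integrable lborel (\<lambda>y. g (Complex c y))"
  shows "line_int c (\<lambda>v. f v + g v) = line_int c f + line_int c g"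
  using assms by (simp add: line_int_def add_divide_distrib)

lemma line_int_cmult: "line_int c (\<lambda>v. k * f v) = k * line_int c f"
  by (simp add: line_int_def)

section \<open>Inverse Laplace transform of a Gevrey asymptotic function\<close>

text \<open>The function \<open>g k\<close> below is the \<open>k\<close>-th derivative of the inverse Laplace transform of \<open>S\<close> on
  the positive half-line. Removing more terms of the expansion makes the integrand decay faster, so
  \<open>g k\<close> has an absolutely convergent representation for every truncation order \<open>n \<ge> 2\<close>; going up to
  \<open>n = 4\<close> allows differentiation under the integral sign with a quadratic remainder.\<close>

locale gevrey_half_plane =
  fixes S :: "complex \<Rightarrow> complex" and cf :: "nat \<Rightarrow> complex" and r B K :: real
  assumes r: "r > 0" and B: "B > 0"
    and holS: "S holomorphic_on {w. Re w > B}"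
    and est: "\<And>w n. Re w > B \<Longrightarrow> n \<ge> 1 \<Longrightarrow>
      norm (S w - (\<Sum>j=1..n. cf j / w ^ j)) \<le> K * fact n / r ^ n / (norm w ^ n * (Re w - B))"
begin

definition R where "R n w = S w - (\<Sum>j=1..n. cf j / w ^ j)"

lemma R_Suc: "R n w = cf (Suc n) / w ^ Suc n + R (Suc n) w"
  by (simp add: R_def)

lemma holR: "R n holomorphic_on {w. Re w > B}"
  unfolding R_def[abs_def] using B by (intro holomorphic_intros holS) auto

lemma K_nonneg: "K \<ge> 0"
proof -
  have "0 \<le> K * fact 1 / r ^ 1 / (norm (complex_of_real (B + 1)) ^ 1 * (Re (complex_of_real (B + 1)) - B))"
    using order_trans[OF norm_ge_zero est[of "of_real (B + 1)" 1]] by simp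
  moreover have "r * (B + 1) > 0" using r B by simp
  ultimately show ?thesis
    using B by (auto simp: zero_le_divide_iff)
qed

text \<open>\<open>k\<close> counts derivatives and \<open>i\<close> is the decay wanted at
  infinity; the surplus n - (k + i) powers of |v| are estimated below by powers of
  \<open>c\<close>.\<close>

lemma R_bound:
  assumes "c > B" "Re v \<ge> c" "n \<ge> k + i" "n \<ge> 1"
  shows "norm (v ^ k * R n v) \<le> (K * fact n / r ^ n / ((c - B) * c ^ (n - (k + i)))) / norm v ^ i"
proof -
  have v: "c \<le> norm v" using complex_Re_le_cmod[of v] assms by linarith
  have c: "c > 0" using assms B by linarith
  then have v1: "norm v > 0" using v by linarith
  have KK: "0 \<le> K * fact n / r ^ n" using K_nonneg r by simp
  have "norm (v ^ k * R n v) \<le> norm v ^ k * (K * fact n / r ^ n / (norm v ^ n * (Re v - B)))"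
    unfolding norm_mult norm_power R_def using est[of v n] assms by (intro mult_left_mono) auto
  also have "\<dots> = K * fact n / r ^ n / (norm v ^ (n - (k + i)) * (Re v - B) * norm v ^ i)"
  proof -
    have "norm v ^ n = norm v ^ (n - (k + i)) * norm v ^ k * norm v ^ i"
      using assms(3) by (simp flip: power_add)
    then show ?thesis using v1 by simp
  qed
  also have "\<dots> \<le> K * fact n / r ^ n / (c ^ (n - (k + i)) * (c - B) * norm v ^ i)"
    using KK v v1 c assms by (intro divide_left_mono mult_mono power_mono mult_pos_pos zero_less_power mult_nonneg_nonneg) auto
  finally show ?thesis
    by (simp add: mult_ac)
qed

lemma continuous_R:
  assumes "c > B"
  shows "continuous_on {v. Re v = c} (\<lambda>v. v ^ k * R n v)"
  using assms by (intro continuous_intros continuous_on_subset[OF holomorphic_on_imp_continuous_on[OF holR]]) auto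

lemma R_exp_bound:
  assumes "c > B" "Re v \<ge> c" "Re v \<le> d" "x \<ge> 0" "n \<ge> k + 2"
  shows "norm (v ^ k * R n v * exp (v * of_real x))
    \<le> (K * fact n / r ^ n / ((c - B) * c ^ (n - (k + 2))) * exp (d * x)) / norm v ^ 2"
proof -
  have b: "norm (v ^ k * R n v) \<le> (K * fact n / r ^ n / ((c - B) * c ^ (n - (k + 2)))) / norm v ^ 2"
    using assms by (intro R_bound) auto
  have "norm (v ^ k * R n v) * norm (exp (v * of_real x)) \<le> (K * fact n / r ^ n / ((c - B) * c ^ (n - (k + 2)))) / norm v ^ 2 * exp (d * x)"
    using b assms order_trans[OF norm_ge_zero b] by (intro mult_mono) (auto intro: mult_right_mono)
  then show ?thesis
    unfolding norm_mult[of "v ^ k * R n v"] by simp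
qed

lemma line_integrable_R:
  assumes "c > B" "x \<ge> 0" "n \<ge> k + 2"
  shows "integrable lborel (\<lambda>y. Complex c y ^ k * R n (Complex c y) * exp (Complex c y * of_real x))"
  using assms B
  by (intro line_integrable[OF _ _ R_exp_bound[where k = k and n = n and c = c and d = c and x = x]]
      continuous_on_mult[OF continuous_R[OF assms(1)]] continuous_intros) auto

lemma line_int_R_indep:
  assumes "c > B" "c \<le> d" "x \<ge> 0" "n \<ge> k + 2"
  shows "line_int c (\<lambda>v. v ^ k * R n v * exp (v * of_real x)) = line_int d (\<lambda>v. v ^ k * R n v * exp (v * of_real x))"
proof (rule line_int_shift)
  show "(\<lambda>v. v ^ k * R n v * exp (v * of_real x)) holomorphic_on {v. Re v > B}"
    by (intro holomorphic_intros holR)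
  show "norm (v ^ k * R n v * exp (v * of_real x))
    \<le> (K * fact n / r ^ n / ((c - B) * c ^ (n - (k + 2))) * exp (d * x)) / norm v ^ 2" if "c \<le> Re v" "Re v \<le> d" for v
    using assms that by (intro R_exp_bound) auto
qed (use assms B in auto)

definition g where
  "g k x = cf (k + 1) + cf (k + 2) * of_real x + line_int (B + 1) (\<lambda>v. v ^ k * R (k + 2) v * exp (v * of_real x))"

text \<open>Formally \<open>g k\<close> is the inverse Laplace integral of v^k S(v). The terms with
  index j \<le> k of the expansion become polynomials in v and contribute nothing, which is why the
  sum starts at \<open>cf (k + 1)\<close>; the term of index k + 1 + i contributes x^i / i!. The
  induction moves one such term at a time out of the integral.\<close>

lemma g_eq_line_int:
  assumes c: "c > B" and x: "x \<ge> 0" and n: "n \<ge> 2"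
  shows "g k x = (\<Sum>i<n. cf (k + 1 + i) * of_real x ^ i / fact i) + line_int c (\<lambda>v. v ^ k * R (k + n) v * exp (v * of_real x))"
  using n
proof (induction n rule: dec_induct)
  case base
  have "line_int (B + 1) (\<lambda>v. v ^ k * R (k + 2) v * exp (v * of_real x)) = line_int c (\<lambda>v. v ^ k * R (k + 2) v * exp (v * of_real x))"
  proof (cases "B + 1 \<le> c")
    case True
    with x show ?thesis by (intro line_int_R_indep) auto
  next
    case False
    with x c show ?thesis by (intro line_int_R_indep[symmetric]) auto
  qed
  then show ?case
    by (simp add: g_def numeral_2_eq_2)
next
  case (step n)
  have c0: "c > 0" using c B by linarith
  let ?T = "cf (k + 1 + n) * of_real x ^ n / fact n"
  have "line_int c (\<lambda>v. v ^ k * R (k + n) v * exp (v * of_real x))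
      = line_int c (\<lambda>v. cf (k + 1 + n) * (exp (v * of_real x) / v ^ (n + 1)) + v ^ k * R (k + Suc n) v * exp (v * of_real x))"
    unfolding line_int_def
  proof (intro arg_cong2[where f = "(/)"] Bochner_Integration.integral_cong refl)
    fix y
    have "Complex c y \<noteq> 0" using c0 by (simp add: complex_eq_iff)
    then show "Complex c y ^ k * R (k + n) (Complex c y) * exp (Complex c y * of_real x) =
      cf (k + 1 + n) * (exp (Complex c y * of_real x) / Complex c y ^ (n + 1)) + Complex c y ^ k * R (k + Suc n) (Complex c y) * exp (Complex c y * of_real x)"
      unfolding R_Suc[of "k + n"] by (simp add: field_simps power_add)
  qed
  also have "\<dots> = cf (k + 1 + n) * line_int c (\<lambda>v. exp (v * of_real x) / v ^ (n + 1)) + line_int c (\<lambda>v. v ^ k * R (k + Suc n) v * exp (v * of_real x))"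
  proof (subst line_int_add)
    show "integrable lborel (\<lambda>y. cf (k + 1 + n) * (exp (Complex c y * of_real x) / Complex c y ^ (n + 1)))"
      using step.hyps c0 by (intro integrable_mult_right line_integrable_exp_div_power) auto
    show "integrable lborel (\<lambda>y. Complex c y ^ k * R (k + Suc n) (Complex c y) * exp (Complex c y * of_real x))"
      using step.hyps c x by (intro line_integrable_R) auto
  qed (simp only: line_int_cmult)
  also have "line_int c (\<lambda>v. exp (v * of_real x) / v ^ (n + 1)) = of_real x ^ n / fact n"
    using line_int_exp_div_power[OF c0 x, of "n - 1"] step.hyps by (simp add: eval_nat_numeral)
  finally show ?case
    using step.IH by simp
qed

text \<open>Truncating \<open>g k\<close> after 4 terms and \<open>g (Suc k)\<close> after 3 puts
  the same remainder \<open>R (k + 4)\<close> under both integrals, so differentiation merely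
  inserts a factor v.\<close>

lemma g_has_vector_derivative:
  assumes x: "x \<ge> 0"
  shows "(g k has_vector_derivative g (Suc k) x) (at x within {0..})"
proof -
  define c where "c = B + 1"
  have c: "c > B" "c > 0" using B by (auto simp: c_def)
  have g4: "g k y = (\<Sum>i<4. cf (k + 1 + i) * of_real y ^ i / fact i) + line_int c (\<lambda>v. v ^ k * R (k + 4) v * exp (v * of_real y))" if "y \<ge> 0" for y
    using g_eq_line_int[OF c(1) that, of 4 k] by simp
  have g3: "g (Suc k) x = (\<Sum>i<3. cf (k + 2 + i) * of_real x ^ i / fact i) + line_int c (\<lambda>v. v * (v ^ k * R (k + 4) v) * exp (v * of_real x))"
    using g_eq_line_int[OF c(1) x, of 3 "Suc k"] by (simp add: eval_nat_numeral mult.assoc)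
  have "((\<lambda>y. \<Sum>i<4. cf (k + 1 + i) * of_real y ^ i / fact i) has_vector_derivative
      (\<Sum>i<3. cf (k + 2 + i) * of_real x ^ i / fact i)) (at x within {0..})"
    by (rule has_vector_derivative_real_field)
       (auto intro!: derivative_eq_intros simp: eval_nat_numeral field_simps)
  moreover have "((\<lambda>y. line_int c (\<lambda>v. v ^ k * R (k + 4) v * exp (v * of_real y))) has_vector_derivative
      line_int c (\<lambda>v. v * (v ^ k * R (k + 4) v) * exp (v * of_real x))) (at x within {0..})"
    by (rule has_vector_derivative_line_int[OF continuous_R[OF c(1)] c(2) R_bound[OF c(1)]]) (auto simp: c)
  ultimately have "((\<lambda>y. (\<Sum>i<4. cf (k + 1 + i) * of_real y ^ i / fact i) + line_int c (\<lambda>v. v ^ k * R (k + 4) v * exp (v * of_real y))) has_vector_derivative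
      g (Suc k) x) (at x within {0..})"
    unfolding g3 by (rule has_vector_derivative_add)
  then show ?thesis
    by (rule has_vector_derivative_transform[rotated 2]) (use x g4 in auto)
qed

text \<open>Consecutive remainders differ by one term of the expansion, so a coefficient can be read
  off at the real point B + 1, where Re w - B = 1. The estimate does not cover truncation order 0,
  so \<open>cf 1\<close> is put into the constant by hand.\<close>

lemma cf_bound: "\<exists>M\<ge>0. \<forall>n\<ge>1. norm (cf n) \<le> M * fact n / r ^ n"
proof -
  define b where "b = B + 1"
  define M where "M = K * (b * r + 1) + norm (cf 1) * r"
  have b: "b > 0" "b > B" using B by (auto simp: b_def)
  have M0: "M \<ge> 0" using K_nonneg b r by (simp add: M_def)
  have "norm (cf n) \<le> M * fact n / r ^ n" if "n \<ge> 1" for n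
  proof (cases "n = 1")
    case True
    have "norm (cf 1) * r \<le> M" using K_nonneg b r by (simp add: M_def)
    with True r show ?thesis by (simp add: field_simps)
  next
    case False
    define j where "j = n - 1"
    have n: "n = Suc j" "j \<ge> 1" using that False by (auto simp: j_def)
    let ?w = "complex_of_real b"
    have "cf (Suc j) = ?w ^ Suc j * R j ?w - ?w ^ Suc j * R (Suc j) ?w"
      using R_Suc[of j ?w] b by (simp add: field_simps)
    then have "norm (cf (Suc j)) \<le> norm (?w ^ Suc j * R j ?w) + norm (?w ^ Suc j * R (Suc j) ?w)"
      by (simp only: norm_triangle_ineq4)
    also have "norm (?w ^ Suc j * R j ?w) = b * norm (?w ^ j * R j ?w)"
      using b by (simp add: norm_mult)
    also have "norm (?w ^ j * R j ?w) \<le> K * fact j / r ^ j"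
      using R_bound[of b ?w j 0 j] b n by (simp add: b_def)
    also have "norm (?w ^ Suc j * R (Suc j) ?w) \<le> K * fact (Suc j) / r ^ Suc j"
      using R_bound[of b ?w "Suc j" 0 "Suc j"] b n by (simp add: b_def)
    finally have *: "norm (cf (Suc j)) \<le> b * (K * fact j / r ^ j) + K * fact (Suc j) / r ^ Suc j"
      using b by simp
    have "fact j \<le> (fact (Suc j) :: real)" by (intro fact_mono) auto
    then have "b * (K * fact j / r ^ j) \<le> b * (K * fact (Suc j) / r ^ j)"
      using b K_nonneg r by (intro mult_left_mono divide_right_mono) auto
    also have "\<dots> = (K * (b * r)) * fact (Suc j) / r ^ Suc j"
      using r by simp
    finally have "norm (cf (Suc j)) \<le> (K * (b * r)) * fact (Suc j) / r ^ Suc j + K * fact (Suc j) / r ^ Suc j"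
      using * by linarith
    also have "\<dots> = K * (b * r + 1) * (fact (Suc j) / r ^ Suc j)"
      by (simp add: distrib_left add_divide_distrib distrib_right)
    also have "\<dots> \<le> M * (fact (Suc j) / r ^ Suc j)"
      using r by (intro mult_right_mono) (auto simp: M_def)
    finally show ?thesis by (simp add: n)
  qed
  with M0 show ?thesis by blast
qed

text \<open>The integral for the k-th derivative uses truncation order k + 2. The extra factor (k +
  1) (k + 2) is at most 4 * 2^k, and this costs half of the radius.\<close>

lemma fact_add2_le: "fact (k + 2) / r ^ (k + 2) \<le> (4 / r\<^sup>2) * (fact k / (r / 2) ^ k)"
proof -
  have "(real k + 1) * (real k + 2) \<le> 4 * 2 ^ k"
  proof (induction k)
    case (Suc k)
    show ?case
    proof (cases "k \<le> 1")
      case True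
      then have "k = 0 \<or> k = 1" by auto
      then show ?thesis by auto
    next
      case False
      then have k2: "2 \<le> real k" by linarith
      then have "2 * real k \<le> real k * real k" by (intro mult_right_mono) auto
      with k2 have "2 \<le> real k + real k * real k" by linarith
      then have "(real (Suc k) + 1) * (real (Suc k) + 2) \<le> 2 * ((real k + 1) * (real k + 2))"
        by (simp add: algebra_simps)
      with Suc show ?thesis by simp
    qed
  qed auto
  then have "(real k + 1) * (real k + 2) * (fact k / r ^ (k + 2)) \<le> 4 * 2 ^ k * (fact k / r ^ (k + 2))"
    using r by (intro mult_right_mono) auto
  then show ?thesis
    using r by (simp add: power_divide power2_eq_square mult_ac add_ac)
qed

text \<open>Integrating along Re v = b gives the rate \<open>b\<close>. The constant contains 1 / (b
  - B), so each b > B has its own.\<close>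

lemma g_bound:
  assumes b: "b > B"
  shows "\<exists>M\<ge>0. \<forall>k. \<forall>x\<ge>0. norm (g k x) \<le> M * exp (b * x) * fact k / (r / 2) ^ k"
proof -
  have b0: "b > 0" using b B by linarith
  obtain M1 where M1: "M1 \<ge> 0" "\<And>n. n \<ge> 1 \<Longrightarrow> norm (cf n) \<le> M1 * fact n / r ^ n"
    using cf_bound by blast
  define M where "M = M1 * r + M1 / b + K / (b - B) / (2 * b)"
  have M0: "M \<ge> 0" using M1(1) r b b0 K_nonneg by (auto simp: M_def)
  have "norm (g k x) \<le> (M * (4 / r\<^sup>2)) * exp (b * x) * fact k / (r / 2) ^ k" if x: "x \<ge> 0" for k x
  proof -
    define q where "q = (fact (k + 2) / r ^ (k + 2) :: real)"
    have q0: "q \<ge> 0" using r by (simp add: q_def)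
    have e1: "1 \<le> exp (b * x)" using x b0 by simp
    have e2: "x \<le> exp (b * x) / b"
    proof -
      have "b * x \<le> exp (b * x)" using exp_ge_add_one_self[of "b * x"] by linarith
      then show ?thesis using b0 by (simp add: field_simps)
    qed
    have gk: "g k x = cf (k + 1) + cf (k + 2) * of_real x + line_int b (\<lambda>v. v ^ k * R (k + 2) v * exp (v * of_real x))"
      using g_eq_line_int[OF b x, of 2 k] by (simp add: eval_nat_numeral)
    have t1: "norm (cf (k + 1)) \<le> M1 * r * q * exp (b * x)"
    proof -
      have "fact (k + 1) \<le> (fact (k + 2) :: real)" by (intro fact_mono) auto
      then have "M1 * fact (k + 1) / r ^ (k + 1) \<le> M1 * fact (k + 2) / r ^ (k + 1)"
        using M1(1) r by (intro mult_left_mono divide_right_mono) auto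
      also have "\<dots> = M1 * r * q * 1"
        using r by (simp add: q_def)
      also have "\<dots> \<le> M1 * r * q * exp (b * x)"
        using M1(1) r q0 e1 by (intro mult_left_mono) auto
      finally show ?thesis using M1(2)[of "k + 1"] by simp
    qed
    have t2: "norm (cf (k + 2) * of_real x) \<le> M1 * q * (exp (b * x) / b)"
    proof -
      have "norm (cf (k + 2)) \<le> M1 * q" using M1(2)[of "k + 2"] by (simp add: q_def)
      then show ?thesis
        unfolding norm_mult using e2 x M1(1) q0 by (intro mult_mono) auto
    qed
    have t3: "norm (line_int b (\<lambda>v. v ^ k * R (k + 2) v * exp (v * of_real x))) \<le> (K * q / (b - B) * exp (b * x)) / (2 * b)"
    proof (rule norm_line_int_le[OF b0])
      fix v assume "Re v = b"
      then show "norm (v ^ k * R (k + 2) v * exp (v * of_real x)) \<le> (K * q / (b - B) * exp (b * x)) / norm v ^ 2"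
        using R_exp_bound[OF b _ _ x, of v b k "k + 2"] by (simp add: q_def del: fact_Suc)
    qed
    have "norm (g k x) \<le> M1 * r * q * exp (b * x) + M1 * q * (exp (b * x) / b) + (K * q / (b - B) * exp (b * x)) / (2 * b)"
      unfolding gk by (intro norm_triangle_le add_mono t1 t2 t3)
    also have "\<dots> = M * exp (b * x) * q"
      by (simp add: M_def algebra_simps)
    also have "\<dots> \<le> M * exp (b * x) * ((4 / r\<^sup>2) * (fact k / (r / 2) ^ k))"
      using M0 fact_add2_le[of k] by (intro mult_left_mono) (auto simp: q_def)
    finally show ?thesis by (simp add: mult_ac)
  qed
  moreover have "M * (4 / r\<^sup>2) \<ge> 0" using M0 by simp
  ultimately show ?thesis by blast
qed

text \<open>At x = 0 the factor exp (v x) is 1, so the integrand decays in the whole half-plane and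
  the line can be moved to infinity. The Taylor coefficients at 0 are thus those of the Borel
  transform.\<close>

lemma g_at_0: "g k 0 = cf (Suc k)"
proof -
  have "line_int (B + 1) (\<lambda>v. v ^ k * R (k + 2) v * exp (v * of_real 0)) = 0"
  proof (rule line_int_eq_0)
    show "(\<lambda>v. v ^ k * R (k + 2) v * exp (v * of_real 0)) holomorphic_on {v. Re v > B}"
      by (intro holomorphic_intros holR)
    show "norm (v ^ k * R (k + 2) v * exp (v * of_real 0))
      \<le> (K * fact (k + 2) / r ^ (k + 2) / ((B + 1 - B) * (B + 1) ^ (k + 2 - (k + 2)))) / norm v ^ 2" if "B + 1 \<le> Re v" for v
      using R_bound[of "B + 1" v k 2 "k + 2"] that by simp
  qed (use B in auto)
  then show ?thesis by (simp add: g_def)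
qed

lemma laplace_g:
  assumes w: "Re w > B"
  shows "laplace (g 0) w = S w"
proof -
  \<comment> \<open>The line has to separate \<open>w\<close> from Re v = B: only then are both the
    Fubini step and the Cauchy formula with kernel 1 / (w - v) available.\<close>
  define c where "c = (Re w + B) / 2"
  have c: "B < c" "c < Re w" "c > 0" using w B by (auto simp: c_def)
  have w0: "w \<noteq> 0" using w B by auto
  have Rb: "norm (R 2 v) \<le> (K * fact 2 / r ^ 2 / ((c - B) * c ^ (2 - (0 + 2)))) / norm v ^ 2" if "Re v \<ge> c" for v
    using R_bound[of c v 0 2 2] c that by simp
  let ?e = "\<lambda>x. exp (- (w * complex_of_real x))"
  let ?L = "\<lambda>x. line_int c (\<lambda>v. R 2 v * exp (v * complex_of_real x))"
  have I: "set_integrable lborel {0<..} (\<lambda>x. ?L x * ?e x)"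
    and LL: "laplace ?L w = line_int c (\<lambda>v. R 2 v / (w - v))"
    using laplace_line_int[OF _ c(3,2) Rb[OF eq_refl[OF sym]]] continuous_R[of c 0 2] c by auto
  have I1: "set_integrable lborel {0<..} (\<lambda>x. cf 1 * ?e x)"
    using laplace_one(1)[of w] w B by (intro set_integrable_mult_right) auto
  have "set_integrable lborel {0<..} (\<lambda>x. of_real x * ?e x)"
  proof (rule set_integrable_laplace[where b = 0 and \<alpha> = 2 and M = 1])
  qed (use w B in \<open>auto intro!: continuous_intros\<close>)
  then have I2: "set_integrable lborel {0<..} (\<lambda>x. cf 2 * (of_real x * ?e x))"
    by (intro set_integrable_mult_right)
  have "laplace (g 0) w = laplace (\<lambda>x. cf 1 + cf 2 * of_real x + ?L x) w"
  proof (rule laplace_cong)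
    fix x :: real assume "x > 0"
    then show "g 0 x = cf 1 + cf 2 * of_real x + ?L x"
      using g_eq_line_int[of c x 2 0] c by (simp add: eval_nat_numeral)
  qed
  also have "\<dots> = (LINT x:{0<..}|lborel. (cf 1 * ?e x + cf 2 * (of_real x * ?e x)) + ?L x * ?e x)"
    unfolding laplace_def by (simp add: algebra_simps)
  also have "\<dots> = (LINT x:{0<..}|lborel. cf 1 * ?e x) + (LINT x:{0<..}|lborel. cf 2 * (of_real x * ?e x)) + (LINT x:{0<..}|lborel. ?L x * ?e x)"
    by (simp only: set_integral_add(2)[OF set_integral_add(1)[OF I1 I2] I] set_integral_add(2)[OF I1 I2])
  also have "\<dots> = cf 1 / w + cf 2 / w\<^sup>2 + R 2 w"
  proof -
    have "(LINT x:{0<..}|lborel. cf 1 * ?e x) = cf 1 / w"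
      using laplace_one(2)[of w] w B by simp
    moreover have "(LINT x:{0<..}|lborel. cf 2 * (of_real x * ?e x)) = cf 2 / w\<^sup>2"
      using laplace_id[of w] w B by (simp add: laplace_def)
    moreover have "(LINT x:{0<..}|lborel. ?L x * ?e x) = R 2 w"
      using LL half_plane_Cauchy_formula[OF holR _ c(1,2) Rb] B by (simp add: laplace_def)
    ultimately show ?thesis by (simp only:)
  qed
  also have "\<dots> = S w"
    by (simp add: R_def eval_nat_numeral)
  finally show ?thesis .
qed

end

section \<open>Analytic continuation to a neighbourhood of the half-line\<close>

text \<open>Allowing every b > B makes the class stable under multiplication by \<xi>, and it still
  gives convergent Laplace integrals on all of Re w > B.\<close>

definition exp_type :: "real \<Rightarrow> real \<Rightarrow> (complex \<Rightarrow> complex) \<Rightarrow> bool" where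
  "exp_type r B f \<longleftrightarrow> (\<forall>b>B. \<exists>M\<ge>0. \<forall>\<xi>\<in>Bset r. norm (f \<xi>) \<le> M * exp (b * norm \<xi>))"

section \<open>Geometry of the neighbourhoods \<open>Bset r\<close>\<close>

definition nearest :: "complex \<Rightarrow> real" where "nearest \<xi> = max 0 (Re \<xi>)"

lemma nearest_nonneg: "nearest \<xi> \<ge> 0"
  by (simp add: nearest_def)

lemma nearest_le_norm: "nearest \<xi> \<le> norm \<xi>"
  using complex_Re_le_cmod[of \<xi>] by (simp add: nearest_def)

lemma dist_nearest_le:
  assumes "x \<ge> 0"
  shows "dist \<xi> (of_real (nearest \<xi>)) \<le> dist \<xi> (of_real x)"
proof -
  have "(Re \<xi> - nearest \<xi>)\<^sup>2 \<le> (Re \<xi> - x)\<^sup>2"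
    using assms by (intro abs_le_square_iff[THEN iffD1]) (auto simp: nearest_def)
  then show ?thesis
    by (simp add: dist_norm cmod_def)
qed

lemma nearest_dist_le:
  assumes "x \<ge> 0"
  shows "\<bar>nearest \<xi> - x\<bar> \<le> dist \<xi> (of_real x)"
proof -
  have "\<bar>nearest \<xi> - x\<bar> \<le> \<bar>Re (\<xi> - of_real x)\<bar>"
    using assms by (auto simp: nearest_def)
  also have "\<dots> \<le> dist \<xi> (of_real x)"
    unfolding dist_norm by (rule abs_Re_le_cmod)
  finally show ?thesis .
qed

lemma mem_Bset_iff_nearest: "\<xi> \<in> Bset r \<longleftrightarrow> dist \<xi> (of_real (nearest \<xi>)) < r"
proof -
  have "infdist \<xi> (complex_of_real ` {0..}) = dist \<xi> (of_real (nearest \<xi>))"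
  proof (rule antisym)
    show "infdist \<xi> (complex_of_real ` {0..}) \<le> dist \<xi> (of_real (nearest \<xi>))"
      by (rule infdist_le) (auto simp: nearest_nonneg)
    show "dist \<xi> (of_real (nearest \<xi>)) \<le> infdist \<xi> (complex_of_real ` {0..})"
      by (subst infdist_notempty) (auto intro!: cINF_greatest dist_nearest_le)
  qed
  then show ?thesis by (simp add: Bset_def)
qed

lemma mem_Bset_iff: "\<xi> \<in> Bset r \<longleftrightarrow> (\<exists>x\<ge>0. dist \<xi> (of_real x) < r)"
  unfolding mem_Bset_iff_nearest using dist_nearest_le nearest_nonneg le_less_trans by blast

lemma Bset_eq_Union: "Bset r = (\<Union>x\<in>{0..}. ball (of_real x) r)"
  by (auto simp: mem_Bset_iff dist_commute)

lemma open_Bset: "open (Bset r)"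
  unfolding Bset_eq_Union by auto

lemma Bset_mono: "r \<le> s \<Longrightarrow> Bset r \<subseteq> Bset s"
  by (auto simp: Bset_def)

lemma of_real_in_Bset: "r > 0 \<Longrightarrow> x \<ge> 0 \<Longrightarrow> of_real x \<in> Bset r"
  unfolding mem_Bset_iff by (auto intro!: exI[of _ x])

lemma in_Bset_of_norm_less: "norm \<xi> < r \<Longrightarrow> \<xi> \<in> Bset r"
  unfolding mem_Bset_iff by (auto intro!: exI[of _ 0])

text \<open>Star-shapedness about 0: it keeps the argument \<open>of_real s * \<xi>\<close> of the
  Euler integrals inside the domain.\<close>

lemma Bset_scale:
  assumes "\<xi> \<in> Bset r" "0 \<le> s" "s \<le> 1"
  shows "of_real s * \<xi> \<in> Bset r"
proof -
  from assms obtain x where x: "x \<ge> 0" "dist \<xi> (of_real x) < r" by (auto simp: mem_Bset_iff)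
  have "dist (of_real s * \<xi>) (of_real (s * x)) = s * dist \<xi> (of_real x)"
    using assms by (simp add: dist_norm norm_mult flip: right_diff_distrib)
  also have "\<dots> \<le> 1 * dist \<xi> (of_real x)"
    using assms by (intro mult_right_mono) auto
  finally have "dist (of_real s * \<xi>) (of_real (s * x)) < r" using x by simp
  moreover have "s * x \<ge> 0" using assms x by simp
  ultimately show ?thesis unfolding mem_Bset_iff by blast
qed

lemma Bset_add:
  assumes "\<xi> \<in> Bset r" "dist \<eta> \<xi> \<le> d" "r + d \<le> s"
  shows "\<eta> \<in> Bset s"
proof -
  from assms obtain x where x: "x \<ge> 0" "dist \<xi> (of_real x) < r" by (auto simp: mem_Bset_iff)
  have "dist \<eta> (of_real x) < s"
    using dist_triangle[of \<eta> "of_real x" \<xi>] x assms by linarith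
  with x show ?thesis unfolding mem_Bset_iff by blast
qed

lemma exp_type_mono:
  assumes "exp_type r B f" "r' \<le> r"
  shows "exp_type r' B f"
  using assms Bset_mono[OF assms(2)] unfolding exp_type_def by blast

lemma islimpt_of_real_Ioo:
  assumes "a < p" "p < b"
  shows "complex_of_real p islimpt (of_real ` {a<..<b})"
  unfolding islimpt_approachable
proof (intro allI impI)
  fix e :: real assume "e > 0"
  define x where "x = p + min e (b - p) / 2"
  have "p < x" "x < b" "x < p + e" using \<open>e > 0\<close> assms by (auto simp: x_def min_def field_simps)
  with assms have "x \<in> {a<..<b}" "of_real x \<noteq> complex_of_real p" "dist (of_real x) (complex_of_real p) < e"
    by (auto simp: dist_norm simp flip: of_real_diff)
  then show "\<exists>x'\<in>of_real ` {a<..<b}. x' \<noteq> complex_of_real p \<and> dist x' (complex_of_real p) < e"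
    by blast
qed

text \<open>The Taylor discs centred at nearby points of the half-line agree because both series reproduce
  \<open>g 0\<close> on a common real interval, to the right of the centres; the disc used at \<open>\<xi>\<close> is the one centred
  at the point of the half-line nearest to \<open>\<xi>\<close>.\<close>

locale taylor_bounded =
  fixes g :: "nat \<Rightarrow> real \<Rightarrow> complex" and \<rho> B :: real
  assumes \<rho>: "\<rho> > 0" and B: "B \<ge> 0"
    and D: "\<And>k x. x \<ge> 0 \<Longrightarrow> (g k has_vector_derivative g (Suc k) x) (at x within {0..})"
    and bd: "\<And>b. b > B \<Longrightarrow> \<exists>M\<ge>0. \<forall>k. \<forall>x\<ge>0. norm (g k x) \<le> M * exp (b * x) * fact k / \<rho> ^ k"
begin

definition T where "T x \<xi> = (\<Sum>k. g k x / fact k * (\<xi> - of_real x) ^ k)"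

lemma term_bound:
  assumes M: "\<forall>k. \<forall>x\<ge>0. norm (g k x) \<le> M * exp (b * x) * fact k / \<rho> ^ k" and x: "x \<ge> 0"
  shows "norm (g k x / fact k * (\<xi> - of_real x) ^ k) \<le> M * exp (b * x) * (dist \<xi> (of_real x) / \<rho>) ^ k"
proof -
  have "norm (g k x / fact k * (\<xi> - of_real x) ^ k) = norm (g k x) / fact k * dist \<xi> (of_real x) ^ k"
    by (simp add: norm_mult norm_divide norm_power dist_norm)
  also have "\<dots> \<le> (M * exp (b * x) * fact k / \<rho> ^ k) / fact k * dist \<xi> (of_real x) ^ k"
    using M x by (intro mult_right_mono divide_right_mono) auto
  finally show ?thesis
    by (simp add: power_divide)
qed

lemma T_sums:
  assumes x: "x \<ge> 0" and \<xi>: "dist \<xi> (of_real x) < \<rho>"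
  shows "(\<lambda>k. g k x / fact k * (\<xi> - of_real x) ^ k) sums T x \<xi>"
proof -
  obtain M where M: "\<forall>k. \<forall>x\<ge>0. norm (g k x) \<le> M * exp ((B + 1) * x) * fact k / \<rho> ^ k"
    using bd[of "B + 1"] by auto
  have "summable (\<lambda>k. M * exp ((B + 1) * x) * (dist \<xi> (of_real x) / \<rho>) ^ k)"
    using \<xi> \<rho> by (intro summable_mult summable_geometric) auto
  then have "summable (\<lambda>k. g k x / fact k * (\<xi> - of_real x) ^ k)"
    by (rule summable_comparison_test') (use term_bound[OF M x] in auto)
  then show ?thesis unfolding T_def by (rule summable_sums)
qed

lemma norm_T_le:
  assumes M: "\<forall>k. \<forall>x\<ge>0. norm (g k x) \<le> M * exp (b * x) * fact k / \<rho> ^ k" and x: "x \<ge> 0"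
    and \<xi>: "dist \<xi> (of_real x) \<le> \<rho>'" "\<rho>' < \<rho>"
  shows "norm (T x \<xi>) \<le> M * exp (b * x) * (1 / (1 - \<rho>' / \<rho>))"
proof -
  have r0: "0 \<le> \<rho>'" using \<xi>(1) zero_le_dist order_trans by blast
  have "M * exp (b * x) \<ge> 0"
    using order_trans[OF norm_ge_zero M[rule_format, OF x, of 0]] by simp
  have q: "norm (g k x / fact k * (\<xi> - of_real x) ^ k) \<le> M * exp (b * x) * (\<rho>' / \<rho>) ^ k" for k
  proof -
    have "M * exp (b * x) * (dist \<xi> (of_real x) / \<rho>) ^ k \<le> M * exp (b * x) * (\<rho>' / \<rho>) ^ k"
      using \<open>M * exp (b * x) \<ge> 0\<close> \<xi> \<rho> by (intro mult_left_mono power_mono divide_right_mono) auto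
    then show ?thesis using term_bound[OF M x, of k \<xi>] by linarith
  qed
  have s: "(\<lambda>k. M * exp (b * x) * (\<rho>' / \<rho>) ^ k) sums (M * exp (b * x) * (1 / (1 - \<rho>' / \<rho>)))"
    using r0 \<rho> \<xi> by (intro sums_mult geometric_sums) auto
  have "norm (T x \<xi>) \<le> (\<Sum>k. M * exp (b * x) * (\<rho>' / \<rho>) ^ k)"
    unfolding T_def using q sums_summable[OF s] by (rule norm_suminf_le)
  with s show ?thesis by (simp add: sums_iff)
qed

lemma holomorphic_T:
  assumes "x \<ge> 0"
  shows "T x holomorphic_on ball (of_real x) \<rho>"
  by (rule power_series_holomorphic[where a = "\<lambda>k. g k x / fact k"])
     (use T_sums[OF assms] in \<open>auto simp: dist_commute\<close>)

text \<open>Taylor's formula with integral remainder: the bound on \<open>g p\<close> and the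
  quotient fact p / fact (p - 1) = p leave a remainder of size p q^p with q = (t - x) / \<rho> < 1.
  Working to the right of the centre also covers x = 0, where the derivatives are one-sided.\<close>

lemma T_of_real:
  assumes x: "x \<ge> 0" and t: "x \<le> t" "t < x + \<rho>"
  shows "T x (of_real t) = g 0 t"
proof -
  obtain M where M: "M \<ge> 0" "\<forall>k. \<forall>x\<ge>0. norm (g k x) \<le> M * exp ((B + 1) * x) * fact k / \<rho> ^ k"
    using bd[of "B + 1"] by auto
  define q where "q = (t - x) / \<rho>"
  have q: "0 \<le> q" "q < 1" using t \<rho> by (auto simp: q_def)
  have part: "norm (g 0 t - (\<Sum>k<p. g k x / fact k * (of_real t - of_real x) ^ k)) \<le> M * exp ((B + 1) * t) * (real p * q ^ p)"
    if p: "p > 0" for p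
  proof -
    let ?i = "\<lambda>s. ((t - s) ^ (p - 1) / fact (p - 1)) *\<^sub>R g p s"
    have D': "(g m has_vector_derivative g (Suc m) s) (at s within {x..t})" if "x \<le> s" "s \<le> t" for m s
      using D[of s m] x that by (auto intro: has_vector_derivative_within_subset)
    have I: "(?i has_integral g 0 t - (\<Sum>k<p. ((t - x) ^ k / fact k) *\<^sub>R g k x)) {x..t}"
      by (rule Taylor_has_integral[where Df = g and f = "g 0" and a = x and b = t]) (use p D' t in auto)
    have "norm (g 0 t - (\<Sum>k<p. ((t - x) ^ k / fact k) *\<^sub>R g k x))
        \<le> (t - x) ^ (p - 1) / fact (p - 1) * (M * exp ((B + 1) * t) * fact p / \<rho> ^ p) * measure lborel (cbox x t)"
    proof (rule has_integral_bound)
      show "(?i has_integral g 0 t - (\<Sum>k<p. ((t - x) ^ k / fact k) *\<^sub>R g k x)) (cbox x t)"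
        using I by simp
      show "0 \<le> (t - x) ^ (p - 1) / fact (p - 1) * (M * exp ((B + 1) * t) * fact p / \<rho> ^ p)"
        using t M(1) \<rho> by simp
      fix s assume s: "s \<in> cbox x t"
      have "norm (g p s) \<le> M * exp ((B + 1) * s) * fact p / \<rho> ^ p"
        using M(2) s x by auto
      also have "\<dots> \<le> M * exp ((B + 1) * t) * fact p / \<rho> ^ p"
        using s B M(1) \<rho> by (intro divide_right_mono mult_right_mono mult_left_mono) (auto intro: mult_left_mono)
      finally have "norm (g p s) \<le> M * exp ((B + 1) * t) * fact p / \<rho> ^ p" .
      moreover have "\<bar>(t - s) ^ (p - 1) / fact (p - 1)\<bar> \<le> (t - x) ^ (p - 1) / fact (p - 1)"
        using s by (auto intro!: divide_right_mono power_mono simp: power_abs)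
      ultimately show "norm (?i s) \<le> (t - x) ^ (p - 1) / fact (p - 1) * (M * exp ((B + 1) * t) * fact p / \<rho> ^ p)"
        unfolding norm_scaleR using t by (intro mult_mono) auto
    qed
    also have "\<dots> = M * exp ((B + 1) * t) * (real p * q ^ p)"
    proof -
      have "fact p = real p * fact (p - 1)" using p by (simp add: fact_reduce)
      moreover have "(t - x) ^ p = (t - x) ^ (p - 1) * (t - x)"
        using p by (metis Suc_diff_1 power_Suc2)
      ultimately show ?thesis
        using t by (simp add: q_def power_divide mult_ac)
    qed
    finally show ?thesis
      by (simp add: scaleR_conv_of_real mult_ac flip: of_real_diff)
  qed
  have lim: "(\<lambda>p. M * exp ((B + 1) * t) * (real p * q ^ p)) \<longlonglongrightarrow> M * exp ((B + 1) * t) * 0"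
    using powser_times_n_limit_0[of q] q by (intro tendsto_mult tendsto_const) auto
  have "(\<lambda>p. g 0 t - (\<Sum>k<p. g k x / fact k * (of_real t - of_real x) ^ k)) \<longlonglongrightarrow> 0"
  proof (rule Lim_null_comparison)
    show "\<forall>\<^sub>F p in sequentially. norm (g 0 t - (\<Sum>k<p. g k x / fact k * (of_real t - of_real x) ^ k))
        \<le> M * exp ((B + 1) * t) * (real p * q ^ p)"
      using eventually_gt_at_top[of 0] by eventually_elim (rule part)
    show "(\<lambda>p. M * exp ((B + 1) * t) * (real p * q ^ p)) \<longlonglongrightarrow> 0"
      using lim by simp
  qed
  moreover have "(\<lambda>p. g 0 t - (\<Sum>k<p. g k x / fact k * (of_real t - of_real x) ^ k)) \<longlonglongrightarrow> g 0 t - T x (of_real t)"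
    using T_sums[OF x, of "of_real t"] t
    by (intro tendsto_diff tendsto_const) (auto simp: sums_def dist_norm simp flip: of_real_diff)
  ultimately have "0 = g 0 t - T x (of_real t)"
    by (rule LIMSEQ_unique)
  then show ?thesis by simp
qed

lemma T_agree:
  assumes x: "0 \<le> x" "x \<le> y" "y < x + \<rho>" and \<xi>: "\<xi> \<in> ball (of_real x) \<rho>" "\<xi> \<in> ball (of_real y) \<rho>"
  shows "T x \<xi> = T y \<xi>"
proof -
  let ?S = "ball (complex_of_real x) \<rho> \<inter> ball (of_real y) \<rho>"
  let ?p = "(y + (x + \<rho>)) / 2"
  have sub: "of_real t \<in> ?S" if "y < t" "t < x + \<rho>" for t
    using that x by (auto simp: dist_norm simp flip: of_real_diff)
  have "T x \<xi> - T y \<xi> = 0"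
  proof (rule analytic_continuation[where f = "\<lambda>\<xi>. T x \<xi> - T y \<xi>"])
    show "(\<lambda>\<xi>. T x \<xi> - T y \<xi>) holomorphic_on ?S"
      using x by (intro holomorphic_intros holomorphic_on_subset[OF holomorphic_T]) auto
    show "connected ?S"
      by (intro convex_connected convex_Int convex_ball)
    show "of_real ` {y<..<x + \<rho>} \<subseteq> ?S"
      using sub by auto
    show "complex_of_real ?p islimpt (of_real ` {y<..<x + \<rho>})"
      using x by (intro islimpt_of_real_Ioo) auto
    show "of_real ?p \<in> ?S"
      using x by (intro sub) auto
    show "\<xi> \<in> ?S" using \<xi> by simp
    fix z assume "z \<in> complex_of_real ` {y<..<x + \<rho>}"
    then obtain t where "z = of_real t" "y < t" "t < x + \<rho>" by auto
    then show "T x z - T y z = 0"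
      using T_of_real[of x t] T_of_real[of y t] x by simp
  qed auto
  then show ?thesis by simp
qed

definition G where "G \<xi> = T (nearest \<xi>) \<xi>"

text \<open>The centre in \<open>G\<close> moves with \<xi>. This identity freezes it, so that
  \<open>G\<close> is a single power series on each disc.\<close>

lemma G_eq_T:
  assumes x: "x \<ge> 0" and \<xi>: "dist \<xi> (of_real x) < \<rho>"
  shows "G \<xi> = T x \<xi>"
proof -
  have d: "dist \<xi> (of_real (nearest \<xi>)) < \<rho>" "\<bar>nearest \<xi> - x\<bar> < \<rho>"
    using dist_nearest_le[OF x, of \<xi>] nearest_dist_le[OF x, of \<xi>] \<xi> by linarith+
  show ?thesis
    unfolding G_def
  proof (cases "x \<le> nearest \<xi>")
    case True
    with d x \<xi> show "T (nearest \<xi>) \<xi> = T x \<xi>"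
      by (intro T_agree[symmetric]) (auto simp: dist_commute)
  next
    case False
    with d x \<xi> show "T (nearest \<xi>) \<xi> = T x \<xi>"
      by (intro T_agree) (auto simp: dist_commute nearest_nonneg)
  qed
qed

lemma holomorphic_G: "G holomorphic_on Bset \<rho>"
  unfolding Bset_eq_Union
proof (rule holomorphic_on_UN_open)
  fix x :: real assume "x \<in> {0..}"
  then show "G holomorphic_on ball (of_real x) \<rho>"
    using holomorphic_T[of x] by (rule_tac holomorphic_transform) (auto simp: G_eq_T dist_commute)
qed auto

lemma G_of_real: "x \<ge> 0 \<Longrightarrow> G (of_real x) = g 0 x"
  using G_eq_T[of x "of_real x"] T_of_real[of x x] \<rho> by simp

lemma G_sums: "norm \<xi> < \<rho> \<Longrightarrow> (\<lambda>k. g k 0 / fact k * \<xi> ^ k) sums G \<xi>"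
  using G_eq_T[of 0 \<xi>] T_sums[of 0 \<xi>] by simp

text \<open>Strictly inside radius \<rho> the geometric majorants are bounded uniformly, and a rate
  at the centre is also a rate at \<xi> because the nearest point of the half-line has no larger
  modulus.\<close>

lemma exp_type_G:
  assumes "\<rho>' < \<rho>"
  shows "exp_type \<rho>' B G"
  unfolding exp_type_def
proof (intro allI impI)
  fix b assume b: "b > B"
  obtain M where M: "M \<ge> 0" "\<forall>k. \<forall>x\<ge>0. norm (g k x) \<le> M * exp (b * x) * fact k / \<rho> ^ k"
    using bd[OF b] by auto
  let ?N = "M * (1 / (1 - \<rho>' / \<rho>))"
  have q: "1 - \<rho>' / \<rho> > 0" using assms \<rho> by simp
  have "norm (G \<xi>) \<le> ?N * exp (b * norm \<xi>)" if "\<xi> \<in> Bset \<rho>'" for \<xi>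
  proof -
    have d: "dist \<xi> (of_real (nearest \<xi>)) \<le> \<rho>'" using that by (simp add: mem_Bset_iff_nearest)
    have "norm (G \<xi>) \<le> M * exp (b * nearest \<xi>) * (1 / (1 - \<rho>' / \<rho>))"
      unfolding G_def by (rule norm_T_le[OF M(2) nearest_nonneg d assms])
    also have "\<dots> \<le> M * exp (b * norm \<xi>) * (1 / (1 - \<rho>' / \<rho>))"
      using b B M(1) q nearest_le_norm[of \<xi>] by (intro mult_right_mono mult_left_mono) (auto intro: mult_left_mono)
    finally show ?thesis by (simp add: mult_ac)
  qed
  moreover have "?N \<ge> 0" using M q by simp
  ultimately show "\<exists>M\<ge>0. \<forall>\<xi>\<in>Bset \<rho>'. norm (G \<xi>) \<le> M * exp (b * norm \<xi>)" by blast
qed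

end

section \<open>Stability of the exponential growth class\<close>

lemma exp_typeD:
  assumes "exp_type r B f" "b > B"
  obtains M where "M \<ge> 0" "\<And>\<xi>. \<xi> \<in> Bset r \<Longrightarrow> norm (f \<xi>) \<le> M * exp (b * norm \<xi>)"
  using assms unfolding exp_type_def by blast

lemma exp_type_add:
  assumes "exp_type r B f" "exp_type r B g"
  shows "exp_type r B (\<lambda>\<xi>. f \<xi> + g \<xi>)"
  unfolding exp_type_def
proof (intro allI impI)
  fix b assume b: "b > B"
  obtain M where M: "M \<ge> 0" "\<And>\<xi>. \<xi> \<in> Bset r \<Longrightarrow> norm (f \<xi>) \<le> M * exp (b * norm \<xi>)"
    using assms(1) b by (rule exp_typeD) blast
  obtain N where N: "N \<ge> 0" "\<And>\<xi>. \<xi> \<in> Bset r \<Longrightarrow> norm (g \<xi>) \<le> N * exp (b * norm \<xi>)"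
    using assms(2) b by (rule exp_typeD) blast
  have "norm (f \<xi> + g \<xi>) \<le> (M + N) * exp (b * norm \<xi>)" if "\<xi> \<in> Bset r" for \<xi>
    using norm_triangle_ineq[of "f \<xi>" "g \<xi>"] M(2)[OF that] N(2)[OF that]
    by (simp add: distrib_right)
  with M(1) N(1) show "\<exists>M\<ge>0. \<forall>\<xi>\<in>Bset r. norm (f \<xi> + g \<xi>) \<le> M * exp (b * norm \<xi>)"
    by (intro exI[of _ "M + N"]) auto
qed

lemma exp_type_cmult:
  assumes "exp_type r B f"
  shows "exp_type r B (\<lambda>\<xi>. k * f \<xi>)"
  unfolding exp_type_def
proof (intro allI impI)
  fix b assume b: "b > B"
  obtain M where M: "M \<ge> 0" "\<And>\<xi>. \<xi> \<in> Bset r \<Longrightarrow> norm (f \<xi>) \<le> M * exp (b * norm \<xi>)"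
    using assms(1) b by (rule exp_typeD) blast
  have "norm (k * f \<xi>) \<le> (norm k * M) * exp (b * norm \<xi>)" if "\<xi> \<in> Bset r" for \<xi>
    using mult_left_mono[OF M(2)[OF that], of "norm k"] by (simp add: norm_mult mult.assoc)
  with M(1) show "\<exists>M\<ge>0. \<forall>\<xi>\<in>Bset r. norm (k * f \<xi>) \<le> M * exp (b * norm \<xi>)"
    by (intro exI[of _ "norm k * M"]) auto
qed

text \<open>Half of the gap b - B pays for the factor |\<xi>|, by |\<xi>| \<le> exp (d |\<xi>|) /
  d.\<close>

lemma exp_type_mult_id:
  assumes "exp_type r B f"
  shows "exp_type r B (\<lambda>\<xi>. \<xi> * f \<xi>)"
  unfolding exp_type_def
proof (intro allI impI)
  fix b assume b: "b > B"
  define d where "d = (b - B) / 2"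
  have d: "d > 0" "b - d > B" using b by (auto simp: d_def field_simps)
  obtain M where M: "M \<ge> 0" "\<And>\<xi>. \<xi> \<in> Bset r \<Longrightarrow> norm (f \<xi>) \<le> M * exp ((b - d) * norm \<xi>)"
    using assms d(2) by (rule exp_typeD) blast
  have "norm (\<xi> * f \<xi>) \<le> (M / d) * exp (b * norm \<xi>)" if "\<xi> \<in> Bset r" for \<xi>
  proof -
    have "d * norm \<xi> \<le> exp (d * norm \<xi>)"
      using exp_ge_add_one_self[of "d * norm \<xi>"] by linarith
    then have "norm \<xi> \<le> exp (d * norm \<xi>) / d"
      using d by (simp add: field_simps)
    then have "norm \<xi> * norm (f \<xi>) \<le> (exp (d * norm \<xi>) / d) * (M * exp ((b - d) * norm \<xi>))"
      using M(2)[OF that] d by (intro mult_mono) auto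
    also have "\<dots> = (M / d) * (exp (d * norm \<xi>) * exp ((b - d) * norm \<xi>))"
      by simp
    also have "exp (d * norm \<xi>) * exp ((b - d) * norm \<xi>) = exp (b * norm \<xi>)"
      by (simp add: algebra_simps flip: exp_add)
    finally show ?thesis by (simp add: norm_mult)
  qed
  with M(1) d show "\<exists>M\<ge>0. \<forall>\<xi>\<in>Bset r. norm (\<xi> * f \<xi>) \<le> M * exp (b * norm \<xi>)"
    by (intro exI[of _ "M / d"]) auto
qed

text \<open>Cauchy's inequality on discs of one fixed radius \<open>d\<close>, which fit between the
  two neighbourhoods. The rate is unchanged because |z| exceeds |\<xi>| by at most \<open>d\<close>
  on such a disc.\<close>

lemma norm_higher_deriv_le_on_Bset:
  assumes hol: "f holomorphic_on Bset r" and r': "0 < d" "r' + d < r" and "b \<ge> 0" "M \<ge> 0"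
    and bd: "\<And>\<xi>. \<xi> \<in> Bset r \<Longrightarrow> norm (f \<xi>) \<le> M * exp (b * norm \<xi>)"
    and \<xi>: "\<xi> \<in> Bset r'"
  shows "norm ((deriv ^^ n) f \<xi>) \<le> fact n * (M * exp (b * (norm \<xi> + d))) / d ^ n"
proof (rule Cauchy_inequality)
  have sub: "cball \<xi> d \<subseteq> Bset r"
    using r' by (auto intro!: Bset_add[OF \<xi>, of _ d] simp: dist_commute)
  show "f holomorphic_on ball \<xi> d"
    using hol sub by (meson ball_subset_cball holomorphic_on_subset order_trans)
  show "continuous_on (cball \<xi> d) f"
    using holomorphic_on_imp_continuous_on[OF hol] sub by (rule continuous_on_subset)
  fix z assume z: "norm (\<xi> - z) = d"
  then have "norm (f z) \<le> M * exp (b * norm z)"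
    using sub by (intro bd) (auto simp: dist_norm)
  also have "norm z \<le> norm \<xi> + d"
    using z norm_triangle_ineq2[of z \<xi>] by (simp add: norm_minus_commute)
  finally show "norm (f z) \<le> M * exp (b * (norm \<xi> + d))"
    using assms by (auto intro: mult_left_mono)
qed (use r' in auto)

lemma exp_type_deriv:
  assumes hol: "f holomorphic_on Bset r" and "B \<ge> 0" "r' < r" and ty: "exp_type r B f"
  shows "exp_type r' B (deriv f)"
  unfolding exp_type_def
proof (intro allI impI)
  fix b assume b: "b > B"
  define d where "d = (r - r') / 2"
  have d: "0 < d" "r' + d < r" using assms by (auto simp: d_def field_simps)
  obtain M where M: "M \<ge> 0" "\<And>\<xi>. \<xi> \<in> Bset r \<Longrightarrow> norm (f \<xi>) \<le> M * exp (b * norm \<xi>)"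
    using ty b by (rule exp_typeD) blast
  have "norm (deriv f \<xi>) \<le> (M * exp (b * d) / d) * exp (b * norm \<xi>)" if "\<xi> \<in> Bset r'" for \<xi>
    using norm_higher_deriv_le_on_Bset[OF hol d _ M that, of 1] b assms
    by (simp add: distrib_left exp_add mult_ac)
  with M(1) d show "\<exists>M\<ge>0. \<forall>\<xi>\<in>Bset r'. norm (deriv f \<xi>) \<le> M * exp (b * norm \<xi>)"
    by (intro exI[of _ "M * exp (b * d) / d"]) auto
qed

section \<open>Euler integrals and shifts of the Gamma factors\<close>

text \<open>The unnormalised Beta density, extended by 0 so that Euler integrals run over the whole
  line.\<close>

definition beta_weight :: "real \<Rightarrow> real \<Rightarrow> real \<Rightarrow> real" where
  "beta_weight p q s = indicator {0..1} s * (s powr (p - 1) * (1 - s) powr (q - 1))"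

lemma beta_weight_nonneg: "beta_weight p q s \<ge> 0"
  by (simp add: beta_weight_def)

lemma beta_weight_eq_0: "s \<notin> {0..1} \<Longrightarrow> beta_weight p q s = 0"
  by (simp add: beta_weight_def)

lemma integrable_beta_weight:
  assumes "p > 0" "q > 0"
  shows "integrable lborel (beta_weight p q)" "(\<integral>s. beta_weight p q s \<partial>lborel) = Beta p q"
proof -
  have I: "set_integrable lborel {0..1} (\<lambda>t. t powr (p - 1) * (1 - t) powr (q - 1))"
    by (rule integrable_Beta[OF assms])
  then show "integrable lborel (beta_weight p q)"
    by (simp add: set_integrable_def beta_weight_def[abs_def])
  have "(\<integral>s. beta_weight p q s \<partial>lborel) = integral {0..1} (\<lambda>t. t powr (p - 1) * (1 - t) powr (q - 1))"
    using set_borel_integral_eq_integral(2)[OF I] by (simp add: set_lebesgue_integral_def beta_weight_def[abs_def])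
  also have "\<dots> = Beta p q"
    using has_integral_Beta_real[OF assms] by (rule integral_unique)
  finally show "(\<integral>s. beta_weight p q s \<partial>lborel) = Beta p q" .
qed

lemma beta_weight_power: "beta_weight p q s * s ^ j = beta_weight (p + real j) q s"
proof (cases "s \<in> {0<..1}")
  case True
  then have "s powr (p - 1) * s ^ j = s powr (p + real j - 1)"
    using powr_add[of s "p - 1" "real j"] by (simp add: powr_realpow algebra_simps)
  with True show ?thesis by (simp add: beta_weight_def mult_ac)
\<comment> \<open>The remaining case contains s = 0, where both sides vanish because
  \<open>0 powr x = 0\<close>.\<close>
qed (auto simp: beta_weight_def indicator_def)

definition euler_int :: "real \<Rightarrow> real \<Rightarrow> (complex \<Rightarrow> complex) \<Rightarrow> complex \<Rightarrow> complex" where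
  "euler_int p q f \<xi> = (\<integral>s. beta_weight p q s *\<^sub>R f (of_real s * \<xi>) \<partial>lborel)"

lemma euler_integrable:
  assumes p: "p > 0" and q: "q > 0" and cont: "continuous_on {0..1} f"
  shows "integrable lborel (\<lambda>s. beta_weight p q s *\<^sub>R (f s :: complex))"
proof -
  have "compact (f ` {0..1})"
    using cont by (intro compact_continuous_image) auto
  then obtain M where M: "\<And>s. s \<in> {0..1} \<Longrightarrow> norm (f s) \<le> M"
    using compact_imp_bounded by (force simp: bounded_iff)
  show ?thesis
  proof (rule Bochner_Integration.integrable_bound)
    show "integrable lborel (\<lambda>s. beta_weight p q s * M)"
      by (rule integrable_mult_left[OF integrable_beta_weight(1)[OF p q]])
    have *: "(\<lambda>s. indicator {0..1} s *\<^sub>R f s) \<in> borel_measurable borel"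
      by (rule borel_measurable_continuous_on_indicator[OF _ cont]) auto
    have eq: "beta_weight p q s *\<^sub>R f s = beta_weight p q s *\<^sub>R (indicator {0..1} s *\<^sub>R f s)" for s
      by (simp add: beta_weight_def indicator_def)
    show "(\<lambda>s. beta_weight p q s *\<^sub>R f s) \<in> borel_measurable lborel"
      unfolding eq
      by (rule borel_measurable_scaleR) (use * borel_measurable_integrable[OF integrable_beta_weight(1)[OF p q]] in auto)
    show "AE s in lborel. norm (beta_weight p q s *\<^sub>R f s) \<le> norm (beta_weight p q s * M)"
    proof (intro AE_I2)
      fix s
      show "norm (beta_weight p q s *\<^sub>R f s) \<le> norm (beta_weight p q s * M)"
      proof (cases "s \<in> {0..1}")
        case True
        then have "norm (f s) \<le> \<bar>M\<bar>" using M[OF True] by linarith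
        then show ?thesis by (simp add: abs_mult mult_left_mono)
      qed (simp add: beta_weight_eq_0)
    qed
  qed
qed

lemma continuous_on_scaled:
  assumes "f holomorphic_on Bset r" "\<xi> \<in> Bset r"
  shows "continuous_on {0..1} (\<lambda>s. f (of_real s * \<xi>))"
proof (rule continuous_on_compose2[OF holomorphic_on_imp_continuous_on[OF assms(1)]])
  show "(\<lambda>s. complex_of_real s * \<xi>) ` {0..1} \<subseteq> Bset r"
    using assms by (auto intro: Bset_scale)
qed (intro continuous_intros)

lemma norm_euler_int_le:
  assumes pq: "p > 0" "q > 0" and "b \<ge> 0" "M \<ge> 0"
    and bd: "\<And>\<xi>. \<xi> \<in> Bset r \<Longrightarrow> norm (f \<xi>) \<le> M * exp (b * norm \<xi>)" and \<xi>: "\<xi> \<in> Bset r"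
  shows "norm (euler_int p q f \<xi>) \<le> Beta p q * M * exp (b * norm \<xi>)"
proof -
  have "norm (euler_int p q f \<xi>) \<le> (\<integral>s. beta_weight p q s * (M * exp (b * norm \<xi>)) \<partial>lborel)"
    unfolding euler_int_def
  proof (rule norm_lebesgue_integral_le)
    show "integrable lborel (\<lambda>s. beta_weight p q s * (M * exp (b * norm \<xi>)))"
      by (rule integrable_mult_left[OF integrable_beta_weight(1)[OF pq]])
    fix s :: real
    show "norm (beta_weight p q s *\<^sub>R f (of_real s * \<xi>)) \<le> beta_weight p q s * (M * exp (b * norm \<xi>))"
    proof (cases "s \<in> {0..1}")
      case True
      then have "norm (f (of_real s * \<xi>)) \<le> M * exp (b * norm (of_real s * \<xi>))"
        using \<xi> by (intro bd Bset_scale) auto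
      also have "norm (of_real s * \<xi>) \<le> 1 * norm \<xi>"
        unfolding norm_mult using True by (intro mult_right_mono) auto
      finally have "norm (f (of_real s * \<xi>)) \<le> M * exp (b * norm \<xi>)"
        using \<open>b \<ge> 0\<close> \<open>M \<ge> 0\<close> by (simp add: mult_left_mono)
      then show ?thesis
        by (simp add: beta_weight_nonneg mult_left_mono)
    qed (simp add: beta_weight_eq_0)
  qed
  also have "\<dots> = Beta p q * M * exp (b * norm \<xi>)"
    by (simp add: integrable_beta_weight(2)[OF pq])
  finally show ?thesis .
qed

lemma exp_type_euler_int:
  assumes "p > 0" "q > 0" "B \<ge> 0" "exp_type r B f"
  shows "exp_type r B (euler_int p q f)"
  unfolding exp_type_def
proof (intro allI impI)
  fix b assume b: "b > B"
  obtain M where M: "M \<ge> 0" "\<And>\<xi>. \<xi> \<in> Bset r \<Longrightarrow> norm (f \<xi>) \<le> M * exp (b * norm \<xi>)"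
    using assms(4) b by (rule exp_typeD) blast
  have "Beta p q \<ge> 0"
    using integrable_beta_weight(2)[OF assms(1,2)] beta_weight_nonneg by (metis Bochner_Integration.integral_nonneg)
  with M(1) show "\<exists>M\<ge>0. \<forall>\<xi>\<in>Bset r. norm (euler_int p q f \<xi>) \<le> M * exp (b * norm \<xi>)"
    using norm_euler_int_le[OF assms(1,2) _ M] b assms(3) by (intro exI[of _ "Beta p q * M"]) auto
qed

text \<open>Differentiation under the integral. The quadratic remainder comes from a bound on the
  second derivative of \<open>f\<close> on the compact set of all s z with s in [0, 1] and z near
  \<xi>; star-shapedness keeps this set in the domain.\<close>

lemma holomorphic_euler_int:
  assumes pq: "p > 0" "q > 0" and hol: "f holomorphic_on Bset r"
  shows "euler_int p q f holomorphic_on Bset r"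
proof -
  have hol1: "deriv f holomorphic_on Bset r"
    by (rule holomorphic_deriv[OF hol open_Bset])
  have hol2: "deriv (deriv f) holomorphic_on Bset r"
    by (rule holomorphic_deriv[OF hol1 open_Bset])
  have "\<exists>D. (euler_int p q f has_field_derivative D) (at \<xi> within Bset r)" if \<xi>: "\<xi> \<in> Bset r" for \<xi>
  proof -
    obtain d where d: "d > 0" "cball \<xi> d \<subseteq> Bset r"
      using open_contains_cball_eq[OF open_Bset] \<xi> by blast
    define C where "C = (\<lambda>(s, z). complex_of_real s * z) ` ({0..1} \<times> cball \<xi> d)"
    have "compact C"
      unfolding C_def split_def by (intro compact_continuous_image continuous_intros compact_Times) auto
    moreover have "C \<subseteq> Bset r"
      unfolding C_def using d by (auto intro!: Bset_scale)
    ultimately have "compact (deriv (deriv f) ` C)"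
      by (intro compact_continuous_image continuous_on_subset[OF holomorphic_on_imp_continuous_on[OF hol2]])
    then obtain N where N: "\<And>z. z \<in> C \<Longrightarrow> norm (deriv (deriv f) z) \<le> N"
      using compact_imp_bounded by (force simp: bounded_iff)
    let ?f' = "\<lambda>s. beta_weight p q s *\<^sub>R (of_real s * deriv f (of_real s * \<xi>))"
    have I': "integrable lborel ?f'"
      using continuous_on_scaled[OF hol1 \<xi>] by (intro euler_integrable pq continuous_intros)
    have "((\<lambda>z. \<integral>s. beta_weight p q s *\<^sub>R f (of_real s * z) \<partial>lborel) has_derivative (\<lambda>h. \<integral>s. ?f' s * h \<partial>lborel)) (at \<xi> within Bset r)"
    proof (rule has_derivative_integral_of_quadratic_bound[where C = "\<lambda>s. beta_weight p q s * N", OF _ _ _ _ \<xi> d(1)])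
      show "integrable lborel (\<lambda>s. beta_weight p q s *\<^sub>R f (of_real s * z))" if "z \<in> Bset r" for z
        by (intro euler_integrable pq continuous_on_scaled[OF hol that])
      show "integrable lborel (\<lambda>s. ?f' s * h)" for h
        by (rule integrable_mult_left[OF I'])
      show "bounded_linear (\<lambda>h. \<integral>s. ?f' s * h \<partial>lborel)"
        unfolding integral_mult_left_zero by (rule bounded_linear_mult_right)
      show "integrable lborel (\<lambda>s. beta_weight p q s * N)"
        by (rule integrable_mult_left[OF integrable_beta_weight(1)[OF pq]])
      fix s :: real and z assume z: "z \<in> Bset r" "norm (z - \<xi>) < d"
      show "norm (beta_weight p q s *\<^sub>R f (of_real s * z) - beta_weight p q s *\<^sub>R f (of_real s * \<xi>) - ?f' s * (z - \<xi>))
          \<le> beta_weight p q s * N * norm (z - \<xi>) ^ 2"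
      proof (cases "s \<in> {0..1}")
        case True
        define F where "F i z = (if i = 0 then f (of_real s * z) else if i = 1 then of_real s * deriv f (of_real s * z)
            else of_real s * of_real s * deriv (deriv f) (of_real s * z))" for i :: nat and z
        have dd: "((\<lambda>z. h (of_real s * z)) has_field_derivative of_real s * deriv h (of_real s * x)) (at x within cball \<xi> d)"
          if "h holomorphic_on Bset r" "x \<in> cball \<xi> d" for h x
        proof -
          have "of_real s * x \<in> Bset r" using that d True by (auto intro: Bset_scale)
          then have "(h has_field_derivative deriv h (of_real s * x)) (at (of_real s * x))"
            using that open_Bset by (intro holomorphic_derivI) auto
          from DERIV_chain2[where f = h and g = "\<lambda>x. of_real s * x", OF this DERIV_cmult_Id] show ?thesis
            by (simp add: mult.commute)
        qed
        have "norm (F 0 z - (\<Sum>i\<le>1. F i \<xi> * (z - \<xi>) ^ i / fact i)) \<le> N * norm (z - \<xi>) ^ Suc 1 / fact 1"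
        proof (rule complex_Taylor[where S = "cball \<xi> d"])
          fix i :: nat and x assume x: "x \<in> cball \<xi> d" "i \<le> 1"
          then consider "i = 0" | "i = 1" by linarith
          then show "(F i has_field_derivative F (Suc i) x) (at x within cball \<xi> d)"
          proof cases
            case 1
            then show ?thesis using dd[OF hol x(1)] by (simp add: F_def[abs_def])
          next
            case 2
            then show ?thesis using DERIV_cmult[OF dd[OF hol1 x(1)], of "of_real s"] by (simp add: F_def[abs_def] mult.assoc)
          qed
        next
          fix x assume x: "x \<in> cball \<xi> d"
          have "of_real s * x \<in> C" using x True by (auto simp: C_def)
          then have "s * s * norm (deriv (deriv f) (of_real s * x)) \<le> 1 * N"
            using True N by (intro mult_mono) (auto intro: mult_le_one)
          then show "norm (F (Suc 1) x) \<le> N"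
            using True by (simp add: F_def norm_mult)
        qed (use d z in \<open>auto simp: dist_norm norm_minus_commute\<close>)
        then have "norm (f (of_real s * z) - f (of_real s * \<xi>) - of_real s * deriv f (of_real s * \<xi>) * (z - \<xi>)) \<le> N * norm (z - \<xi>) ^ 2"
          by (simp add: F_def numeral_2_eq_2 diff_diff_eq)
        then have "beta_weight p q s * norm (f (of_real s * z) - f (of_real s * \<xi>) - of_real s * deriv f (of_real s * \<xi>) * (z - \<xi>))
            \<le> beta_weight p q s * (N * norm (z - \<xi>) ^ 2)"
          by (intro mult_left_mono beta_weight_nonneg)
        also have "beta_weight p q s * norm (f (of_real s * z) - f (of_real s * \<xi>) - of_real s * deriv f (of_real s * \<xi>) * (z - \<xi>))
          = norm (beta_weight p q s *\<^sub>R (f (of_real s * z) - f (of_real s * \<xi>) - of_real s * deriv f (of_real s * \<xi>) * (z - \<xi>)))"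
          by (simp add: beta_weight_nonneg)
        finally show ?thesis
          by (simp add: scaleR_diff_right mult.assoc)
      qed (simp add: beta_weight_eq_0)
    qed
    then have "((\<lambda>z. \<integral>s. beta_weight p q s *\<^sub>R f (of_real s * z) \<partial>lborel) has_field_derivative (\<integral>s. ?f' s \<partial>lborel)) (at \<xi> within Bset r)"
      by (simp only: has_field_derivative_def integral_mult_left_zero)
    then show ?thesis
      unfolding euler_int_def by blast
  qed
  then show ?thesis
    by (auto simp: holomorphic_on_def field_differentiable_def)
qed

text \<open>Termwise integration, dominated because |s| \<le> 1: a factor s^j only shifts the first
  parameter of the Beta density.\<close>

lemma euler_int_sums:
  assumes pq: "p > 0" "q > 0" and sums: "\<And>\<xi>. norm \<xi> < \<epsilon> \<Longrightarrow> (\<lambda>j. c j * \<xi> ^ j) sums f \<xi>"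
    and \<xi>: "norm \<xi> < \<epsilon>"
  shows "(\<lambda>j. of_real (Beta (p + real j) q) * c j * \<xi> ^ j) sums euler_int p q f \<xi>"
proof -
  obtain e where e: "norm \<xi> < e" "e < \<epsilon>" using \<xi> dense by blast
  have "summable (\<lambda>j. c j * of_real e ^ j)"
    using sums[of "of_real e"] e norm_ge_zero[of \<xi>] by (intro sums_summable) (auto simp del: norm_ge_zero)
  then have abs: "summable (\<lambda>j. norm (c j * \<xi> ^ j))"
    by (rule powser_insidea) (use e norm_ge_zero[of \<xi>] in \<open>auto simp del: norm_ge_zero\<close>)
  let ?h = "\<lambda>j s. beta_weight p q s *\<^sub>R (c j * (of_real s * \<xi>) ^ j)"
  have hle: "norm (?h j s) \<le> beta_weight p q s * norm (c j * \<xi> ^ j)" for j s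
  proof (cases "s \<in> {0..1}")
    case True
    have "norm (c j * (of_real s * \<xi>) ^ j) = s ^ j * norm (c j * \<xi> ^ j)"
      using True by (simp add: norm_mult norm_power power_mult_distrib)
    also have "\<dots> \<le> 1 * norm (c j * \<xi> ^ j)"
      using True by (intro mult_right_mono power_le_one) auto
    finally show ?thesis by (simp add: beta_weight_nonneg mult_left_mono)
  qed (simp add: beta_weight_eq_0)
  have I: "integrable lborel (?h j)" for j
    by (intro euler_integrable pq continuous_intros)
  have "(\<lambda>j. \<integral>s. ?h j s \<partial>lborel) sums (\<integral>s. (\<Sum>j. ?h j s) \<partial>lborel)"
  proof (rule sums_integral[OF I])
    show "AE s in lborel. summable (\<lambda>j. norm (?h j s))"
    proof (intro AE_I2)
      fix s :: real
      have "summable (\<lambda>j. beta_weight p q s * norm (c j * \<xi> ^ j))"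
        using abs by (rule summable_mult)
      then show "summable (\<lambda>j. norm (?h j s))"
        by (rule summable_comparison_test') (use hle in auto)
    qed
    have "summable (\<lambda>j. Beta p q * norm (c j * \<xi> ^ j))"
      using abs by (rule summable_mult)
    then show "summable (\<lambda>j. \<integral>s. norm (?h j s) \<partial>lborel)"
    proof (rule summable_comparison_test')
      fix j
      have "(\<integral>s. norm (?h j s) \<partial>lborel) \<le> (\<integral>s. beta_weight p q s * norm (c j * \<xi> ^ j) \<partial>lborel)"
        using hle I by (intro integral_mono integrable_norm integrable_mult_left[OF integrable_beta_weight(1)[OF pq]]) auto
      also have "\<dots> = Beta p q * norm (c j * \<xi> ^ j)"
        by (simp add: integrable_beta_weight(2)[OF pq])
      finally show "norm (\<integral>s. norm (?h j s) \<partial>lborel) \<le> Beta p q * norm (c j * \<xi> ^ j)"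
        by (simp add: Bochner_Integration.integral_nonneg)
    qed
  qed
  moreover have "(\<Sum>j. ?h j s) = beta_weight p q s *\<^sub>R f (of_real s * \<xi>)" for s
  proof (cases "s \<in> {0..1}")
    case True
    have "norm (of_real s * \<xi>) \<le> 1 * norm \<xi>"
      unfolding norm_mult using True by (intro mult_right_mono) auto
    then have "norm (of_real s * \<xi>) < \<epsilon>" using \<xi> by linarith
    from sums_scaleR_right[OF sums[OF this]] show ?thesis by (simp add: sums_iff)
  qed (simp add: beta_weight_eq_0)
  moreover have "(\<integral>s. ?h j s \<partial>lborel) = of_real (Beta (p + real j) q) * c j * \<xi> ^ j" for j
  proof -
    have "?h j s = beta_weight (p + real j) q s *\<^sub>R (c j * \<xi> ^ j)" for s
      unfolding beta_weight_power[symmetric] by (simp add: power_mult_distrib scaleR_conv_of_real mult_ac)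
    moreover have "integrable lborel (beta_weight (p + real j) q)" "(\<integral>s. beta_weight (p + real j) q s \<partial>lborel) = Beta (p + real j) q"
      using integrable_beta_weight[of "p + real j" q] pq by auto
    ultimately have "(\<integral>s. ?h j s \<partial>lborel) = Beta (p + real j) q *\<^sub>R (c j * \<xi> ^ j)"
      by (simp only: integral_scaleR_left)
    then show ?thesis
      by (simp add: scaleR_conv_of_real)
  qed
  ultimately show ?thesis
    by (simp add: euler_int_def)
qed

text \<open>Multiplies the \<open>j\<close>-th Taylor coefficient by \<open>\<Gamma>(j + p) / \<Gamma>(j + p + q - 1)\<close>. The Euler integral alone
  gives \<open>\<Gamma>(j + p + q)\<close> in the denominator; the first-order operator repairs the extra factor and allows
  both directions between the Borel transforms to be treated with \<open>q > 0\<close>.\<close>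

definition gamma_shift :: "real \<Rightarrow> real \<Rightarrow> (complex \<Rightarrow> complex) \<Rightarrow> complex \<Rightarrow> complex" where
  "gamma_shift p q f \<xi> = (of_real (p + q - 1) * euler_int p q f \<xi> + \<xi> * deriv (euler_int p q f) \<xi>) / of_real (Gamma q)"

lemma holomorphic_gamma_shift:
  assumes "p > 0" "q > 0" "f holomorphic_on Bset r"
  shows "gamma_shift p q f holomorphic_on Bset r"
proof -
  have "Gamma q > 0" using assms by (rule_tac Gamma_real_pos)
  then show ?thesis
    unfolding gamma_shift_def[abs_def]
    using holomorphic_euler_int[OF assms]
    by (intro holomorphic_intros holomorphic_deriv open_Bset) auto
qed

lemma exp_type_gamma_shift:
  assumes "p > 0" "q > 0" "f holomorphic_on Bset r" "B \<ge> 0" "exp_type r B f" "r' < r"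
  shows "exp_type r' B (gamma_shift p q f)"
proof -
  have E: "exp_type r B (euler_int p q f)"
    using assms by (intro exp_type_euler_int)
  have "exp_type r' B (\<lambda>\<xi>. (1 / of_real (Gamma q)) * (of_real (p + q - 1) * euler_int p q f \<xi> + \<xi> * deriv (euler_int p q f) \<xi>))"
    using assms by (intro exp_type_cmult exp_type_add exp_type_mult_id exp_type_mono[OF E]
        exp_type_deriv[OF holomorphic_euler_int _ _ E]) auto
  then show ?thesis
    by (simp add: gamma_shift_def[abs_def])
qed

lemma gamma_shift_sums:
  assumes pq: "p > 0" "q > 0" "p + q > 1" and hol: "f holomorphic_on Bset r" and "\<epsilon> \<le> r"
    and sums: "\<And>\<xi>. norm \<xi> < \<epsilon> \<Longrightarrow> (\<lambda>j. c j * \<xi> ^ j) sums f \<xi>"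
    and \<xi>: "norm \<xi> < \<epsilon>"
  shows "(\<lambda>j. of_real (Gamma (real j + p) / Gamma (real j + (p + q - 1))) * c j * \<xi> ^ j) sums gamma_shift p q f \<xi>"
proof -
  define e where "e j = of_real (Beta (p + real j) q) * c j" for j
  have E: "(\<lambda>j. e j * z ^ j) sums euler_int p q f z" if "norm z < \<epsilon>" for z
    unfolding e_def using euler_int_sums[OF pq(1,2) sums that] .
  have "\<xi> \<in> Bset r" using \<xi> \<open>\<epsilon> \<le> r\<close> by (intro in_Bset_of_norm_less) auto
  then have "(euler_int p q f has_field_derivative deriv (euler_int p q f) \<xi>) (at \<xi>)"
    using holomorphic_euler_int[OF pq(1,2) hol] open_Bset by (intro holomorphic_derivI) auto
  then have "(\<lambda>j. diffs e j * \<xi> ^ j) sums deriv (euler_int p q f) \<xi>"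
    by (intro termdiffs_sums_strong[where f = "euler_int p q f" and K = \<epsilon>]) (use E \<xi> in auto)
  then have "(\<lambda>j. \<xi> * (diffs e j * \<xi> ^ j)) sums (\<xi> * deriv (euler_int p q f) \<xi>)"
    by (rule sums_mult)
  then have "(\<lambda>j. of_nat (Suc j) * e (Suc j) * \<xi> ^ Suc j) sums (\<xi> * deriv (euler_int p q f) \<xi>)"
    by (simp add: diffs_def mult_ac)
  \<comment> \<open>Reindexing is free because the term j = 0 vanishes.\<close>
  then have "(\<lambda>j. of_nat j * e j * \<xi> ^ j) sums (\<xi> * deriv (euler_int p q f) \<xi>)"
    using sums_Suc_iff[of "\<lambda>j. of_nat j * e j * \<xi> ^ j"] by simp
  from sums_divide[OF sums_add[OF sums_mult[OF E[OF \<xi>], of "of_real (p + q - 1)"] this], of "of_real (Gamma q)"]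
  have "(\<lambda>j. (of_real (p + q - 1) * (e j * \<xi> ^ j) + of_nat j * e j * \<xi> ^ j) / of_real (Gamma q)) sums gamma_shift p q f \<xi>"
    by (simp add: gamma_shift_def)
  moreover have "(of_real (p + q - 1) * (e j * \<xi> ^ j) + of_nat j * e j * \<xi> ^ j) / of_real (Gamma q)
      = of_real (Gamma (real j + p) / Gamma (real j + (p + q - 1))) * c j * \<xi> ^ j" for j
  proof -
    \<comment> \<open>The first-order operator multiplies the j-th coefficient by \<sigma>, and
      \<open>Gamma (p + j + q) = \<sigma> * Gamma \<sigma>\<close>. The hypothesis p + q > 1 keeps
      \<sigma> positive at j = 0.\<close>
    define \<sigma> where "\<sigma> = real j + (p + q - 1)"
    have \<sigma>: "\<sigma> > 0" using pq by (simp add: \<sigma>_def)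
    have g: "Gamma q > 0" "Gamma \<sigma> > 0" using pq \<sigma> by (auto intro: Gamma_real_pos)
    have "Gamma (p + real j + q) = \<sigma> * Gamma \<sigma>"
      using Gamma_plus1[of \<sigma>] \<sigma> by (auto simp: \<sigma>_def algebra_simps nonpos_Ints_def)
    then have B: "\<sigma> * Beta (p + real j) q / Gamma q = Gamma (real j + p) / Gamma \<sigma>"
      using g \<sigma> by (simp add: Beta_def add.commute)
    have "(of_real (p + q - 1) * (e j * \<xi> ^ j) + of_nat j * e j * \<xi> ^ j) / of_real (Gamma q)
        = of_real (\<sigma> * Beta (p + real j) q / Gamma q) * c j * \<xi> ^ j"
      using g by (simp add: e_def \<sigma>_def field_simps)
    then show ?thesis unfolding B by (simp add: \<sigma>_def)
  qed
  ultimately show ?thesis by simp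
qed

lemma higher_deriv_power_series_at_0:
  fixes f :: "complex \<Rightarrow> complex"
  assumes "\<epsilon> > 0" "\<And>z. norm z < \<epsilon> \<Longrightarrow> (\<lambda>n. c n * z ^ n) sums f z"
  shows "(deriv ^^ n) f 0 = fact n * c n"
  using assms(2)
proof (induction n arbitrary: c f)
  case 0
  have "(\<lambda>n. c n * 0 ^ n) sums f 0" by (rule 0) (use assms(1) in simp)
  then have "f 0 = c 0" by (rule sums_unique2[OF _ powser_sums_zero])
  then show ?case by simp
next
  case (Suc n)
  have hol: "f holomorphic_on ball 0 \<epsilon>"
    by (rule power_series_holomorphic[where a = c]) (use Suc.prems in auto)
  have "(\<lambda>n. diffs c n * z ^ n) sums deriv f z" if "norm z < \<epsilon>" for z
  proof (rule termdiffs_sums_strong[where f = f and K = \<epsilon>])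
    show "(f has_field_derivative deriv f z) (at z)"
      using hol that by (intro holomorphic_derivI[of _ "ball 0 \<epsilon>"]) auto
  qed (use Suc.prems that in auto)
  from Suc.IH[OF this] have "(deriv ^^ n) (deriv f) 0 = fact n * diffs c n" by simp
  then show ?case
    by (simp add: funpow_Suc_right diffs_def algebra_simps del: funpow.simps)
qed

section \<open>Laplace transforms of Borel transforms\<close>

text \<open>For real \<open>w\<close> this is the Gamma integral after scaling. Both sides are
  holomorphic on Re w > 0, so the identity theorem gives the rest, with the principal branch of the
  power.\<close>

lemma laplace_powr:
  assumes \<alpha>: "\<alpha> > 0" and w: "Re w > 0"
  shows "laplace (\<lambda>t. of_real (t powr (\<alpha> - 1))) w = of_real (Gamma \<alpha>) * w powr (- of_real \<alpha>)"
proof -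
  let ?h = "\<lambda>t. complex_of_real (t powr (\<alpha> - 1))"
  have cont: "continuous_on {0<..} ?h"
    by (intro continuous_intros) auto
  have real: "laplace ?h (of_real x) = of_real (Gamma \<alpha>) * of_real x powr (- of_real \<alpha>)" if x: "x > 0" for x
  proof -
    let ?f = "\<lambda>t::real. indicator {0<..} t *\<^sub>R (t powr (\<alpha> - 1) * exp (- (1 * t)))"
    have I: "set_integrable lborel {0<..} (\<lambda>t. t powr (\<alpha> - 1) * exp (- (1 * t)))"
      using \<alpha> by (intro set_integrable_powr_exp) auto
    have "((\<lambda>t. t powr (\<alpha> - 1) / exp t) has_integral Gamma \<alpha>) {0<..}"
      using Gamma_integral_real[OF \<alpha>]
      by (subst (asm) has_integral_spike_set_eq[where T = "{0<..}"]) (auto intro: negligible_subset[of "{0}"])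
    then have "((\<lambda>t. t powr (\<alpha> - 1) * exp (- (1 * t))) has_integral Gamma \<alpha>) {0<..}"
      by (simp add: exp_minus divide_inverse)
    from integral_unique[OF this] have "Gamma \<alpha> = (\<integral>t. ?f t \<partial>lborel)"
      using set_borel_integral_eq_integral(2)[OF I] by (simp add: set_lebesgue_integral_def)
    also have "\<dots> = x * (\<integral>t. ?f (0 + x * t) \<partial>lborel)"
      using lborel_integral_real_affine[of x ?f 0] x by simp
    also have "(\<integral>t. ?f (0 + x * t) \<partial>lborel) = (\<integral>t. x powr (\<alpha> - 1) * (indicator {0<..} t *\<^sub>R (t powr (\<alpha> - 1) * exp (- (x * t)))) \<partial>lborel)"
      using x by (intro Bochner_Integration.integral_cong) (auto simp: indicator_def powr_mult zero_less_mult_iff)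
    also have "\<dots> = x powr (\<alpha> - 1) * (LINT t:{0<..}|lborel. t powr (\<alpha> - 1) * exp (- (x * t)))"
      by (simp only: integral_mult_right_zero set_lebesgue_integral_def)
    finally have "Gamma \<alpha> = x powr \<alpha> * (LINT t:{0<..}|lborel. t powr (\<alpha> - 1) * exp (- (x * t)))"
      using x powr_mult_base[of x "\<alpha> - 1"] by simp
    then have e: "(LINT t:{0<..}|lborel. t powr (\<alpha> - 1) * exp (- (x * t))) = Gamma \<alpha> * x powr (- \<alpha>)"
      using x by (simp add: powr_minus field_simps)
    have "laplace ?h (of_real x) = (LINT t:{0<..}|lborel. complex_of_real (t powr (\<alpha> - 1) * exp (- (x * t))))"
      unfolding laplace_def by (simp only: of_real_mult exp_of_real[symmetric] of_real_minus)
    also have "\<dots> = of_real (Gamma \<alpha> * x powr (- \<alpha>))"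
      unfolding set_integral_complex_of_real e ..
    finally show ?thesis
      using x powr_of_real[of x "- \<alpha>"] by simp
  qed
  have "laplace ?h w - of_real (Gamma \<alpha>) * w powr (- of_real \<alpha>) = 0"
  proof (rule analytic_continuation[where f = "\<lambda>w. laplace ?h w - of_real (Gamma \<alpha>) * w powr (- of_real \<alpha>)"
        and S = "{w. Re w > 0}" and U = "of_real ` {0<..<2::real}" and \<xi> = "of_real 1"])
    have "laplace ?h holomorphic_on {w. Re w > 0}"
      using \<alpha> cont by (intro holomorphic_laplace[where M = 1 and \<alpha> = \<alpha>]) auto
    then show "(\<lambda>w. laplace ?h w - of_real (Gamma \<alpha>) * w powr (- of_real \<alpha>)) holomorphic_on {w. Re w > 0}"
      by (intro holomorphic_intros) (auto simp: complex_nonpos_Reals_iff)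
    show "connected {w. Re w > 0}"
      by (intro convex_connected convex_halfspace_Re_gt)
    show "complex_of_real 1 islimpt of_real ` {0<..<2::real}"
      by (intro islimpt_of_real_Ioo) auto
  qed (use real w in \<open>auto simp: open_halfspace_Re_gt\<close>)
  then show ?thesis by simp
qed

text \<open>In the application both functions vanish on the negative half-line, so the inner
  integral is the convolution over [0, t]. The proof is Fubini and translation invariance.\<close>

lemma integral_convolution:
  fixes f k :: "real \<Rightarrow> complex"
  assumes f: "integrable lborel f" and k: "integrable lborel k"
  shows "(\<integral>t. \<integral>\<tau>. f \<tau> * k (t - \<tau>) \<partial>lborel \<partial>lborel) = (\<integral>\<tau>. f \<tau> \<partial>lborel) * (\<integral>t. k t \<partial>lborel)"
    and "integrable lborel (\<lambda>t. \<integral>\<tau>. f \<tau> * k (t - \<tau>) \<partial>lborel)"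
proof -
  have [measurable]: "f \<in> borel_measurable borel" "k \<in> borel_measurable borel"
    using borel_measurable_integrable[OF f] borel_measurable_integrable[OF k] by auto
  have kt: "integrable lborel (\<lambda>t. k (t - \<tau>))" for \<tau>
    using lborel_integrable_real_affine[OF k, of 1 "- \<tau>"] by simp
  have ke: "(\<integral>t. k (t - \<tau>) \<partial>lborel) = (\<integral>t. k t \<partial>lborel)" for \<tau>
    using lborel_integral_real_affine[of 1 k "- \<tau>"] by simp
  have kn: "(\<integral>t. norm (k (t - \<tau>)) \<partial>lborel) = (\<integral>t. norm (k t) \<partial>lborel)" for \<tau>
    using lborel_integral_real_affine[of 1 "\<lambda>t. norm (k t)" "- \<tau>"] by simp
  have I: "integrable (lborel \<Otimes>\<^sub>M lborel) (\<lambda>(\<tau>, t). f \<tau> * k (t - \<tau>))"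
  proof (rule lborel_pair.Fubini_integrable)
    have "integrable lborel (\<lambda>\<tau>. norm (f \<tau>) * (\<integral>t. norm (k t) \<partial>lborel))"
      using f by (intro integrable_mult_left) auto
    then show "integrable lborel (\<lambda>\<tau>. \<integral>t. norm (case (\<tau>, t) of (\<tau>, t) \<Rightarrow> f \<tau> * k (t - \<tau>)) \<partial>lborel)"
      by (simp add: norm_mult kn)
    show "AE \<tau> in lborel. integrable lborel (\<lambda>t. case (\<tau>, t) of (\<tau>, t) \<Rightarrow> f \<tau> * k (t - \<tau>))"
      using kt by (intro AE_I2) auto
  qed measurable
  show "integrable lborel (\<lambda>t. \<integral>\<tau>. f \<tau> * k (t - \<tau>) \<partial>lborel)"
    using lborel_pair.integrable_snd[OF I] .
  have "(\<integral>t. \<integral>\<tau>. f \<tau> * k (t - \<tau>) \<partial>lborel \<partial>lborel) = (\<integral>\<tau>. \<integral>t. f \<tau> * k (t - \<tau>) \<partial>lborel \<partial>lborel)"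
    using lborel_pair.Fubini_integral[OF I] .
  also have "\<dots> = (\<integral>\<tau>. f \<tau> * (\<integral>t. k t \<partial>lborel) \<partial>lborel)"
    by (simp add: ke)
  finally show "(\<integral>t. \<integral>\<tau>. f \<tau> * k (t - \<tau>) \<partial>lborel \<partial>lborel) = (\<integral>\<tau>. f \<tau> \<partial>lborel) * (\<integral>t. k t \<partial>lborel)"
    by simp
qed

lemma continuous_on_of_real_Bset:
  assumes "G holomorphic_on Bset r" "r > 0"
  shows "continuous_on {0..} (\<lambda>t. G (complex_of_real t))"
  using assms
  by (intro continuous_on_compose2[OF holomorphic_on_imp_continuous_on[OF assms(1)]] continuous_intros)
     (auto intro: of_real_in_Bset)

lemma exp_type_of_real:
  assumes "exp_type r B G" "r > 0" "b > B"
  obtains M where "M \<ge> 0" "\<And>t. t \<ge> 0 \<Longrightarrow> norm (G (of_real t)) \<le> M * exp (b * t)"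
proof -
  obtain M where M: "M \<ge> 0" "\<And>\<xi>. \<xi> \<in> Bset r \<Longrightarrow> norm (G \<xi>) \<le> M * exp (b * norm \<xi>)"
    using assms(1,3) by (rule exp_typeD) blast
  have "norm (G (of_real t)) \<le> M * exp (b * t)" if "t \<ge> 0" for t
    using M(2)[OF of_real_in_Bset[OF assms(2) that]] that by simp
  with M(1) that show ?thesis by blast
qed

lemma set_integrable_laplace_exp_type:
  assumes "G holomorphic_on Bset r" "exp_type r B G" "r > 0" "Re w > B" "\<alpha> > 0"
  shows "set_integrable lborel {0<..} (\<lambda>t. (of_real (t powr (\<alpha> - 1)) * G (of_real t)) * exp (- (w * of_real t)))"
proof -
  obtain b where b: "B < b" "b < Re w" using assms dense by blast
  obtain M where M: "M \<ge> 0" "\<And>t. t \<ge> 0 \<Longrightarrow> norm (G (of_real t)) \<le> M * exp (b * t)"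
    using exp_type_of_real[OF assms(2,3) b(1)] by blast
  show ?thesis
  proof (rule set_integrable_laplace[OF assms(5) b(2)])
    show "continuous_on {0<..} (\<lambda>t. complex_of_real (t powr (\<alpha> - 1)) * G (of_real t))"
      by (intro continuous_intros continuous_on_subset[OF continuous_on_of_real_Bset[OF assms(1,3)]]) auto
    show "norm (complex_of_real (t powr (\<alpha> - 1)) * G (of_real t)) \<le> M * (t powr (\<alpha> - 1) * exp (b * t))" if "t > 0" for t
      using mult_left_mono[OF M(2)[of t], of "t powr (\<alpha> - 1)"] that by (simp add: norm_mult mult_ac)
  qed
qed

text \<open>\<open>t\<^sup>\<alpha> E(t)\<close> is the convolution of \<open>G\<close> with \<open>t\<^bsup>\<alpha> - 1\<^esup>\<close>.\<close>

lemma laplace_powr_euler_int: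
  assumes hol: "G holomorphic_on Bset r" and ty: "exp_type r B G" and r: "r > 0"
    and B: "B \<ge> 0" and w: "Re w > B" and \<alpha>: "\<alpha> > 0"
  shows "laplace (\<lambda>t. of_real (t powr \<alpha>) * euler_int 1 \<alpha> G (of_real t)) w
    = laplace (\<lambda>t. G (of_real t)) w * (of_real (Gamma \<alpha>) * w powr (- of_real \<alpha>))"
proof -
  define f where "f \<tau> = indicator {0<..} \<tau> *\<^sub>R (G (of_real \<tau>) * exp (- (w * of_real \<tau>)))" for \<tau> :: real
  define k where "k v = indicator {0<..} v *\<^sub>R (of_real (v powr (\<alpha> - 1)) * exp (- (w * of_real v)))" for v :: real
  have "set_integrable lborel {0<..} (\<lambda>t. G (of_real t) * exp (- (w * of_real t)))"
    using set_integrable_laplace_exp_type[OF hol ty r w, of 1]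
    by (rule set_integrable_cong[THEN iffD1, rotated -1]) auto
  then have f: "integrable lborel f"
    by (simp add: f_def[abs_def] set_integrable_def)
  have "set_integrable lborel {0<..} (\<lambda>t. of_real (t powr (\<alpha> - 1)) * exp (- (w * of_real t)))"
    using \<alpha> w B by (intro set_integrable_laplace[where M = 1 and b = 0]) (auto intro!: continuous_intros)
  then have k: "integrable lborel k"
    by (simp add: k_def[abs_def] set_integrable_def)
  have kint: "(\<integral>v. k v \<partial>lborel) = of_real (Gamma \<alpha>) * w powr (- of_real \<alpha>)"
    using laplace_powr[OF \<alpha>, of w] w B by (simp add: k_def laplace_def set_lebesgue_integral_def)
  have fint: "(\<integral>\<tau>. f \<tau> \<partial>lborel) = laplace (\<lambda>t. G (of_real t)) w"
    by (simp add: f_def laplace_def set_lebesgue_integral_def)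
  have conv: "(\<integral>\<tau>. f \<tau> * k (t - \<tau>) \<partial>lborel)
      = indicator {0<..} t *\<^sub>R ((of_real (t powr \<alpha>) * euler_int 1 \<alpha> G (of_real t)) * exp (- (w * of_real t)))" for t
  proof (cases "t > 0")
    case t: True
    \<comment> \<open>With \<tau> = t s the indicators in \<open>f\<close> and \<open>k\<close>
      confine s to (0, 1), and the two exponentials combine to exp (- w t).\<close>
    have "(\<integral>\<tau>. f \<tau> * k (t - \<tau>) \<partial>lborel) = t *\<^sub>R (\<integral>s. f (0 + t * s) * k (t - (0 + t * s)) \<partial>lborel)"
      using lborel_integral_real_affine[of t "\<lambda>\<tau>. f \<tau> * k (t - \<tau>)" 0] t by simp
    also have "(\<lambda>s. f (0 + t * s) * k (t - (0 + t * s)))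
      = (\<lambda>s. (beta_weight 1 \<alpha> s *\<^sub>R G (of_real s * of_real t)) * (of_real (t powr (\<alpha> - 1)) * exp (- (w * of_real t))))"
    proof
      fix s :: real
      show "f (0 + t * s) * k (t - (0 + t * s)) = (beta_weight 1 \<alpha> s *\<^sub>R G (of_real s * of_real t)) * (of_real (t powr (\<alpha> - 1)) * exp (- (w * of_real t)))"
      proof (cases "0 < s \<and> s < 1")
        case True
        then have p: "t * s > 0" "t - t * s > 0" using t by auto
        have "(t - t * s) powr (\<alpha> - 1) = t powr (\<alpha> - 1) * (1 - s) powr (\<alpha> - 1)"
          using True t by (simp flip: powr_mult add: right_diff_distrib)
        moreover have "exp (- (w * of_real (t * s))) * exp (- (w * of_real (t - t * s))) = exp (- (w * of_real t))"
          by (simp add: algebra_simps flip: exp_add)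
        ultimately show ?thesis
          using True p by (simp add: f_def k_def beta_weight_def scaleR_conv_of_real mult_ac)
      next
        \<comment> \<open>At s = 0 and s = 1 the weight vanishes because
          \<open>0 powr x = 0\<close>, in agreement with the open indicators in \<open>f\<close> and
          \<open>k\<close>.\<close>
        case False
        then have "s \<le> 0 \<or> s \<ge> 1" by auto
        then show ?thesis
        proof
          assume "s \<le> 0"
          then have "\<not> t * s > 0" using t by (simp add: zero_less_mult_iff)
          with \<open>s \<le> 0\<close> show ?thesis by (cases "s = 0") (auto simp: f_def beta_weight_def)
        next
          assume "s \<ge> 1"
          then have "\<not> t - t * s > 0" using t by simp
          with \<open>s \<ge> 1\<close> show ?thesis by (cases "s = 1") (auto simp: k_def beta_weight_def)
        qed
      qed
    qed
    also have "t *\<^sub>R (\<integral>s. (beta_weight 1 \<alpha> s *\<^sub>R G (of_real s * of_real t)) * (of_real (t powr (\<alpha> - 1)) * exp (- (w * of_real t))) \<partial>lborel)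
      = of_real (t * t powr (\<alpha> - 1)) * euler_int 1 \<alpha> G (of_real t) * exp (- (w * of_real t))"
      by (simp only: integral_mult_left_zero euler_int_def) (simp add: scaleR_conv_of_real)
    also have "t * t powr (\<alpha> - 1) = t powr \<alpha>"
      using t powr_mult_base[of t "\<alpha> - 1"] by simp
    finally show ?thesis using t by simp
  next
    case False
    then have "f \<tau> * k (t - \<tau>) = 0" for \<tau>
      by (cases "\<tau> > 0") (auto simp: f_def k_def)
    then have "(\<integral>\<tau>. f \<tau> * k (t - \<tau>) \<partial>lborel) = (\<integral>\<tau>. 0 \<partial>(lborel :: real measure))"
      by (simp only:)
    with False show ?thesis by simp
  qed
  have "laplace (\<lambda>t. of_real (t powr \<alpha>) * euler_int 1 \<alpha> G (of_real t)) w = (\<integral>t. \<integral>\<tau>. f \<tau> * k (t - \<tau>) \<partial>lborel \<partial>lborel)"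
    unfolding conv laplace_def set_lebesgue_integral_def ..
  also have "\<dots> = laplace (\<lambda>t. G (of_real t)) w * (of_real (Gamma \<alpha>) * w powr (- of_real \<alpha>))"
    unfolding integral_convolution(1)[OF f k] kint fint ..
  finally show ?thesis .
qed

text \<open>For p = 1 the operator in \<open>gamma_shift\<close> is \<alpha> + t d/dt, and
  t^(\<alpha> - 1) (\<alpha> E + t E') is the derivative of t^\<alpha> E. Integration by parts with
  vanishing boundary terms yields w times the transform of t^\<alpha> E, which the convolution
  theorem turns into a product.\<close>

lemma laplace_powr_gamma_shift:
  assumes hol: "G holomorphic_on Bset r" and ty: "exp_type r B G" and r: "r > 0"
    and B: "B \<ge> 0" and w: "Re w > B" and \<alpha>: "\<alpha> > 0"
  shows "set_integrable lborel {0<..} (\<lambda>t. (of_real (t powr (\<alpha> - 1)) * gamma_shift 1 \<alpha> G (of_real t)) * exp (- (w * of_real t)))"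
    and "laplace (\<lambda>t. of_real (t powr (\<alpha> - 1)) * gamma_shift 1 \<alpha> G (of_real t)) w
      = w powr (1 - of_real \<alpha>) * laplace (\<lambda>t. G (of_real t)) w"
proof -
  let ?E = "euler_int 1 \<alpha> G" and ?\<psi> = "gamma_shift 1 \<alpha> G"
  let ?e = "\<lambda>t. exp (- (w * complex_of_real t))"
  have holE: "?E holomorphic_on Bset r" using \<alpha> hol by (intro holomorphic_euler_int) auto
  have tyE: "exp_type r B ?E" using \<alpha> B ty by (intro exp_type_euler_int) auto
  have hol\<psi>: "?\<psi> holomorphic_on Bset r" using \<alpha> hol by (intro holomorphic_gamma_shift) auto
  have ty\<psi>: "exp_type (r / 2) B ?\<psi>" using \<alpha> hol B ty r by (intro exp_type_gamma_shift[where r = r]) auto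
  have hol\<psi>2: "?\<psi> holomorphic_on Bset (r / 2)"
    using hol\<psi> r by (rule_tac holomorphic_on_subset[OF _ Bset_mono]) auto
  show I\<psi>: "set_integrable lborel {0<..} (\<lambda>t. (of_real (t powr (\<alpha> - 1)) * ?\<psi> (of_real t)) * ?e t)"
    using set_integrable_laplace_exp_type[OF hol\<psi>2 ty\<psi> _ w \<alpha>] r by simp
  have IE: "set_integrable lborel {0<..} (\<lambda>t. (of_real (t powr \<alpha>) * ?E (of_real t)) * ?e t)"
    using set_integrable_laplace_exp_type[OF holE tyE r w, of "\<alpha> + 1"] \<alpha> by simp
  define g where "g = complex_of_real (Gamma \<alpha>)"
  have g0: "g \<noteq> 0" using Gamma_real_pos[OF \<alpha>] by (simp add: g_def)
  let ?F = "\<lambda>t. of_real (t powr \<alpha>) * ?E (of_real t) * ?e t"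
  let ?F' = "\<lambda>t. g * ((of_real (t powr (\<alpha> - 1)) * ?\<psi> (of_real t)) * ?e t) - w * ((of_real (t powr \<alpha>) * ?E (of_real t)) * ?e t)"
  obtain b where b: "B < b" "b < Re w" using w dense by blast
  obtain M where M: "M \<ge> 0" "\<And>t. t \<ge> 0 \<Longrightarrow> norm (?E (of_real t)) \<le> M * exp (b * t)"
    using exp_type_of_real[OF tyE r b(1)] by blast
  have Fb: "norm (?F t) \<le> M * (t powr \<alpha> * exp (- ((Re w - b) * t)))" if "t > 0" for t
  proof -
    have "norm (?F t) = t powr \<alpha> * norm (?E (of_real t)) * exp (- (Re w * t))"
      by (simp add: norm_mult)
    also have "\<dots> \<le> t powr \<alpha> * (M * exp (b * t)) * exp (- (Re w * t))"
      using M(2)[of t] that by (intro mult_right_mono mult_left_mono) auto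
    also have "\<dots> = M * (t powr \<alpha> * exp (- ((Re w - b) * t)))"
      by (simp add: algebra_simps flip: exp_add)
    finally show ?thesis .
  qed
  have "(LINT t:{0<..}|lborel. ?F' t) = 0 - 0"
  proof (rule set_integral_FTC_half_line[where F = ?F])
    fix t :: real assume t: "t > 0"
    have in_B: "complex_of_real t \<in> Bset r" using of_real_in_Bset[OF r, of t] t by simp
    have "((\<lambda>t. t powr \<alpha>) has_real_derivative \<alpha> * t powr (\<alpha> - 1)) (at t)"
      using t by (auto intro!: derivative_eq_intros)
    then have 1: "((\<lambda>t. complex_of_real (t powr \<alpha>)) has_vector_derivative of_real (\<alpha> * t powr (\<alpha> - 1))) (at t)"
      by (rule has_vector_derivative_of_real)
    have "(?E has_field_derivative deriv ?E (of_real t)) (at (of_real t))"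
      using holE in_B open_Bset by (intro holomorphic_derivI) auto
    then have 2: "((\<lambda>t. ?E (of_real t)) has_vector_derivative deriv ?E (of_real t)) (at t)"
      by (rule has_vector_derivative_real_field)
    have 3: "(?e has_vector_derivative (- w * ?e t)) (at t)"
      by (auto intro!: derivative_eq_intros has_vector_derivative_real_field)
    have g\<psi>: "g * ?\<psi> (of_real t) = of_real \<alpha> * ?E (of_real t) + of_real t * deriv ?E (of_real t)"
      using g0 by (simp add: gamma_shift_def g_def)
    have tp: "complex_of_real (t powr \<alpha>) = of_real (t powr (\<alpha> - 1)) * of_real t"
      using t powr_mult_base[of t "\<alpha> - 1"] by (simp add: mult.commute flip: of_real_mult)
    have "of_real (t powr \<alpha>) * deriv ?E (of_real t) + of_real (\<alpha> * t powr (\<alpha> - 1)) * ?E (of_real t)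
        = of_real (t powr (\<alpha> - 1)) * (g * ?\<psi> (of_real t))"
      unfolding g\<psi> tp by (simp add: algebra_simps)
    then have eq: "of_real (t powr \<alpha>) * ?E (of_real t) * (- w * ?e t)
        + (of_real (t powr \<alpha>) * deriv ?E (of_real t) + of_real (\<alpha> * t powr (\<alpha> - 1)) * ?E (of_real t)) * ?e t = ?F' t"
      by (simp add: algebra_simps)
    show "(?F has_vector_derivative ?F' t) (at t)"
      using has_vector_derivative_mult[OF has_vector_derivative_mult[OF 1 2] 3] unfolding eq .
    have c1: "isCont (\<lambda>t. ?E (complex_of_real t)) t" "isCont (\<lambda>t. ?\<psi> (complex_of_real t)) t"
      using continuous_on_of_real_Bset[OF holE r] continuous_on_of_real_Bset[OF hol\<psi> r] t
      by (auto intro!: continuous_on_interior[where S = "{0..}"])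
    have c2: "isCont (\<lambda>t. complex_of_real (t powr a)) t" for a
      using t by (intro continuous_intros) auto
    show "isCont ?F' t"
      by (intro continuous_intros c1 c2)
  next
    show "set_integrable lborel {0<..} ?F'"
      by (intro set_integral_diff set_integrable_mult_right I\<psi> IE)
    have "((\<lambda>t. M * (t powr \<alpha> * exp (- ((Re w - b) * t)))) \<longlongrightarrow> 0) (at_right 0)"
      using \<alpha> by real_asymp
    then show "(?F \<longlongrightarrow> 0) (at_right 0)"
      by (rule Lim_null_comparison[rotated]) (use Fb in \<open>auto simp: eventually_at_filter\<close>)
    have "((\<lambda>t. M * (t powr \<alpha> * exp (- ((Re w - b) * t)))) \<longlongrightarrow> 0) at_top"
      using \<alpha> b by real_asymp
    then show "(?F \<longlongrightarrow> 0) at_top"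
      by (rule Lim_null_comparison[rotated]) (use Fb in \<open>auto intro: eventually_mono[OF eventually_gt_at_top[of 0]]\<close>)
  qed
  also have "(LINT t:{0<..}|lborel. ?F' t)
      = g * laplace (\<lambda>t. of_real (t powr (\<alpha> - 1)) * ?\<psi> (of_real t)) w - w * laplace (\<lambda>t. of_real (t powr \<alpha>) * ?E (of_real t)) w"
    unfolding laplace_def
    by (simp only: set_integral_diff(2)[OF set_integrable_mult_right[OF I\<psi>] set_integrable_mult_right[OF IE]]
          set_integral_mult_right)
  finally have "g * laplace (\<lambda>t. of_real (t powr (\<alpha> - 1)) * ?\<psi> (of_real t)) w
      = w * (laplace (\<lambda>t. G (of_real t)) w * (g * w powr (- of_real \<alpha>)))"
    using laplace_powr_euler_int[OF hol ty r B w \<alpha>] by (simp add: g_def)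
  also have "\<dots> = g * ((w * w powr (- of_real \<alpha>)) * laplace (\<lambda>t. G (of_real t)) w)"
    by simp
  also have "w * w powr (- of_real \<alpha>) = w powr (1 - of_real \<alpha>)"
    using w B powr_add[of w 1 "- of_real \<alpha>"] by auto
  finally show "laplace (\<lambda>t. of_real (t powr (\<alpha> - 1)) * ?\<psi> (of_real t)) w = w powr (1 - of_real \<alpha>) * laplace (\<lambda>t. G (of_real t)) w"
    using g0 by simp
qed

text \<open>Integrating by parts n times leaves the transform of the n-th derivative, divided by
  w^n. Cauchy's inequality on discs of radius \<open>d\<close> gives n! / d^n, together with exp (b
  d) because the modulus grows by at most \<open>d\<close> on such a disc; this is the origin of the
  factor e^(B r) in \<open>Ras\<close>.\<close>

lemma laplace_asymptotic_expansion:
  assumes hol: "G holomorphic_on Bset r" and d: "0 < d" "d < r" and b: "b \<ge> 0" and M: "M \<ge> 0"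
    and bd: "\<And>\<xi>. \<xi> \<in> Bset r \<Longrightarrow> norm (G \<xi>) \<le> M * exp (b * norm \<xi>)"
    and w: "Re w > b"
  shows "norm (laplace (\<lambda>t. G (of_real t)) w - (\<Sum>j=1..n. (deriv ^^ (j - 1)) G 0 / w ^ j))
    \<le> M * exp (b * d) * fact n / d ^ n / (norm w ^ n * (Re w - b))"
proof -
  have w0: "w \<noteq> 0" using w b by auto
  define h where "h n t = (deriv ^^ n) G (complex_of_real t)" for n and t :: real
  have r0: "r > 0" using d by linarith
  have hold: "(deriv ^^ n) G holomorphic_on Bset r" for n
    using hol open_Bset by (intro holomorphic_higher_deriv)
  have hb: "norm (h n t) \<le> (fact n * (M * exp (b * d)) / d ^ n) * exp (b * t)" if "t \<ge> 0" for n t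
  proof -
    \<comment> \<open>Any positive radius below r - d would do, since the point lies on the
      half-line itself.\<close>
    have "complex_of_real t \<in> Bset ((r - d) / 2)"
      using d that by (intro of_real_in_Bset) auto
    moreover have "(r - d) / 2 + d < r" using d by (simp add: field_simps)
    ultimately show ?thesis
      using norm_higher_deriv_le_on_Bset[OF hol d(1) _ b M bd, of "(r - d) / 2" "of_real t" n] d that
      by (simp add: h_def distrib_left exp_add mult_ac)
  qed
  have hd: "(h n has_vector_derivative h (Suc n) t) (at t within {0..})" if "t \<ge> 0" for n t
  proof -
    have "((deriv ^^ n) G has_field_derivative deriv ((deriv ^^ n) G) (of_real t)) (at (of_real t))"
      using hold[of n] of_real_in_Bset[OF r0 that] open_Bset by (intro holomorphic_derivI) auto
    then have "((\<lambda>t. (deriv ^^ n) G (of_real t)) has_vector_derivative deriv ((deriv ^^ n) G) (of_real t)) (at t)"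
      by (rule has_vector_derivative_real_field)
    then show ?thesis
      unfolding h_def[abs_def] by (simp add: has_vector_derivative_at_within)
  qed
  have hc: "continuous_on {0..} (h n)" for n
    unfolding h_def[abs_def] by (rule continuous_on_of_real_Bset[OF hold r0])
  have step: "laplace (h n) w = h n 0 / w + laplace (h (Suc n)) w / w" for n
    using laplace_derivative[OF w hd hc hb hb, of n] w0 by (simp add: field_simps)
  have "laplace (h 0) w - (\<Sum>j=1..n. (deriv ^^ (j - 1)) G 0 / w ^ j) = laplace (h n) w / w ^ n"
  proof (induction n)
    case (Suc n)
    have "laplace (h 0) w - (\<Sum>j=1..Suc n. (deriv ^^ (j - 1)) G 0 / w ^ j) = laplace (h n) w / w ^ n - h n 0 / w ^ Suc n"
      using Suc by (simp add: h_def[of n 0])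
    also have "\<dots> = laplace (h (Suc n)) w / w ^ Suc n"
      using w0 by (subst step) (simp add: field_simps)
    finally show ?case .
  qed simp
  moreover have "norm (laplace (h n) w / w ^ n) \<le> (fact n * (M * exp (b * d)) / d ^ n) / (Re w - b) / norm w ^ n"
    unfolding norm_divide norm_power by (intro divide_right_mono norm_laplace_le w hb) auto
  moreover have "h 0 = (\<lambda>t. G (of_real t))"
    by (simp add: h_def fun_eq_iff)
  ultimately show ?thesis
    by (simp add: mult_ac)
qed

section \<open>Splitting the Borel transform into residue classes\<close>

text \<open>Power series coefficients of u^(m - 1) times the Borel transform. The index is shifted
  by one, so the residue class of l among the \<open>a n\<close> is the class l - 1 here.\<close>

definition borel_coeff :: "nat \<Rightarrow> (nat \<Rightarrow> complex) \<Rightarrow> nat \<Rightarrow> complex" where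
  "borel_coeff m a n = a (Suc n) / complex_of_real (Gamma (real (Suc n) / real m))"

lemma borel_germ_eq: "borel_germ m a u = (\<Sum>n. borel_coeff m a n * u ^ n) / u ^ (m - 1)"
  by (simp add: borel_germ_def borel_coeff_def)

lemma borel_coeff_bound:
  assumes "m \<ge> 1" "gevrey1 m a"
  obtains C L where "C \<ge> 0" "L > 0" "\<And>n. norm (borel_coeff m a n) \<le> C * L ^ n"
proof -
  obtain C K where CK: "\<And>n. norm (a n) \<le> C * K ^ n * Gamma (1 + real n / real m)"
    using assms(2) by (auto simp: gevrey1_def)
  \<comment> \<open>The factor x from \<open>Gamma (1 + x) = x * Gamma x\<close> is absorbed by 2^n.
    The absolute value and the summand 1 make \<open>L\<close> positive whatever \<open>K\<close>
    is.\<close>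
  define L where "L = 2 * \<bar>K\<bar> + 1"
  have "norm (borel_coeff m a n) \<le> (\<bar>C\<bar> * \<bar>K\<bar>) * L ^ n" for n
  proof -
    define x where "x = real (Suc n) / real m"
    have x: "x > 0" using assms(1) by (simp add: x_def)
    have G: "Gamma (1 + x) = x * Gamma x"
      using Gamma_plus1[of x] x by (auto simp: add.commute nonpos_Ints_def)
    have Gx: "Gamma x > 0" by (rule Gamma_real_pos[OF x])
    have xle: "x \<le> 2 ^ n"
    proof -
      have "x \<le> real (Suc n) / 1" unfolding x_def using assms(1) by (intro divide_left_mono) auto
      also have "real (Suc n) \<le> 2 ^ n"
      proof -
        have "Suc n \<le> 2 ^ n" by (simp add: Suc_leI)
        then have "real (Suc n) \<le> real (2 ^ n)" by (rule of_nat_mono)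
        then show ?thesis by simp
      qed
      finally show ?thesis by simp
    qed
    have "norm (a (Suc n)) \<le> C * K ^ Suc n * (x * Gamma x)"
      using CK[of "Suc n"] G by (simp add: x_def)
    also have "\<dots> \<le> \<bar>C * K ^ Suc n\<bar> * (x * Gamma x)"
      using x Gx by (intro mult_right_mono) auto
    finally have "norm (a (Suc n)) / Gamma x \<le> \<bar>C * K ^ Suc n\<bar> * x"
      using Gx by (simp add: pos_divide_le_eq mult_ac)
    also have "\<dots> \<le> \<bar>C * K ^ Suc n\<bar> * 2 ^ n"
      using xle by (intro mult_left_mono) auto
    also have "\<dots> = \<bar>C\<bar> * \<bar>K\<bar> * (2 * \<bar>K\<bar>) ^ n"
      by (simp add: abs_mult power_abs power_mult_distrib)
    also have "\<dots> \<le> \<bar>C\<bar> * \<bar>K\<bar> * L ^ n"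
      by (intro mult_left_mono power_mono) (auto simp: L_def)
    finally show ?thesis
      using Gx by (simp add: borel_coeff_def norm_divide x_def)
  qed
  moreover have "L > 0" by (simp add: L_def)
  ultimately show ?thesis using that[of "\<bar>C\<bar> * \<bar>K\<bar>" L] by simp
qed

locale geometric_coeffs =
  fixes m :: nat and d :: "nat \<Rightarrow> complex" and C L :: real
  assumes m: "m \<ge> 1" and C: "C \<ge> 0" and L: "L > 0" and d: "\<And>n. norm (d n) \<le> C * L ^ n"
begin

definition q where "q i \<xi> = (\<Sum>j. d (i + m * j) * \<xi> ^ j)"

lemma q_sums:
  assumes "norm \<xi> < (1 / L) ^ m"
  shows "(\<lambda>j. d (i + m * j) * \<xi> ^ j) sums q i \<xi>"
proof -
  have "L ^ m * norm \<xi> < 1"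
    using assms L by (simp add: power_divide field_simps)
  then have s: "summable (\<lambda>j. C * L ^ i * (L ^ m * norm \<xi>) ^ j)"
    using L by (intro summable_mult summable_geometric) auto
  have "norm (d (i + m * j) * \<xi> ^ j) \<le> C * L ^ i * (L ^ m * norm \<xi>) ^ j" for j
  proof -
    have "norm (d (i + m * j) * \<xi> ^ j) \<le> C * L ^ (i + m * j) * norm \<xi> ^ j"
      unfolding norm_mult norm_power by (intro mult_right_mono d) auto
    also have "\<dots> = C * L ^ i * (L ^ m * norm \<xi>) ^ j"
      by (simp add: power_add power_mult power_mult_distrib)
    finally show ?thesis .
  qed
  with s have "summable (\<lambda>j. d (i + m * j) * \<xi> ^ j)"
    by (rule summable_comparison_test'[where N = 0])
  then show ?thesis unfolding q_def by (rule summable_sums)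
qed

lemma sums_split:
  assumes u: "norm u < 1 / L"
  shows "(\<lambda>n. d n * u ^ n) sums (\<Sum>i<m. u ^ i * q i (u ^ m))"
proof -
  have "L * norm u < 1" using u L by (simp add: field_simps)
  then have s: "summable (\<lambda>n. C * (L * norm u) ^ n)"
    using L by (intro summable_mult summable_geometric) auto
  have "norm (d n * u ^ n) \<le> C * (L * norm u) ^ n" for n
    using mult_right_mono[OF d[of n], of "norm u ^ n"] by (simp add: norm_mult norm_power power_mult_distrib mult_ac)
  with s have sm: "summable (\<lambda>n. d n * u ^ n)"
    by (rule summable_comparison_test'[where N = 0])
  have um: "norm (u ^ m) < (1 / L) ^ m"
    unfolding norm_power using u m by (intro power_strict_mono) auto
  have "(\<lambda>j. sum (\<lambda>n. d n * u ^ n) {j * m..<j * m + m}) sums (\<Sum>n. d n * u ^ n)"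
    using m by (intro sums_group summable_sums sm) auto
  moreover have "sum (\<lambda>n. d n * u ^ n) {j * m..<j * m + m} = (\<Sum>i<m. u ^ i * (d (i + m * j) * (u ^ m) ^ j))" for j
  proof -
    have "sum (\<lambda>n. d n * u ^ n) {j * m..<j * m + m} = (\<Sum>i<m. d (i + m * j) * u ^ (i + m * j))"
      by (rule sum.reindex_bij_witness[where i = "\<lambda>i. i + m * j" and j = "\<lambda>n. n - m * j"]) (auto simp: mult.commute)
    then show ?thesis by (simp add: power_add power_mult mult.left_commute)
  qed
  moreover have "(\<lambda>j. \<Sum>i<m. u ^ i * (d (i + m * j) * (u ^ m) ^ j)) sums (\<Sum>i<m. u ^ i * q i (u ^ m))"
    by (intro sums_sum sums_mult q_sums um)
  ultimately have "(\<Sum>n. d n * u ^ n) = (\<Sum>i<m. u ^ i * q i (u ^ m))"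
    using sums_unique2 by fastforce
  with summable_sums[OF sm] show ?thesis by simp
qed

lemma holomorphic_q: "q i holomorphic_on ball 0 ((1 / L) ^ m)"
  by (rule power_series_holomorphic[where a = "\<lambda>j. d (i + m * j)"]) (use q_sums in auto)

end

section \<open>Separating the residue classes on the m-sheeted neighbourhood\<close>

lemma root_of_unity_filter:
  assumes "m \<ge> 1" "i < m" "j < m"
  shows "(\<Sum>k<m. cis (2 * pi * real k * real j / real m) * cis (- (2 * pi * real k * real i / real m))) = (if i = j then of_nat m else 0)"
proof (cases "i = j")
  case True
  then show ?thesis by (simp add: cis_mult)
next
  case False
  define z where "z = cis (2 * pi * (real j - real i) / real m)"
  have e: "cis (2 * pi * real k * real j / real m) * cis (- (2 * pi * real k * real i / real m)) = z ^ k" for k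
    unfolding z_def Complex.DeMoivre cis_mult by (rule arg_cong[where f = cis]) (use assms in \<open>simp add: field_simps\<close>)
  have "z ^ m = cis (2 * pi * of_int (int j - int i))"
    unfolding z_def Complex.DeMoivre using assms by simp
  then have zm: "z ^ m = 1" by (simp only: cis_multiple_2pi Ints_of_int)
  have "z \<noteq> 1"
  proof
    assume "z = 1"
    then have "cos (2 * pi * (real j - real i) / real m) = 1"
      by (simp add: z_def complex_eq_iff)
    then obtain n :: int where "2 * pi * (real j - real i) / real m = of_int n * 2 * pi"
      using cos_one_2pi_int by blast
    then have "2 * pi * (real j - real i) = 2 * pi * (of_int n * real m)"
      using assms by (simp add: divide_eq_eq mult_ac)
    then have "real j - real i = of_int n * real m"
      by (subst (asm) mult_left_cancel) auto
    then have "real_of_int (int j - int i) = real_of_int (n * int m)" by simp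
    then have "int j - int i = n * int m" by (simp only: of_int_eq_iff)
    then have "int m dvd (int j - int i)" by simp
    moreover have "\<bar>int j - int i\<bar> < int m" using assms by auto
    moreover have "int j - int i \<noteq> 0" using False by simp
    ultimately show False
      using dvd_imp_le_int[of "int j - int i" "int m"] by linarith
  qed
  have "(\<Sum>k<m. z ^ k) = 0"
    using geometric_sum[OF \<open>z \<noteq> 1\<close>, of m] zm by simp
  with False show ?thesis by (simp add: e)
qed

lemma powr_root_power:
  fixes \<xi> :: complex
  assumes "m \<ge> 1" "\<xi> \<noteq> 0"
  shows "(\<xi> powr (1 / of_nat m)) ^ m = \<xi>"
  using assms by (simp add: powr_def flip: exp_of_nat_mult)

lemma norm_root_of_unity_filter_le:
  assumes "m \<ge> 1" "\<And>k. k < m \<Longrightarrow> norm (\<Phi> k) \<le> N"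
  shows "norm ((\<Sum>k<m. cis (\<theta> k) * \<Phi> k) / of_nat m) \<le> N"
proof -
  have "norm (\<Sum>k<m. cis (\<theta> k) * \<Phi> k) \<le> (\<Sum>k<m. N)"
    using assms(2) by (intro sum_norm_le) (auto simp: norm_mult)
  then show ?thesis
    using assms(1) by (simp add: norm_divide field_simps)
qed

text \<open>The twisted average over the m points above \<xi> isolates one residue class up to a
  power of the root. The principal root is holomorphic on Re \<xi> > 0. A point of
  \<open>Bset r'\<close> with Re \<xi> \<le> 0 has 0 as its nearest point, so it lies in the disc
  where the power series defines \<psi>.\<close>

lemma cond1_decomposition:
  assumes m: "m \<ge> 1" and gev: "gevrey1 m a" and r: "r > 0"
    and hol: "F holomorphic_on Dset m r"
    and \<epsilon>: "\<epsilon> > 0" and germ: "\<And>u. u \<noteq> 0 \<Longrightarrow> norm u < \<epsilon> \<Longrightarrow> F u = borel_germ m a u"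
    and A: "A > 0" "B > 0" and bd: "\<And>u. u \<in> Dset m r \<Longrightarrow> norm (F u * u ^ (m - 1)) \<le> A * exp (B * norm u ^ m)"
  shows "\<exists>r'>0. \<exists>\<psi>. \<forall>l\<in>{1..m}. \<psi> l holomorphic_on Bset r' \<and> exp_type r' B (\<psi> l)
    \<and> (\<forall>\<xi>. norm \<xi> < r' \<longrightarrow>
      (\<lambda>j. (a (l + m * j) / of_real (Gamma (real j + real l / real m))) * \<xi> ^ j) sums \<psi> l \<xi>)"
proof -
  obtain C L where CL: "C \<ge> 0" "L > 0" "\<And>n. norm (borel_coeff m a n) \<le> C * L ^ n"
    using borel_coeff_bound[OF m gev] by blast
  interpret geometric_coeffs m "borel_coeff m a" C L
    by unfold_locales (use m CL in auto)
  \<comment> \<open>At most the radius of the germ identity and strictly below 1 / L, where the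
    series is under control; its m-th power is the corresponding radius \<rho> in the
    \<xi>-plane.\<close>
  define e where "e = min \<epsilon> (1 / (2 * L))"
  have e: "e > 0" "e \<le> \<epsilon>" "e < 1 / L"
    using \<epsilon> CL(2) by (auto simp: e_def min_less_iff_disj field_simps)
  define \<rho> where "\<rho> = e ^ m"
  have \<rho>: "\<rho> > 0" "\<rho> < (1 / L) ^ m"
    using e m by (auto simp: \<rho>_def intro!: power_strict_mono)
  define \<Phi> where "\<Phi> u = F u * u ^ (m - 1)" for u
  define rt where "rt \<xi> = \<xi> powr (1 / of_nat m)" for \<xi> :: complex
  define \<eta> where "\<eta> i \<xi> = (\<Sum>k<m. cis (- (2 * pi * real k * real i / real m)) * \<Phi> (cis (2 * pi * real k / real m) * rt \<xi>)) / of_nat m / rt \<xi> ^ i" for i \<xi>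
  have rt_pow: "(cis (2 * pi * real k / real m) * rt \<xi>) ^ m = \<xi>" if "\<xi> \<noteq> 0" for \<xi> k
  proof -
    have "cis (2 * pi * real k / real m) ^ m = cis (2 * pi * of_int (int k))"
      unfolding Complex.DeMoivre using m by simp
    then have "cis (2 * pi * real k / real m) ^ m = 1"
      by (simp only: cis_multiple_2pi Ints_of_int)
    then show ?thesis
      using powr_root_power[OF m that] by (simp add: power_mult_distrib rt_def)
  qed
  have rt0: "rt \<xi> \<noteq> 0" if "\<xi> \<noteq> 0" for \<xi>
    using that by (simp add: rt_def powr_def)
  have nrt: "norm (rt \<xi>) ^ m = norm \<xi>" if "\<xi> \<noteq> 0" for \<xi>
    using powr_root_power[OF m that] by (metis norm_power rt_def)
  have \<Phi>_eq: "\<Phi> u = (\<Sum>i<m. u ^ i * q i (u ^ m))" if "u \<noteq> 0" "norm u < e" for u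
  proof -
    have "\<Phi> u = (\<Sum>n. borel_coeff m a n * u ^ n)"
      using germ[of u] that e by (simp add: \<Phi>_def borel_germ_eq)
    also have "\<dots> = (\<Sum>i<m. u ^ i * q i (u ^ m))"
      using sums_split[of u] that e by (simp add: sums_iff)
    finally show ?thesis .
  qed
  have \<eta>_eq: "\<eta> i \<xi> = q i \<xi>" if \<xi>: "\<xi> \<noteq> 0" "norm \<xi> < \<rho>" and i: "i < m" for \<xi> i
  proof -
    have "norm (rt \<xi>) ^ m < e ^ m" using nrt[OF \<xi>(1)] \<xi>(2) by (simp add: \<rho>_def)
    then have ne: "norm (rt \<xi>) < e" using e by (simp add: power_less_imp_less_base)
    have "\<Phi> (cis (2 * pi * real k / real m) * rt \<xi>) = (\<Sum>j<m. cis (2 * pi * real k * real j / real m) * (rt \<xi> ^ j * q j \<xi>))" for k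
    proof -
      have "\<Phi> (cis (2 * pi * real k / real m) * rt \<xi>)
          = (\<Sum>j<m. (cis (2 * pi * real k / real m) * rt \<xi>) ^ j * q j \<xi>)"
        using \<Phi>_eq[of "cis (2 * pi * real k / real m) * rt \<xi>"] ne rt0[OF \<xi>(1)] rt_pow[OF \<xi>(1)]
        by (simp add: norm_mult)
      also have "\<dots> = (\<Sum>j<m. cis (2 * pi * real k * real j / real m) * (rt \<xi> ^ j * q j \<xi>))"
        by (intro sum.cong refl) (simp add: power_mult_distrib Complex.DeMoivre mult_ac)
      finally show ?thesis .
    qed
    then have "(\<Sum>k<m. cis (- (2 * pi * real k * real i / real m)) * \<Phi> (cis (2 * pi * real k / real m) * rt \<xi>))
        = (\<Sum>k<m. \<Sum>j<m. (cis (2 * pi * real k * real j / real m) * cis (- (2 * pi * real k * real i / real m))) * (rt \<xi> ^ j * q j \<xi>))"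
      by (simp only: sum_distrib_left) (simp add: mult_ac)
    also have "\<dots> = (\<Sum>j<m. \<Sum>k<m. (cis (2 * pi * real k * real j / real m) * cis (- (2 * pi * real k * real i / real m))) * (rt \<xi> ^ j * q j \<xi>))"
      by (rule sum.swap)
    also have "\<dots> = (\<Sum>j<m. (if i = j then of_nat m else 0) * (rt \<xi> ^ j * q j \<xi>))"
      unfolding sum_distrib_right[symmetric] using root_of_unity_filter[OF m i] by (intro sum.cong refl arg_cong2[where f = "(*)"]) auto
    also have "\<dots> = of_nat m * (rt \<xi> ^ i * q i \<xi>)"
      using i by (simp add: if_distrib[where f = "\<lambda>x. x * _"] cong: if_cong)
    finally show ?thesis
      using m rt0[OF \<xi>(1)] by (simp add: \<eta>_def)
  qed
  define \<psi> where "\<psi> l \<xi> = (if norm \<xi> < \<rho> then q (l - 1) \<xi> else \<eta> (l - 1) \<xi>)" for l \<xi>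
  define r' where "r' = min r \<rho>"
  have r': "r' > 0" "r' \<le> r" "r' \<le> \<rho>" using r \<rho> by (auto simp: r'_def)
  have cover: "\<xi> \<in> ball 0 \<rho> \<or> (Re \<xi> > 0 \<and> \<xi> \<in> Bset r)" if "\<xi> \<in> Bset r'" for \<xi>
  proof (cases "Re \<xi> > 0")
    case True
    then show ?thesis using that Bset_mono[OF r'(2)] by auto
  next
    case False
    then have "nearest \<xi> = 0" by (simp add: nearest_def)
    then show ?thesis using that r' by (simp add: mem_Bset_iff_nearest)
  qed
  have in_D: "cis (2 * pi * real k / real m) * rt \<xi> \<in> Dset m r" if "\<xi> \<noteq> 0" "\<xi> \<in> Bset r" for \<xi> k
    using that rt_pow[OF that(1)] rt0[OF that(1)] by (simp add: Dset_def)
  show ?thesis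
  proof (intro exI[of _ r'] exI[of _ \<psi>] conjI ballI allI impI)
    show "r' > 0" by (rule r'(1))
  next
    fix l assume l: "l \<in> {1..m}"
    let ?i = "l - 1"
    have i: "?i < m" using l by auto
    let ?U = "{\<xi>. Re \<xi> > 0} \<inter> Bset r"
    have hol\<eta>: "\<eta> ?i holomorphic_on ?U"
    proof -
      have rth: "rt holomorphic_on ?U"
        unfolding rt_def[abs_def] by (intro holomorphic_intros) (auto simp: complex_nonpos_Reals_iff)
      have hol\<Phi>: "\<Phi> holomorphic_on Dset m r"
        unfolding \<Phi>_def[abs_def] by (intro holomorphic_intros hol)
      have h1: "(\<lambda>\<xi>. \<Phi> (cis (2 * pi * real k / real m) * rt \<xi>)) holomorphic_on ?U" for k
      proof -
        have "(\<Phi> \<circ> (\<lambda>\<xi>. cis (2 * pi * real k / real m) * rt \<xi>)) holomorphic_on ?U"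
        proof (rule holomorphic_on_compose_gen[OF _ hol\<Phi>])
          show "(\<lambda>\<xi>. cis (2 * pi * real k / real m) * rt \<xi>) holomorphic_on ?U"
            by (intro holomorphic_intros rth)
          show "(\<lambda>\<xi>. cis (2 * pi * real k / real m) * rt \<xi>) ` ?U \<subseteq> Dset m r"
          proof (rule image_subsetI)
            fix \<xi> assume "\<xi> \<in> ?U"
            then have "\<xi> \<noteq> 0" "\<xi> \<in> Bset r" by auto
            then show "cis (2 * pi * real k / real m) * rt \<xi> \<in> Dset m r" by (rule in_D)
          qed
        qed
        then show ?thesis by (simp add: o_def)
      qed
      have "rt \<xi> ^ (l - 1) \<noteq> 0" if "\<xi> \<in> ?U" for \<xi>
      proof -
        have "\<xi> \<noteq> 0" using that by auto
        then show ?thesis using rt0[of \<xi>] by simp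
      qed
      moreover have "of_nat m \<noteq> (0 :: complex)" using m by simp
      ultimately show ?thesis
        unfolding \<eta>_def[abs_def] by (intro holomorphic_intros rth h1)
    qed
    have "\<psi> l holomorphic_on ball 0 \<rho> \<union> ?U"
    proof (rule holomorphic_on_Un)
      have "q ?i holomorphic_on ball 0 \<rho>"
        using \<rho> by (intro holomorphic_on_subset[OF holomorphic_q]) auto
      then show "\<psi> l holomorphic_on ball 0 \<rho>"
        by (rule holomorphic_transform) (auto simp: \<psi>_def)
      show "\<psi> l holomorphic_on ?U"
        using hol\<eta>
      proof (rule holomorphic_transform)
        fix \<xi> assume "\<xi> \<in> ?U"
        then have "\<xi> \<noteq> 0" by auto
        then show "\<eta> ?i \<xi> = \<psi> l \<xi>" using \<eta>_eq[OF _ _ i] by (simp add: \<psi>_def)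
      qed
    qed (auto intro: open_Int open_halfspace_Re_gt open_Bset)
    then show "\<psi> l holomorphic_on Bset r'"
      by (rule holomorphic_on_subset) (use cover in blast)
    have "compact (q ?i ` cball 0 \<rho>)"
      using \<rho> by (intro compact_continuous_image continuous_on_subset[OF holomorphic_on_imp_continuous_on[OF holomorphic_q]]) auto
    then obtain N where N: "\<And>\<xi>. norm \<xi> \<le> \<rho> \<Longrightarrow> norm (q ?i \<xi>) \<le> N"
      using compact_imp_bounded by (force simp: bounded_iff)
    have N0: "N \<ge> 0" using order_trans[OF norm_ge_zero N[of 0]] \<rho> by simp
    show "exp_type r' B (\<psi> l)"
      unfolding exp_type_def
    proof (intro allI impI)
      fix b assume b: "b > B"
      have "norm (\<psi> l \<xi>) \<le> (N + A / e ^ ?i) * exp (b * norm \<xi>)" if \<xi>: "\<xi> \<in> Bset r'" for \<xi>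
      proof (cases "norm \<xi> < \<rho>")
        case True
        have "norm (\<psi> l \<xi>) \<le> N * 1" using True N[of \<xi>] by (simp add: \<psi>_def)
        also have "\<dots> \<le> (N + A / e ^ ?i) * exp (b * norm \<xi>)"
          using N0 A b e by (intro mult_mono) auto
        finally show ?thesis .
      next
        case False
        with cover[OF \<xi>] have \<xi>': "\<xi> \<noteq> 0" "\<xi> \<in> Bset r" by auto
        have "norm ((\<Sum>k<m. cis (- (2 * pi * real k * real ?i / real m)) * \<Phi> (cis (2 * pi * real k / real m) * rt \<xi>)) / of_nat m) \<le> A * exp (B * norm \<xi>)"
        proof (rule norm_root_of_unity_filter_le[OF m])
          fix k
          show "norm (\<Phi> (cis (2 * pi * real k / real m) * rt \<xi>)) \<le> A * exp (B * norm \<xi>)"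
            using bd[OF in_D[OF \<xi>', of k]] nrt[OF \<xi>'(1)] by (simp add: \<Phi>_def norm_mult)
        qed
        \<comment> \<open>Outside the disc of radius \<rho> the root has modulus at least
          \<open>e\<close>, so dividing by its power only changes the constant.\<close>
        moreover have "e ^ ?i \<le> norm (rt \<xi>) ^ ?i"
        proof -
          have "e ^ m \<le> norm (rt \<xi>) ^ m" using False nrt[OF \<xi>'(1)] by (simp add: \<rho>_def)
          then have "e \<le> norm (rt \<xi>)" using e m by (simp add: power_mono_iff)
          then show ?thesis using e by (intro power_mono) auto
        qed
        ultimately have "norm (\<eta> ?i \<xi>) \<le> A * exp (B * norm \<xi>) / e ^ ?i"
          unfolding \<eta>_def norm_divide[of _ "rt \<xi> ^ ?i"] norm_power
          using e A by (intro frac_le) auto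
        also have "\<dots> = A / e ^ ?i * exp (B * norm \<xi>)" by simp
        also have "\<dots> \<le> (N + A / e ^ ?i) * exp (b * norm \<xi>)"
          using N0 A b e by (intro mult_mono) (auto intro: mult_right_mono)
        finally show ?thesis using False by (simp add: \<psi>_def)
      qed
      moreover have "N + A / e ^ ?i \<ge> 0" using N0 A e by simp
      ultimately show "\<exists>M\<ge>0. \<forall>\<xi>\<in>Bset r'. norm (\<psi> l \<xi>) \<le> M * exp (b * norm \<xi>)" by blast
    qed
    fix \<xi> :: complex assume \<xi>: "norm \<xi> < r'"
    have "(\<lambda>j. borel_coeff m a (?i + m * j) * \<xi> ^ j) sums \<psi> l \<xi>"
      using q_sums[of \<xi> ?i] \<xi> r' \<rho> by (simp add: \<psi>_def)
    moreover have "borel_coeff m a (?i + m * j) = a (l + m * j) / of_real (Gamma (real j + real l / real m))" for j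
    proof -
      have "Suc (?i + m * j) = l + m * j" using l by auto
      moreover have "real (l + m * j) / real m = real j + real l / real m"
        using m by (simp add: field_simps)
      ultimately show ?thesis by (simp only: borel_coeff_def)
    qed
    ultimately show "(\<lambda>j. (a (l + m * j) / of_real (Gamma (real j + real l / real m))) * \<xi> ^ j) sums \<psi> l \<xi>"
      by simp
  qed
qed

section \<open>The equivalence\<close>

text \<open>With p = l / m and q = 2 - l / m one has p + q - 1 = 1, so the shift replaces Gamma (j +
  l / m) by j! and produces the Borel transform of f_l, to which repeated integration by parts
  applies.\<close>

lemma cond1_imp_cond2:
  assumes m: "m \<ge> 1" and gev: "gevrey1 m a" and c1: "cond1 m a"
  shows "cond2 m a"
proof -
  obtain r F \<epsilon> A B where r: "r > 0" and hol: "F holomorphic_on Dset m r" and \<epsilon>: "\<epsilon> > 0"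
    and germ: "\<And>u. u \<noteq> 0 \<Longrightarrow> norm u < \<epsilon> \<Longrightarrow> F u = borel_germ m a u"
    and AB: "A > 0" "B > 0" and bd: "\<And>u. u \<in> Dset m r \<Longrightarrow> norm (F u * u ^ (m - 1)) \<le> A * exp (B * norm u ^ m)"
    using c1 unfolding cond1_def by blast
  obtain s \<psi> where s: "s > 0" and hol\<psi>: "\<And>l. l \<in> {1..m} \<Longrightarrow> \<psi> l holomorphic_on Bset s"
    and ty\<psi>: "\<And>l. l \<in> {1..m} \<Longrightarrow> exp_type s B (\<psi> l)"
    and sums\<psi>: "\<And>l \<xi>. l \<in> {1..m} \<Longrightarrow> norm \<xi> < s \<Longrightarrow>
      (\<lambda>j. (a (l + m * j) / of_real (Gamma (real j + real l / real m))) * \<xi> ^ j) sums \<psi> l \<xi>"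
    using cond1_decomposition[OF m gev r hol \<epsilon> germ AB bd] by blast
  \<comment> \<open>Any rate above \<open>B\<close> would do. Fixing one gives definite constants,
    at the price of a smaller half-plane in condition (2).\<close>
  define b where "b = B + 1"
  define G where "G l = gamma_shift (real l / real m) (2 - real l / real m) (\<psi> l)" for l
  define t where "t = s / 2"
  have t: "t > 0" "t < s" using s by (auto simp: t_def)
  have pq: "real l / real m > 0" "2 - real l / real m > 0" if "l \<in> {1..m}" for l
    using that by (auto simp: field_simps)
  have holG: "G l holomorphic_on Bset t" if "l \<in> {1..m}" for l
    unfolding G_def using t by (intro holomorphic_on_subset[OF holomorphic_gamma_shift[OF pq[OF that] hol\<psi>[OF that]] Bset_mono]) auto
  have tyG: "exp_type t B (G l)" if "l \<in> {1..m}" for l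
    unfolding G_def using AB t by (intro exp_type_gamma_shift[OF pq[OF that] hol\<psi>[OF that] _ ty\<psi>[OF that]]) auto
  have coeffG: "(deriv ^^ j) (G l) 0 = sub_coeff m a l (Suc j)" if l: "l \<in> {1..m}" for l j
  proof -
    have "(\<lambda>j. (a (l + m * j) / fact j) * \<xi> ^ j) sums G l \<xi>" if \<xi>: "norm \<xi> < s" for \<xi>
    proof -
      have "(\<lambda>j. of_real (Gamma (real j + real l / real m) / Gamma (real j + (real l / real m + (2 - real l / real m) - 1)))
          * (a (l + m * j) / of_real (Gamma (real j + real l / real m))) * \<xi> ^ j) sums G l \<xi>"
        unfolding G_def using sums\<psi>[OF l] \<xi> by (intro gamma_shift_sums[OF pq[OF l] _ hol\<psi>[OF l], where \<epsilon> = s]) auto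
      moreover have "of_real (Gamma (real j + real l / real m) / Gamma (real j + (real l / real m + (2 - real l / real m) - 1)))
          * (a (l + m * j) / of_real (Gamma (real j + real l / real m))) = a (l + m * j) / fact j" for j
      proof -
        have "Gamma (real j + real l / real m) > 0"
          using pq(1)[OF l] by (intro Gamma_real_pos) auto
        moreover have "Gamma (real j + (real l / real m + (2 - real l / real m) - 1)) = fact j"
          using Gamma_fact[of j, where 'a = real] by (simp add: add.commute)
        ultimately show ?thesis by simp
      qed
      ultimately show ?thesis by simp
    qed
    from higher_deriv_power_series_at_0[OF s this, of j] show ?thesis
      by (simp add: sub_coeff_def)
  qed
  have "\<forall>l\<in>{1..m}. \<exists>M\<ge>0. \<forall>\<xi>\<in>Bset t. norm (G l \<xi>) \<le> M * exp (b * norm \<xi>)"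
    using tyG unfolding exp_type_def b_def by auto
  from bchoice[OF this] obtain M where M: "\<And>l. l \<in> {1..m} \<Longrightarrow> M l \<ge> 0"
    "\<And>l \<xi>. l \<in> {1..m} \<Longrightarrow> \<xi> \<in> Bset t \<Longrightarrow> norm (G l \<xi>) \<le> M l * exp (b * norm \<xi>)"
    by blast
  define S where "S l = laplace (\<lambda>x. G l (of_real x))" for l
  define d where "d = t / 2"
  have d: "d > 0" "d < t" using t by (auto simp: d_def)
  have b0: "b > 0" using AB by (simp add: b_def)
  have "cond2_data m a d b (\<lambda>l. M l + 1) S"
    unfolding cond2_data_def
  proof (intro conjI ballI allI impI)
    show "d > 0" "b > 0" by fact+
    show "M l + 1 > 0" if "l \<in> {1..m}" for l using M(1)[OF that] by simp
    show "S l holomorphic_on {w. Re w > b}" if l: "l \<in> {1..m}" for l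
      unfolding S_def
    proof (rule holomorphic_laplace[where \<alpha> = 1 and M = "M l"])
      show "continuous_on {0<..} (\<lambda>x. G l (complex_of_real x))"
        by (rule continuous_on_subset[OF continuous_on_of_real_Bset[OF holG[OF l] t(1)]]) auto
      show "norm (G l (complex_of_real x)) \<le> M l * (x powr (1 - 1) * exp (b * x))" if "x > 0" for x
        using M(2)[OF l of_real_in_Bset[OF t(1), of x]] that by simp
    qed simp
    fix w and n :: nat and l assume w: "Re w > b" and n: "n \<ge> 1" and l: "l \<in> {1..m}"
    have "(\<Sum>j=1..n. sub_coeff m a l j / w ^ j) = (\<Sum>j=1..n. (deriv ^^ (j - 1)) (G l) 0 / w ^ j)"
      by (intro sum.cong refl) (simp add: coeffG[OF l])
    then have "norm (S l w - (\<Sum>j=1..n. sub_coeff m a l j / w ^ j))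
        \<le> M l * exp (b * d) * fact n / d ^ n / (norm w ^ n * (Re w - b))"
      unfolding S_def
      using laplace_asymptotic_expansion[OF holG[OF l] d less_imp_le[OF b0] M(1)[OF l] M(2)[OF l] w] by simp
    also have "\<dots> \<le> (M l + 1) * exp (b * d) * fact n / d ^ n / (norm w ^ n * (Re w - b))"
      using d w by (intro divide_right_mono mult_right_mono) auto
    also have "\<dots> = Ras d (M l + 1) b n w"
      by (simp add: Ras_def)
    finally show "norm (S l w - (\<Sum>j=1..n. sub_coeff m a l j / w ^ j)) \<le> Ras d (M l + 1) b n w" .
  qed
  then show ?thesis unfolding cond2_def by blast
qed

text \<open>Nevanlinna's theorem for one residue class. The radius r / 2 comes from the bound on the
  derivatives; the growth bound lives on a strictly smaller neighbourhood, here r / 4.\<close>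

lemma cond2_borel_transform:
  assumes c2: "cond2_data m a r B A S" and l: "l \<in> {1..m}"
  shows "\<exists>G. G holomorphic_on Bset (r / 2) \<and> exp_type (r / 4) B G
    \<and> (\<forall>\<xi>. norm \<xi> < r / 2 \<longrightarrow> (\<lambda>j. sub_coeff m a l (Suc j) / fact j * \<xi> ^ j) sums G \<xi>)
    \<and> (\<forall>w. Re w > B \<longrightarrow> laplace (\<lambda>x. G (of_real x)) w = S l w)"
proof -
  interpret N: gevrey_half_plane "S l" "sub_coeff m a l" r B "A l * exp (B * r)"
  proof
    fix w n assume "Re w > B" "n \<ge> (1::nat)"
    then have "norm (S l w - (\<Sum>j=1..n. sub_coeff m a l j / w ^ j)) \<le> Ras r (A l) B n w"
      using c2 l unfolding cond2_data_def by blast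
    then show "norm (S l w - (\<Sum>j=1..n. sub_coeff m a l j / w ^ j)) \<le> A l * exp (B * r) * fact n / r ^ n / (norm w ^ n * (Re w - B))"
      by (simp add: Ras_def)
  qed (use c2 l in \<open>auto simp: cond2_data_def\<close>)
  interpret T: taylor_bounded N.g "r / 2" B
  proof
    show "r / 2 > 0" using N.r by simp
    show "B \<ge> 0" using N.B by simp
  qed (use N.g_has_vector_derivative N.g_bound in auto)
  show ?thesis
  proof (intro exI[of _ T.G] conjI allI impI)
    show "T.G holomorphic_on Bset (r / 2)" by (rule T.holomorphic_G)
    show "exp_type (r / 4) B T.G" using N.r by (intro T.exp_type_G) simp
    show "(\<lambda>j. sub_coeff m a l (Suc j) / fact j * \<xi> ^ j) sums T.G \<xi>" if "norm \<xi> < r / 2" for \<xi>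
      using T.G_sums[OF that] by (simp add: N.g_at_0)
    show "laplace (\<lambda>x. T.G (of_real x)) w = S l w" if "Re w > B" for w
    proof -
      have "laplace (\<lambda>x. T.G (of_real x)) w = laplace (N.g 0) w"
        by (intro laplace_cong) (simp add: T.G_of_real)
      also have "\<dots> = S l w" by (rule N.laplace_g[OF that])
      finally show ?thesis .
    qed
  qed
qed

text \<open>On P(B) the number m Arg u stays inside the range of the principal argument, so Ln (u^m)
  = m Ln u. The principal power of the projected point thus agrees with z^((m - l)/m) on the
  covering.\<close>

lemma Pset_powr:
  assumes m: "m \<ge> 1" and u: "u \<in> Pset m B" and l: "l \<in> {1..m}"
  shows "(u ^ m) powr (1 - of_real (real l / real m)) = u ^ (m - l)"
proof -
  have u0: "u \<noteq> 0" and arg: "\<bar>real m * Arg u\<bar> \<le> pi / 2" using u by (auto simp: Pset_def)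
  have "Im (of_nat m * Ln u) = real m * Arg u"
    using u0 by (simp add: Arg_eq_Im_Ln)
  moreover have "- pi < real m * Arg u" "real m * Arg u \<le> pi"
    using arg[unfolded abs_le_iff] pi_gt_zero by linarith+
  ultimately have "- pi < Im (of_nat m * Ln u)" "Im (of_nat m * Ln u) \<le> pi"
    by (simp_all only:)
  then have "Ln (exp (of_nat m * Ln u)) = of_nat m * Ln u"
    by (rule Ln_exp)
  moreover have "exp (of_nat m * Ln u) = u ^ m"
    using u0 by (simp add: exp_of_nat_mult)
  ultimately have "Ln (u ^ m) = of_nat m * Ln u" by simp
  then have "(u ^ m) powr (1 - of_real (real l / real m)) = exp ((1 - of_real (real l / real m)) * (of_nat m * Ln u))"
    using u0 by (simp add: powr_def)
  also have "(1 - of_real (real l / real m)) * (of_nat m * Ln u) = of_nat (m - l) * Ln u"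
    using m l by (simp add: of_nat_diff field_simps)
  also have "exp (of_nat (m - l) * Ln u) = u ^ (m - l)"
    using u0 by (simp add: exp_of_nat_mult)
  finally show ?thesis .
qed

text \<open>On the ray of argument 0 the coordinate is t^(1/m); this turns the prefactor of class l
  into the power under the Laplace integral.\<close>

lemma root_power_quotient:
  assumes m: "m \<ge> 1" and l: "l \<in> {1..m}" and t: "t > 0"
  shows "complex_of_real (root m t) ^ (l - 1) / complex_of_real (root m t) ^ (m - 1) = of_real (t powr (real l / real m - 1))"
proof -
  define y where "y = root m t"
  have y: "y > 0" using m t by (simp add: y_def)
  have yt: "y = t powr (1 / real m)" unfolding y_def using m t by (intro root_powr_inverse) auto
  have pw: "y ^ k = t powr (real k / real m)" for k
    using y by (simp add: powr_realpow[symmetric] yt powr_powr)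
  have "y ^ (l - 1) / y ^ (m - 1) = t powr (real (l - 1) / real m - real (m - 1) / real m)"
    unfolding pw using t by (simp add: powr_diff)
  also have "real (l - 1) / real m - real (m - 1) / real m = real l / real m - 1"
    using m l by (simp add: of_nat_diff field_simps)
  finally show ?thesis
    unfolding y_def[symmetric] of_real_power[symmetric] of_real_divide[symmetric] by (rule arg_cong)
qed

text \<open>The passage of \<open>cond1_imp_cond2\<close> in reverse: p = 1 and q = l / m replace j!
  by Gamma (j + l / m). The classes are reassembled into one function of u, and its Laplace integral
  is evaluated class by class with the original \<open>B\<close>.\<close>

lemma cond2_borel_germ:
  assumes m: "m \<ge> 1" and gev: "gevrey1 m a" and c2: "cond2_data m a r B A S"
  shows "\<exists>s>0. \<exists>F. F holomorphic_on Dset m s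
    \<and> (\<exists>\<epsilon>>0. \<forall>u. u \<noteq> 0 \<and> norm u < \<epsilon> \<longrightarrow> F u = borel_germ m a u)
    \<and> (\<exists>A>0. \<exists>B>0. \<forall>u\<in>Dset m s. norm (F u * u ^ (m - 1)) \<le> A * exp (B * norm u ^ m))
    \<and> (\<forall>u\<in>Pset m B. ((\<lambda>t. F (complex_of_real (root m t)) * exp (- (u ^ m * complex_of_real t)))
        has_integral (\<Sum>l=1..m. u ^ (m - l) * S l (u ^ m))) {0<..})"
proof -
  have r: "r > 0" and B: "B > 0" using c2 by (auto simp: cond2_data_def)
  have "\<forall>l\<in>{1..m}. \<exists>G. G holomorphic_on Bset (r / 2) \<and> exp_type (r / 4) B G
    \<and> (\<forall>\<xi>. norm \<xi> < r / 2 \<longrightarrow> (\<lambda>j. sub_coeff m a l (Suc j) / fact j * \<xi> ^ j) sums G \<xi>)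
    \<and> (\<forall>w. Re w > B \<longrightarrow> laplace (\<lambda>x. G (of_real x)) w = S l w)"
    using cond2_borel_transform[OF c2] by blast
  from bchoice[OF this] obtain G where holG: "\<And>l. l \<in> {1..m} \<Longrightarrow> G l holomorphic_on Bset (r / 2)"
    and tyG: "\<And>l. l \<in> {1..m} \<Longrightarrow> exp_type (r / 4) B (G l)"
    and sumsG: "\<And>l \<xi>. l \<in> {1..m} \<Longrightarrow> norm \<xi> < r / 2 \<Longrightarrow> (\<lambda>j. sub_coeff m a l (Suc j) / fact j * \<xi> ^ j) sums G l \<xi>"
    and lapG: "\<And>l w. l \<in> {1..m} \<Longrightarrow> Re w > B \<Longrightarrow> laplace (\<lambda>x. G l (of_real x)) w = S l w"
    by blast
  have holG4: "G l holomorphic_on Bset (r / 4)" if "l \<in> {1..m}" for l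
    using r by (intro holomorphic_on_subset[OF holG[OF that] Bset_mono]) simp
  define \<alpha> where "\<alpha> l = real l / real m" for l
  have \<alpha>: "\<alpha> l > 0" if "l \<in> {1..m}" for l using that by (simp add: \<alpha>_def)
  define \<psi> where "\<psi> l = gamma_shift 1 (\<alpha> l) (G l)" for l
  have hol\<psi>: "\<psi> l holomorphic_on Bset (r / 4)" if "l \<in> {1..m}" for l
    unfolding \<psi>_def by (rule holomorphic_gamma_shift[OF _ \<alpha>[OF that] holG4[OF that]]) simp
  have ty\<psi>: "exp_type (r / 8) B (\<psi> l)" if "l \<in> {1..m}" for l
    unfolding \<psi>_def using r B \<alpha>[OF that]
    by (intro exp_type_gamma_shift[OF _ _ holG4[OF that] _ tyG[OF that]]) auto
  have sums\<psi>: "(\<lambda>j. borel_coeff m a (l - 1 + m * j) * \<xi> ^ j) sums \<psi> l \<xi>" if l: "l \<in> {1..m}" and \<xi>: "norm \<xi> < r / 4" for l \<xi>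
  proof -
    have "(\<lambda>j. of_real (Gamma (real j + 1) / Gamma (real j + (1 + \<alpha> l - 1))) * (sub_coeff m a l (Suc j) / fact j) * \<xi> ^ j) sums \<psi> l \<xi>"
      unfolding \<psi>_def using sumsG[OF l] \<xi> \<alpha>[OF l] r
      by (intro gamma_shift_sums[OF _ _ _ holG4[OF l], where \<epsilon> = "r / 4"]) auto
    moreover have "of_real (Gamma (real j + 1) / Gamma (real j + (1 + \<alpha> l - 1))) * (sub_coeff m a l (Suc j) / fact j)
        = borel_coeff m a (l - 1 + m * j)" for j
    proof -
      have "Gamma (real j + 1) = fact j"
        using Gamma_fact[of j, where 'a = real] by (simp add: add.commute)
      moreover have "Suc (l - 1 + m * j) = l + m * j" using l by auto
      moreover have "real (l + m * j) / real m = real j + (1 + \<alpha> l - 1)"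
        using m by (simp add: \<alpha>_def field_simps)
      ultimately show ?thesis
        by (simp only: borel_coeff_def sub_coeff_def) simp
    qed
    ultimately show ?thesis by (simp only:)
  qed
  define F where "F u = (\<Sum>l=1..m. u ^ (l - 1) * \<psi> l (u ^ m)) / u ^ (m - 1)" for u
  define s where "s = r / 8"
  have s: "s > 0" "s \<le> r / 4" using r by (auto simp: s_def)
  have inB: "u ^ m \<in> Bset s" if "u \<in> Dset m s" for u using that by (simp add: Dset_def)
  show ?thesis
  proof (rule exI[of _ s], rule conjI[OF s(1)], rule exI[of _ F], intro conjI ballI)
    have "(\<lambda>u. \<psi> l (u ^ m)) holomorphic_on Dset m s" if "l \<in> {1..m}" for l
    proof -
      have "(\<psi> l \<circ> (\<lambda>u. u ^ m)) holomorphic_on Dset m s"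
        using inB Bset_mono[OF s(2)]
        by (intro holomorphic_on_compose_gen[OF _ hol\<psi>[OF that]] holomorphic_intros) auto
      then show ?thesis by (simp add: o_def)
    qed
    then show "F holomorphic_on Dset m s"
      unfolding F_def[abs_def] by (intro holomorphic_intros) (auto simp: Dset_def)
  next
    obtain C L where CL: "C \<ge> 0" "L > 0" "\<And>n. norm (borel_coeff m a n) \<le> C * L ^ n"
      using borel_coeff_bound[OF m gev] by blast
    interpret geometric_coeffs m "borel_coeff m a" C L
      by unfold_locales (use m CL in auto)
    \<comment> \<open>The bound 1 gives |u^m| \<le> |u|, so that |u| < r / 4 also places u^m in the
      disc of the series for \<psi>.\<close>
    define \<epsilon> where "\<epsilon> = min (1 / L) (min 1 (r / 4))"
    have \<epsilon>: "\<epsilon> > 0" "\<epsilon> \<le> 1 / L" "\<epsilon> \<le> 1" "\<epsilon> \<le> r / 4" using CL(2) r by (auto simp: \<epsilon>_def)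
    have "F u = borel_germ m a u" if u: "u \<noteq> 0" "norm u < \<epsilon>" for u
    proof -
      have "norm u ^ m \<le> norm u ^ 1"
        using u \<epsilon> m by (intro power_decreasing) auto
      then have um: "norm (u ^ m) < r / 4" using u \<epsilon> by (simp add: norm_power)
      have um': "norm (u ^ m) < (1 / L) ^ m"
        unfolding norm_power using u \<epsilon> m by (intro power_strict_mono) auto
      have "(\<Sum>n. borel_coeff m a n * u ^ n) = (\<Sum>i<m. u ^ i * q i (u ^ m))"
        using sums_split[of u] u \<epsilon> by (simp add: sums_iff)
      also have "\<dots> = (\<Sum>l=1..m. u ^ (l - 1) * q (l - 1) (u ^ m))"
        by (rule sum.reindex_bij_witness[where i = "\<lambda>l. l - 1" and j = Suc]) auto
      also have "\<dots> = (\<Sum>l=1..m. u ^ (l - 1) * \<psi> l (u ^ m))"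
        using sums_unique2[OF q_sums[OF um'] sums\<psi>[OF _ um]] by (intro sum.cong refl) auto
      finally show ?thesis
        by (simp add: F_def borel_germ_eq)
    qed
    with \<epsilon>(1) show "\<exists>\<epsilon>>0. \<forall>u. u \<noteq> 0 \<and> norm u < \<epsilon> \<longrightarrow> F u = borel_germ m a u" by blast
  next
    have "\<forall>l\<in>{1..m}. \<exists>M\<ge>0. \<forall>\<xi>\<in>Bset s. norm (\<psi> l \<xi>) \<le> M * exp ((B + 1) * norm \<xi>)"
      using ty\<psi> unfolding exp_type_def s_def by auto
    from bchoice[OF this] obtain M where M: "\<And>l. l \<in> {1..m} \<Longrightarrow> M l \<ge> 0"
      "\<And>l \<xi>. l \<in> {1..m} \<Longrightarrow> \<xi> \<in> Bset s \<Longrightarrow> norm (\<psi> l \<xi>) \<le> M l * exp ((B + 1) * norm \<xi>)"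
      by blast
    \<comment> \<open>One unit above \<open>B\<close> comes from choosing a rate in
      \<open>exp_type\<close>, the second absorbs |u|^(l - 1) \<le> exp (|u|^m).\<close>
    have "norm (F u * u ^ (m - 1)) \<le> ((\<Sum>l=1..m. M l) + 1) * exp ((B + 2) * norm u ^ m)" if u: "u \<in> Dset m s" for u
    proof -
      have u0: "u \<noteq> 0" using u by (simp add: Dset_def)
      have "norm (F u * u ^ (m - 1)) = norm (\<Sum>l=1..m. u ^ (l - 1) * \<psi> l (u ^ m))"
        using u0 by (simp add: F_def)
      also have "\<dots> \<le> (\<Sum>l=1..m. M l * exp ((B + 2) * norm u ^ m))"
      proof (rule sum_norm_le)
        fix l assume l: "l \<in> {1..m}"
        have "norm u ^ (l - 1) \<le> exp (norm u ^ m)"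
        proof (cases "norm u \<le> 1")
          case True
          then have "norm u ^ (l - 1) \<le> 1" by (intro power_le_one) auto
          also have "1 \<le> exp (norm u ^ m)" by simp
          finally show ?thesis .
        next
          case False
          then have "norm u ^ (l - 1) \<le> norm u ^ m" using l by (intro power_increasing) auto
          also have "\<dots> \<le> exp (norm u ^ m)" using exp_ge_add_one_self[of "norm u ^ m"] by linarith
          finally show ?thesis .
        qed
        then have "norm (u ^ (l - 1) * \<psi> l (u ^ m)) \<le> exp (norm u ^ m) * (M l * exp ((B + 1) * norm u ^ m))"
          unfolding norm_mult norm_power using M(2)[OF l inB[OF u]] by (intro mult_mono) (auto simp: norm_power)
        also have "\<dots> = M l * (exp (norm u ^ m) * exp ((B + 1) * norm u ^ m))"
          by simp
        also have "exp (norm u ^ m) * exp ((B + 1) * norm u ^ m) = exp ((B + 2) * norm u ^ m)"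
          by (simp add: algebra_simps flip: exp_add)
        finally show "norm (u ^ (l - 1) * \<psi> l (u ^ m)) \<le> M l * exp ((B + 2) * norm u ^ m)" .
      qed
      also have "\<dots> = (\<Sum>l=1..m. M l) * exp ((B + 2) * norm u ^ m)"
        by (simp add: sum_distrib_right)
      also have "\<dots> \<le> ((\<Sum>l=1..m. M l) + 1) * exp ((B + 2) * norm u ^ m)"
        by (intro mult_right_mono) auto
      finally show ?thesis .
    qed
    moreover have "(\<Sum>l=1..m. M l) + 1 > 0"
      using sum_nonneg[of "{1..m}" M] M(1) by force
    moreover have "B + 2 > 0" using B by simp
    ultimately show "\<exists>A>0. \<exists>B>0. \<forall>u\<in>Dset m s. norm (F u * u ^ (m - 1)) \<le> A * exp (B * norm u ^ m)"
      by blast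
  next
    fix u assume u: "u \<in> Pset m B"
    have w: "Re (u ^ m) > B" using u by (simp add: Pset_def)
    have I: "((\<lambda>t. (of_real (t powr (\<alpha> l - 1)) * \<psi> l (of_real t)) * exp (- (u ^ m * of_real t))) has_integral u ^ (m - l) * S l (u ^ m)) {0<..}"
      if l: "l \<in> {1..m}" for l
    proof -
      have i: "set_integrable lborel {0<..} (\<lambda>t. (of_real (t powr (\<alpha> l - 1)) * \<psi> l (of_real t)) * exp (- (u ^ m * of_real t)))"
        and v: "laplace (\<lambda>t. of_real (t powr (\<alpha> l - 1)) * \<psi> l (of_real t)) (u ^ m)
          = (u ^ m) powr (1 - of_real (\<alpha> l)) * laplace (\<lambda>t. G l (of_real t)) (u ^ m)"
        unfolding \<psi>_def using laplace_powr_gamma_shift[OF holG4[OF l] tyG[OF l] _ _ w \<alpha>[OF l]] r B by auto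
      have "laplace (\<lambda>t. of_real (t powr (\<alpha> l - 1)) * \<psi> l (of_real t)) (u ^ m) = u ^ (m - l) * S l (u ^ m)"
        unfolding v lapG[OF l w] using Pset_powr[OF m u l] by (simp add: \<alpha>_def)
      with has_integral_set_integral[OF i] show ?thesis
        by (simp add: laplace_def)
    qed
    have "((\<lambda>t. \<Sum>l=1..m. (of_real (t powr (\<alpha> l - 1)) * \<psi> l (of_real t)) * exp (- (u ^ m * of_real t)))
        has_integral (\<Sum>l=1..m. u ^ (m - l) * S l (u ^ m))) {0<..}"
      by (intro has_integral_sum I) auto
    then show "((\<lambda>t. F (complex_of_real (root m t)) * exp (- (u ^ m * complex_of_real t)))
        has_integral (\<Sum>l=1..m. u ^ (m - l) * S l (u ^ m))) {0<..}"
    proof (rule has_integral_eq[rotated])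
      fix t :: real assume "t \<in> {0<..}"
      then have t: "t > 0" by simp
      have rm: "complex_of_real (root m t) ^ m = of_real t"
        using m t by (simp flip: of_real_power)
      have "F (complex_of_real (root m t)) = (\<Sum>l=1..m. of_real (t powr (\<alpha> l - 1)) * \<psi> l (of_real t))"
        unfolding F_def rm sum_divide_distrib
        by (intro sum.cong refl) (simp add: \<alpha>_def root_power_quotient[OF m _ t, symmetric])
      then show "(\<Sum>l=1..m. (of_real (t powr (\<alpha> l - 1)) * \<psi> l (of_real t)) * exp (- (u ^ m * of_real t)))
          = F (complex_of_real (root m t)) * exp (- (u ^ m * complex_of_real t))"
        by (simp add: sum_distrib_right)
    qed
  qed
qed

text \<open>The terms 1 \<le> k \<le> m n fall into n blocks of length m, and the term k = l + m j
  is u^(m - l) times the (j + 1)-st term of f_l at u^m. Truncating f at order m n therefore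
  truncates every f_l at order n, and the m errors add up to the sum of powers of |u|.\<close>

lemma cond2_estimate:
  assumes m: "m \<ge> 1" and c2: "cond2_data m a r B A S" and u: "u \<in> Pset m B" and n: "n \<ge> 1"
  shows "norm (a 0 + (\<Sum>l=1..m. u ^ (m - l) * S l (u ^ m)) - (\<Sum>k=0..m*n. a k / u ^ k))
    \<le> Max (A ` {1..m}) * exp (B * r) * fact n / r ^ n
       * ((\<Sum>i=0..m-1. norm u ^ i) / (norm u ^ (m * n) * (Re (u ^ m) - B)))"
proof -
  have r: "r > 0" using c2 by (simp add: cond2_data_def)
  have u0: "u \<noteq> 0" and w: "Re (u ^ m) > B" using u by (auto simp: Pset_def)
  let ?P = "\<lambda>l. \<Sum>j=1..n. sub_coeff m a l j / (u ^ m) ^ j"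
  have "(\<Sum>k=0..m*n. a k / u ^ k) = a 0 + (\<Sum>l=1..m. u ^ (m - l) * ?P l)"
  proof -
    have "(\<Sum>k=0..m*n. a k / u ^ k) = a 0 + (\<Sum>k=1..m*n. a k / u ^ k)"
      by (simp add: sum.atLeast_Suc_atMost)
    also have "(\<Sum>k=1..m*n. a k / u ^ k) = (\<Sum>k<n * m. a (Suc k) / u ^ Suc k)"
      by (rule sum.reindex_bij_witness[where i = Suc and j = "\<lambda>k. k - 1"]) (auto simp: mult.commute)
    also have "\<dots> = (\<Sum>j<n. \<Sum>k\<in>{j * m..<j * m + m}. a (Suc k) / u ^ Suc k)"
      using sum.nat_group[of "\<lambda>k. a (Suc k) / u ^ Suc k" m n] by simp
    also have "\<dots> = (\<Sum>j<n. \<Sum>l=1..m. u ^ (m - l) * (sub_coeff m a l (Suc j) / (u ^ m) ^ Suc j))"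
    proof (rule sum.cong[OF refl])
      fix j
      have "(\<Sum>k\<in>{j * m..<j * m + m}. a (Suc k) / u ^ Suc k) = (\<Sum>l=1..m. a (l + m * j) / u ^ (l + m * j))"
        by (rule sum.reindex_bij_witness[where i = "\<lambda>l. l - 1 + m * j" and j = "\<lambda>k. Suc k - m * j"]) (auto simp: mult.commute)
      also have "\<dots> = (\<Sum>l=1..m. u ^ (m - l) * (sub_coeff m a l (Suc j) / (u ^ m) ^ Suc j))"
      proof (rule sum.cong[OF refl])
        fix l assume l: "l \<in> {1..m}"
        have "u ^ (m - l) * u ^ (l + m * j) = (u ^ m) ^ Suc j"
          using l by (simp flip: power_add power_mult)
        then show "a (l + m * j) / u ^ (l + m * j) = u ^ (m - l) * (sub_coeff m a l (Suc j) / (u ^ m) ^ Suc j)"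
          using u0 by (simp add: sub_coeff_def field_simps)
      qed
      finally show "(\<Sum>k\<in>{j * m..<j * m + m}. a (Suc k) / u ^ Suc k)
          = (\<Sum>l=1..m. u ^ (m - l) * (sub_coeff m a l (Suc j) / (u ^ m) ^ Suc j))" .
    qed
    also have "\<dots> = (\<Sum>l=1..m. \<Sum>j<n. u ^ (m - l) * (sub_coeff m a l (Suc j) / (u ^ m) ^ Suc j))"
      by (rule sum.swap)
    also have "\<dots> = (\<Sum>l=1..m. u ^ (m - l) * ?P l)"
    proof (rule sum.cong[OF refl])
      fix l
      have "?P l = (\<Sum>j<n. sub_coeff m a l (Suc j) / (u ^ m) ^ Suc j)"
        by (rule sum.reindex_bij_witness[where i = Suc and j = "\<lambda>j. j - 1"]) auto
      then show "(\<Sum>j<n. u ^ (m - l) * (sub_coeff m a l (Suc j) / (u ^ m) ^ Suc j)) = u ^ (m - l) * ?P l"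
        by (simp only: sum_distrib_left)
    qed
    finally show ?thesis .
  qed
  then have "a 0 + (\<Sum>l=1..m. u ^ (m - l) * S l (u ^ m)) - (\<Sum>k=0..m*n. a k / u ^ k)
      = (\<Sum>l=1..m. u ^ (m - l) * (S l (u ^ m) - ?P l))"
    by (simp add: sum_subtractf right_diff_distrib)
  also have "norm \<dots> \<le> (\<Sum>l=1..m. norm u ^ (m - l) * Ras r (Max (A ` {1..m})) B n (u ^ m))"
  proof (rule sum_norm_le)
    fix l assume l: "l \<in> {1..m}"
    have "norm (S l (u ^ m) - ?P l) \<le> Ras r (A l) B n (u ^ m)"
      using c2 l w n unfolding cond2_data_def by blast
    also have "\<dots> \<le> Ras r (Max (A ` {1..m})) B n (u ^ m)"
      unfolding Ras_def using l r w by (intro mult_right_mono divide_right_mono Max_ge) auto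
    finally show "norm (u ^ (m - l) * (S l (u ^ m) - ?P l)) \<le> norm u ^ (m - l) * Ras r (Max (A ` {1..m})) B n (u ^ m)"
      unfolding norm_mult norm_power by (intro mult_left_mono) auto
  qed
  also have "\<dots> = (\<Sum>i=0..m-1. norm u ^ i) * Ras r (Max (A ` {1..m})) B n (u ^ m)"
  proof -
    have "(\<Sum>l=1..m. norm u ^ (m - l)) = (\<Sum>i=0..m-1. norm u ^ i)"
      using m by (intro sum.reindex_bij_witness[where i = "\<lambda>i. m - i" and j = "\<lambda>l. m - l"]) auto
    then show ?thesis by (simp only: sum_distrib_right[symmetric])
  qed
  also have "\<dots> = Max (A ` {1..m}) * exp (B * r) * fact n / r ^ n
       * ((\<Sum>i=0..m-1. norm u ^ i) / (norm u ^ (m * n) * (Re (u ^ m) - B)))"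
    by (simp add: Ras_def norm_power power_mult)
  finally show ?thesis .
qed

lemma cond2_data_borel_sub:
  assumes c2: "cond2_data m a r B A S" and l: "l \<in> {1..m}"
  shows "\<exists>r'>0. \<exists>G. G holomorphic_on Bset r'
    \<and> (\<exists>\<epsilon>>0. \<forall>\<xi>. norm \<xi> < \<epsilon> \<longrightarrow> G \<xi> = borel_sub m a l \<xi>)
    \<and> (\<forall>w. Re w > B \<longrightarrow>
         ((\<lambda>t. G (complex_of_real t) * exp (- (w * complex_of_real t))) has_integral S l w) {0<..})"
proof -
  have r: "r > 0" using c2 by (simp add: cond2_data_def)
  obtain G where G: "G holomorphic_on Bset (r / 2)" "exp_type (r / 4) B G"
    "\<And>\<xi>. norm \<xi> < r / 2 \<Longrightarrow> (\<lambda>j. sub_coeff m a l (Suc j) / fact j * \<xi> ^ j) sums G \<xi>"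
    "\<And>w. Re w > B \<Longrightarrow> laplace (\<lambda>x. G (of_real x)) w = S l w"
    using cond2_borel_transform[OF c2 l] by blast
  have hol4: "G holomorphic_on Bset (r / 4)"
    using r by (intro holomorphic_on_subset[OF G(1) Bset_mono]) simp
  have "G \<xi> = borel_sub m a l \<xi>" if "norm \<xi> < r / 2" for \<xi>
    using G(3)[OF that] by (simp add: borel_sub_def sums_iff)
  moreover have "((\<lambda>t. G (complex_of_real t) * exp (- (w * complex_of_real t))) has_integral S l w) {0<..}" if w: "Re w > B" for w
  proof -
    \<comment> \<open>The case of exponent 1: the weight \<open>t powr (1 - 1)\<close> equals 1 for
      t > 0.\<close>
    have "set_integrable lborel {0<..} (\<lambda>t. (of_real (t powr (1 - 1)) * G (of_real t)) * exp (- (w * of_real t)))"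
      using r w by (intro set_integrable_laplace_exp_type[OF hol4 G(2)]) auto
    then have "set_integrable lborel {0<..} (\<lambda>t. G (of_real t) * exp (- (w * of_real t)))"
      by (rule set_integrable_cong[THEN iffD1, rotated -1]) auto
    from has_integral_set_integral[OF this] G(4)[OF w] show ?thesis
      by (simp add: laplace_def)
  qed
  ultimately show ?thesis
    using G(1) r by (intro exI[of _ "r / 2"] exI[of _ G] conjI) auto
qed

text \<open>\<open>has_integral\<close> expresses convergence and value at once, and
  \<open>root m t\<close> is the coordinate of the point of argument 0 above t. The germ conditions
  identify \<open>G\<close> and \<open>F\<close> as continuations of the two Borel
  transforms.\<close>

theorem theorem4p3:
  fixes m :: nat and a :: "nat \<Rightarrow> complex"
  assumes "m \<ge> 1" and "gevrey1 m a"
  shows "(cond1 m a \<longleftrightarrow> cond2 m a)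
    \<and> (\<forall>r B A S. cond2_data m a r B A S \<longrightarrow>
        (\<forall>l\<in>{1..m}. \<exists>r'>0. \<exists>G. G holomorphic_on Bset r'
            \<and> (\<exists>\<epsilon>>0. \<forall>\<xi>. norm \<xi> < \<epsilon> \<longrightarrow> G \<xi> = borel_sub m a l \<xi>)
            \<and> (\<forall>w. Re w > B \<longrightarrow>
                 ((\<lambda>t. G (complex_of_real t) * exp (- (w * complex_of_real t))) has_integral S l w) {0<..}))
      \<and> (\<exists>r'>0. \<exists>F. F holomorphic_on Dset m r'
            \<and> (\<exists>\<epsilon>>0. \<forall>u. u \<noteq> 0 \<and> norm u < \<epsilon> \<longrightarrow> F u = borel_germ m a u)
            \<and> (\<forall>u\<in>Pset m B.
                 ((\<lambda>t. F (complex_of_real (root m t)) * exp (- (u ^ m * complex_of_real t)))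
                    has_integral (\<Sum>l=1..m. u ^ (m - l) * S l (u ^ m))) {0<..}))
      \<and> (\<forall>u\<in>Pset m B. \<forall>n\<ge>1.
            norm (a 0 + (\<Sum>l=1..m. u ^ (m - l) * S l (u ^ m)) - (\<Sum>k=0..m*n. a k / u ^ k))
              \<le> Max (A ` {1..m}) * exp (B * r) * fact n / r ^ n
                 * ((\<Sum>i=0..m-1. norm u ^ i) / (norm u ^ (m * n) * (Re (u ^ m) - B)))))"
proof (intro conjI allI impI)
  show "cond1 m a \<longleftrightarrow> cond2 m a"
  proof
    assume "cond2 m a"
    then obtain r B A S where "cond2_data m a r B A S"
      unfolding cond2_def by blast
    from cond2_borel_germ[OF assms this] show "cond1 m a"
      unfolding cond1_def by blast
  qed (rule cond1_imp_cond2[OF assms])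
next
  fix r B A S assume c2: "cond2_data m a r B A S"
  show "\<forall>l\<in>{1..m}. \<exists>r'>0. \<exists>G. G holomorphic_on Bset r'
      \<and> (\<exists>\<epsilon>>0. \<forall>\<xi>. norm \<xi> < \<epsilon> \<longrightarrow> G \<xi> = borel_sub m a l \<xi>)
      \<and> (\<forall>w. Re w > B \<longrightarrow>
           ((\<lambda>t. G (complex_of_real t) * exp (- (w * complex_of_real t))) has_integral S l w) {0<..})"
    using cond2_data_borel_sub[OF c2] by blast
  show "\<exists>r'>0. \<exists>F. F holomorphic_on Dset m r'
      \<and> (\<exists>\<epsilon>>0. \<forall>u. u \<noteq> 0 \<and> norm u < \<epsilon> \<longrightarrow> F u = borel_germ m a u)
      \<and> (\<forall>u\<in>Pset m B.
           ((\<lambda>t. F (complex_of_real (root m t)) * exp (- (u ^ m * complex_of_real t)))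
              has_integral (\<Sum>l=1..m. u ^ (m - l) * S l (u ^ m))) {0<..})"
    using cond2_borel_germ[OF assms c2] by blast
  show "\<forall>u\<in>Pset m B. \<forall>n\<ge>1.
      norm (a 0 + (\<Sum>l=1..m. u ^ (m - l) * S l (u ^ m)) - (\<Sum>k=0..m*n. a k / u ^ k))
        \<le> Max (A ` {1..m}) * exp (B * r) * fact n / r ^ n
           * ((\<Sum>i=0..m-1. norm u ^ i) / (norm u ^ (m * n) * (Re (u ^ m) - B)))"
    using cond2_estimate[OF assms(1) c2] by blast
qed

end
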